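(* Let $K, L\subset\mathbb{R}^3$ be convex bodies and let $p\in(0,1)$. If $K$ is in $\mathfrak{R}_1$ class with respect to $L$, then $$\left(\int_{S^2}\left(\frac{h_L}{h_K}\right)^p\,\mathrm{d}\bar V_K\right)^{\frac1p}\ \ge\ \left(\frac{V(L)}{V(K)}\right)^{\frac13}.$$ Equality holds if $K$ and $L$ are dilates.
   Context: A convex body in $\mathbb{R}^3$ is a compact convex set with non-empty interior; $\mathcal{K}^3$ is the set of all of them. $V$ is volume (Lebesgue measure). The support function of $K$ is $h_K(x)=\max\{x\cdot y: y\in K\}$. $S_K$ is the surface area measure of $K$: for Borel $\omega\subseteq S^2$, $S_K(\omega)=\mathcal{H}^2(\nu_K^{-1}(\omega))$, where $\nu_K$ is the Gauss map (outer unit normal), defined on the set of points of $\partial K$ having a unique outer unit normal. For $K$ containing the origin $o$ in its interior, the cone-volume measure $V_K$ is the Borel measure on $S^2$ given by $\mathrm{d}V_K=\frac13 h_K\,\mathrm{d}S_K$, and the cone-volume probability measure is $\bar V_K=\frac{1}{V(K)}V_K$. $K$ and $L$ are dilates if $K=cL$ for some $c>0$. Relative quermassintegrals: for convex bodies $K,L$ in $\mathbb{R}^3$, the numbers $W_i(K,L)$, $i=0,1,2,3$, are the coefficients defined by $V(K+tL)=\sum_{i=0}^3\binom{3}{i}W_i(K,L)t^i$ for all $t\ge 0$ ($+$ is Minkowski sum). In particular $W_0(K,L)=V(K)$ and $W_3(K,L)=V(L)$. The $0$-th relative Bonnesen function is $\mathcal{B}_{0;K,L}(r)=2W_1(K,L)r-W_0(K,L)-W_2(K,L)r^2$.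 When $o\in\mathrm{int}(K\cap L)$ put $r_o(K,L)=\max\{t\ge0: tL\subseteq K\}=\min_{u\in S^2}\frac{h_K(u)}{h_L(u)}$ and $R_o(K,L)=\min\{t>0: tL\supseteq K\}=\max_{u\in S^2}\frac{h_K(u)}{h_L(u)}$. Definition: $K$ is in $\mathfrak{R}_1$ class with respect to $L$ if $o\in\mathrm{int}(K\cap L)$ and $\mathcal{B}_{0;K,L}(r)\ge0$ for all $r\in[r_o(K,L),R_o(K,L)]$. *)

theory Defs
  imports "HOL-Analysis.Analysis" "HOL-Library.Set_Algebras"
begin

definition convex_body :: "(real^3) set \<Rightarrow> bool" where
  "convex_body K \<longleftrightarrow> compact K \<and> convex K \<and> interior K \<noteq> {}"

abbreviation vol :: "(real^3) set \<Rightarrow> real" where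
  "vol \<equiv> measure lebesgue"

text \<open>For a compact nonempty body the supremum is attained, i.e. it is the maximum.\<close>

definition support_fun :: "(real^3) set \<Rightarrow> real^3 \<Rightarrow> real" where
  "support_fun K x = (SUP y\<in>K. x \<bullet> y)"

definition dilates :: "(real^3) set \<Rightarrow> (real^3) set \<Rightarrow> bool" where
  "dilates K L \<longleftrightarrow> (\<exists>c>0. K = (*\<^sub>R) c ` L)"

text \<open>
  Two-dimensional Hausdorff (outer) measure. The factor \<open>pi / 4\<close> is the usual
  normalisation, for which it is surface area on smooth surfaces and planar Lebesgue
  measure on planes. Boundedness is required because \<^const>\<open>diameter\<close> is
  unspecified on unbounded sets.
\<close>

definition hausdorff2_pre :: "real \<Rightarrow> 'a::metric_space set \<Rightarrow> ennreal" where
  "hausdorff2_pre \<delta> A =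
     (INF C \<in> {C :: nat \<Rightarrow> 'a set. A \<subseteq> (\<Union>i. C i) \<and> (\<forall>i. bounded (C i) \<and> diameter (C i) \<le> \<delta>)}.
        \<Sum>i. ennreal (pi / 4 * (diameter (C i))\<^sup>2))"

definition hausdorff2 :: "'a::metric_space set \<Rightarrow> ennreal" where
  "hausdorff2 A = (SUP \<delta>\<in>{0<..}. hausdorff2_pre \<delta> A)"

definition outer_unit_normal :: "(real^3) set \<Rightarrow> real^3 \<Rightarrow> real^3 \<Rightarrow> bool" where
  "outer_unit_normal K x u \<longleftrightarrow> norm u = 1 \<and> (\<forall>y\<in>K. u \<bullet> y \<le> u \<bullet> x)"

definition regular_boundary :: "(real^3) set \<Rightarrow> (real^3) set" where
  "regular_boundary K = {x \<in> frontier K. \<exists>!u. outer_unit_normal K x u}"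

definition gauss_map :: "(real^3) set \<Rightarrow> real^3 \<Rightarrow> real^3" where
  "gauss_map K x = (THE u. outer_unit_normal K x u)"

text \<open>
  A measure on the Borel sets of the unit sphere. For a convex body the set function below
  is countably additive there, so the fallback value of \<^const>\<open>measure_of\<close> is not used.
\<close>

definition surface_area_measure :: "(real^3) set \<Rightarrow> (real^3) measure" where
  "surface_area_measure K =
     measure_of (sphere 0 1) (sets (restrict_space borel (sphere 0 1)))
       (\<lambda>\<omega>. hausdorff2 {x \<in> regular_boundary K. gauss_map K x \<in> \<omega>})"

definition cone_volume_measure :: "(real^3) set \<Rightarrow> (real^3) measure" where
  "cone_volume_measure K =
     density (surface_area_measure K) (\<lambda>u. ennreal (support_fun K u / 3))"

definition cone_volume_prob :: "(real^3) set \<Rightarrow> (real^3) measure" where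
  "cone_volume_prob K = scale_measure (ennreal (1 / vol K)) (cone_volume_measure K)"

text \<open>
  The coefficients are determined uniquely by the polynomial identity on \<open>t \<ge> 0\<close>;
  the condition for \<open>i > 3\<close> only fixes the irrelevant values of the total function.
\<close>

definition rel_quermass :: "(real^3) set \<Rightarrow> (real^3) set \<Rightarrow> nat \<Rightarrow> real" where
  "rel_quermass K L =
     (THE W :: nat \<Rightarrow> real.
        (\<forall>t\<ge>0. vol (K + (*\<^sub>R) t ` L) = (\<Sum>i\<le>3. real (3 choose i) * W i * t ^ i)) \<and>
        (\<forall>i>3. W i = 0))"

definition bonnesen0 :: "(real^3) set \<Rightarrow> (real^3) set \<Rightarrow> real \<Rightarrow> real" where
  "bonnesen0 K L r =
     2 * rel_quermass K L 1 * r - rel_quermass K L 0 - rel_quermass K L 2 * r\<^sup>2"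

text \<open>
  If the origin is interior to both bodies, the supremum and infimum below are attained.
\<close>

definition rel_inradius_o :: "(real^3) set \<Rightarrow> (real^3) set \<Rightarrow> real" where
  "rel_inradius_o K L = Sup {t. 0 \<le> t \<and> (*\<^sub>R) t ` L \<subseteq> K}"

definition rel_circumradius_o :: "(real^3) set \<Rightarrow> (real^3) set \<Rightarrow> real" where
  "rel_circumradius_o K L = Inf {t. 0 < t \<and> K \<subseteq> (*\<^sub>R) t ` L}"

definition in_R1_class :: "(real^3) set \<Rightarrow> (real^3) set \<Rightarrow> bool" where
  "in_R1_class K L \<longleftrightarrow>
     0 \<in> interior (K \<inter> L) \<and>
     (\<forall>r\<in>{rel_inradius_o K L .. rel_circumradius_o K L}. 0 \<le> bonnesen0 K L r)"

end

theory Submission imports Defs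
begin

text \<open>
  Write \<open>f = h\<^sub>L / h\<^sub>K\<close>, \<open>a = W\<^sub>1 / W\<^sub>0\<close> and \<open>q = W\<^sub>2 / W\<^sub>0\<close>. Since \<open>1 / f\<close> lies between
  the relative radii, the \<open>R\<^sub>1\<close> condition says that \<open>f\<^sup>2 - 2 a f + q \<le> 0\<close>, i.e. \<open>f\<close> takes values in
  \<open>[a - d, a + d]\<close> with \<open>(a - d) (a + d) = q\<close>. As the mean of \<open>f\<close> is at least \<open>a\<close> and \<open>x\<^sup>p\<close> lies above
  its chord on that interval, the mean of \<open>f\<^sup>p\<close> is at least \<open>((a - d)\<^sup>p + (a + d)\<^sup>p) / 2 \<ge> q\<^sup>p\<^sup>/\<^sup>2\<close>,
  and Minkowski's inequality \<open>W\<^sub>2\<^sup>3 \<ge> W\<^sub>0 W\<^sub>3\<^sup>2\<close> finishes the argument.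

  The cone-volume measure is the image of Lebesgue measure on \<open>K\<close> under \<open>y \<mapsto> \<nu>\<^sub>K (y / g y)\<close>,
  where \<open>g\<close> is the gauge of \<open>K\<close>: central projection to a tangent plane distorts small boundary
  pieces by a factor close to 1, and on planes the Hausdorff measure is Lebesgue measure by the
  isodiametric inequality and Vitali's covering theorem. In these coordinates points \<open>z\<close> of
  \<open>K + t L\<close> satisfy \<open>g z \<le> 1 + t f\<close>, which yields that the mean of \<open>f\<close> is at least \<open>a\<close>. That
  \<open>V (K + t L)\<close> is a cubic polynomial in \<open>t\<close> follows for polytopes by a change of variables along the
  gradient of \<open>\<phi> + t \<psi>\<close>, with \<open>\<phi>\<close> and \<open>\<psi>\<close> the log-sum-exp functions of the vertices (Gromov), whose
  image is \<open>K + t L\<close> up to a null set.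
\<close>

section \<open>Brunn--Minkowski inequality\<close>

text \<open>Two of the definitions carry information only once an existence question is settled.
  \<open>rel_quermass\<close> is a definite description, so nothing is known about it before the
  volume of \<open>K + t L\<close> is shown to be a cubic polynomial; the change of variables is
  chosen because its Jacobian is a 3 by 3 determinant of the form \<open>det (A + t B)\<close>,
  hence cubic in \<open>t\<close> at every point. \<open>surface_area_measure\<close> is
  \<open>measure_of\<close> an outer measure, so countable additivity must be imported by
  identifying the set function exactly with the image of a density of Lebesgue measure. This takes
  both inequalities between Hausdorff measure and that density.

  The lower bound for the mean of \<open>f\<close> passes to \<open>f^p\<close> because the chord
  has nonnegative slope. Since \<open>a\<close> is the midpoint of the interval, the chord at
  \<open>a\<close> is the average of the end values, and their geometric mean depends only on the
  product \<open>q\<close> of the endpoints.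

  Brunn-Minkowski enters twice: applied to a plane set and its reflection it gives the isodiametric
  inequality, and through the growth of the volume of \<open>K + t L\<close> for large
  \<open>t\<close> it gives Minkowski's inequality.\<close>

lemma root_prod_superadditive:
  fixes x y :: "'a \<Rightarrow> real"
  assumes S: "finite S" "S \<noteq> {}" and x: "\<And>i. i \<in> S \<Longrightarrow> 0 < x i" and y: "\<And>i. i \<in> S \<Longrightarrow> 0 < y i"
  shows "root (card S) (\<Prod>i\<in>S. x i) + root (card S) (\<Prod>i\<in>S. y i)
           \<le> root (card S) (\<Prod>i\<in>S. x i + y i)"
proof -
  let ?n = "card S"
  have n: "0 < ?n" using S by (simp add: card_gt_0_iff)
  have pos: "0 < x i + y i" if "i \<in> S" for i using x[OF that] y[OF that] by simp
  have P: "0 < (\<Prod>i\<in>S. x i + y i)" by (rule prod_pos) (use pos in auto)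
  \<comment> \<open>Arithmetic-geometric mean inequality for the ratios
    \<open>z i / (x i + y i)\<close>. It is applied to \<open>x\<close> and to \<open>y\<close>, and
    the two arithmetic means add up to 1.\<close>
  have am: "root ?n (\<Prod>i\<in>S. z i) / root ?n (\<Prod>i\<in>S. x i + y i) \<le> (\<Sum>i\<in>S. z i / (x i + y i) / ?n)"
    if z: "\<And>i. i \<in> S \<Longrightarrow> 0 < z i" for z
  proof -
    have q: "0 < (\<Prod>i\<in>S. z i / (x i + y i))" by (rule prod_pos) (use pos z in auto)
    have "(\<Prod>i\<in>S. z i / (x i + y i)) powr (1 / ?n) \<le> (\<Sum>i\<in>S. z i / (x i + y i) / ?n)"
      by (rule arith_geom_mean[OF S]) (use pos z in \<open>simp add: less_imp_le\<close>)
    also have "(\<Prod>i\<in>S. z i / (x i + y i)) powr (1 / ?n) = root ?n (\<Prod>i\<in>S. z i / (x i + y i))"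
      by (simp add: root_powr_inverse[OF n less_imp_le[OF q]])
    also have "\<dots> = root ?n (\<Prod>i\<in>S. z i) / root ?n (\<Prod>i\<in>S. x i + y i)"
      by (simp add: prod_dividef real_root_divide)
    finally show ?thesis .
  qed
  have "(\<Sum>i\<in>S. x i / (x i + y i) / ?n) + (\<Sum>i\<in>S. y i / (x i + y i) / ?n) = (\<Sum>i\<in>S. 1 / ?n)"
    unfolding sum.distrib[symmetric]
  proof (rule sum.cong)
    fix i assume "i \<in> S"
    from pos[OF this] show "x i / (x i + y i) / ?n + y i / (x i + y i) / ?n = 1 / ?n"
      by (metis add_divide_distrib divide_self_if less_numeral_extra(3))
  qed simp
  also have "\<dots> = 1" using n by simp
  finally have "root ?n (\<Prod>i\<in>S. x i) / root ?n (\<Prod>i\<in>S. x i + y i)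
      + root ?n (\<Prod>i\<in>S. y i) / root ?n (\<Prod>i\<in>S. x i + y i) \<le> 1"
    using am[of x, OF x] am[of y, OF y] by linarith
  moreover have "0 < root ?n (\<Prod>i\<in>S. x i + y i)" using P n by simp
  ultimately show ?thesis by (simp add: add_divide_distrib[symmetric])
qed

lemma compact_set_plus:
  fixes A B :: "'a::real_normed_vector set"
  assumes "compact A" "compact B" shows "compact (A + B)"
proof -
  have "A + B = {x + y |x y. x \<in> A \<and> y \<in> B}" by (auto simp: set_plus_def)
  then show ?thesis using compact_sums[OF assms] by simp
qed

lemma cbox_set_plus:
  fixes a b c d :: "'a::euclidean_space"
  assumes "box a b \<noteq> {}" "box c d \<noteq> {}"
  shows "cbox (a + c) (b + d) \<subseteq> cbox a b + cbox c d"
proof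
  fix x assume x: "x \<in> cbox (a + c) (b + d)"
  have ab: "a \<bullet> i < b \<bullet> i" "c \<bullet> i < d \<bullet> i" if "i \<in> Basis" for i
    using assms that by (auto simp: box_ne_empty)
  \<comment> \<open>In each coordinate the smallest admissible first summand: not below
    \<open>a\<close>, and large enough that the remainder \<open>x - y\<close> does not exceed
    \<open>d\<close>.\<close>
  define y where "y = (\<Sum>i\<in>Basis. max (a \<bullet> i) (x \<bullet> i - d \<bullet> i) *\<^sub>R i)"
  have yi: "y \<bullet> i = max (a \<bullet> i) (x \<bullet> i - d \<bullet> i)" if "i \<in> Basis" for i
    using that by (simp add: y_def)
  have xi: "a \<bullet> i + c \<bullet> i \<le> x \<bullet> i \<and> x \<bullet> i \<le> b \<bullet> i + d \<bullet> i" if "i \<in> Basis" for i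
    using x that by (auto simp: mem_box inner_add_left)
  have "y \<in> cbox a b"
    unfolding mem_box
  proof
    fix i :: 'a assume i: "i \<in> Basis"
    show "a \<bullet> i \<le> y \<bullet> i \<and> y \<bullet> i \<le> b \<bullet> i"
      using ab[OF i] xi[OF i] unfolding yi[OF i] by linarith
  qed
  moreover have "x - y \<in> cbox c d"
    unfolding mem_box inner_diff_left
  proof
    fix i :: 'a assume i: "i \<in> Basis"
    show "c \<bullet> i \<le> x \<bullet> i - y \<bullet> i \<and> x \<bullet> i - y \<bullet> i \<le> d \<bullet> i"
      using ab[OF i] xi[OF i] unfolding yi[OF i] by linarith
  qed
  ultimately show "x \<in> cbox a b + cbox c d"
    using set_plus_intro[of y "cbox a b" "x - y"] by simp
qed

abbreviation leb :: "'a::euclidean_space set \<Rightarrow> real" where "leb \<equiv> measure lebesgue"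

lemma brunn_minkowski_cbox:
  fixes a b c d :: "'a::euclidean_space"
  assumes ab: "box a b \<noteq> {}" and cd: "box c d \<noteq> {}"
  shows "root DIM('a) (leb (cbox a b)) + root DIM('a) (leb (cbox c d))
           \<le> root DIM('a) (leb (cbox a b + cbox c d))"
proof -
  have abi: "a \<bullet> i < b \<bullet> i" "c \<bullet> i < d \<bullet> i" if "i \<in> Basis" for i
    using assms that by (auto simp: box_ne_empty)
  have m: "leb (cbox u v) = (\<Prod>i\<in>Basis. (v - u) \<bullet> i)" if "\<And>i. i \<in> Basis \<Longrightarrow> u \<bullet> i \<le> v \<bullet> i" for u v :: 'a
    using that content_cbox[of u v] by (simp add: inner_diff_left)
  have "root DIM('a) (leb (cbox a b)) + root DIM('a) (leb (cbox c d))
      = root DIM('a) (\<Prod>i\<in>Basis. (b - a) \<bullet> i) + root DIM('a) (\<Prod>i\<in>Basis. (d - c) \<bullet> i)"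
    using abi by (simp add: m less_imp_le)
  also have "\<dots> \<le> root DIM('a) (\<Prod>i\<in>Basis. (b - a) \<bullet> i + (d - c) \<bullet> i)"
    by (rule root_prod_superadditive) (use abi in \<open>auto simp: inner_diff_left\<close>)
  also have "(\<Prod>i\<in>Basis. (b - a) \<bullet> i + (d - c) \<bullet> i) = leb (cbox (a + c) (b + d))"
    by (subst m) (use abi in \<open>auto simp: inner_diff_left inner_add_left algebra_simps less_imp_le intro: add_mono\<close>)
  also have "root DIM('a) (leb (cbox (a + c) (b + d))) \<le> root DIM('a) (leb (cbox a b + cbox c d))"
    by (intro real_root_le_mono measure_mono_fmeasurable cbox_set_plus assms lmeasurable_compact compact_set_plus) auto
  finally show ?thesis .
qed


section \<open>Hyperplane cuts and families of boxes\<close>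

lemma halfspace_measure_split:
  fixes S :: "'a::euclidean_space set"
  assumes S: "S \<in> lmeasurable" and i: "i \<in> Basis"
  shows "leb S = leb (S \<inter> {x. x \<bullet> i \<le> c}) + leb (S \<inter> {x. x \<bullet> i \<ge> c})"
    and "S \<inter> {x. x \<bullet> i \<le> c} \<in> lmeasurable" "S \<inter> {x. x \<bullet> i \<ge> c} \<in> lmeasurable"
proof -
  have cl: "closed {x. x \<bullet> i \<le> c}" "closed {x. x \<bullet> i \<ge> c}"
    by (simp_all add: closed_halfspace_component_le closed_halfspace_component_ge)
  show m: "S \<inter> {x. x \<bullet> i \<le> c} \<in> lmeasurable" "S \<inter> {x. x \<bullet> i \<ge> c} \<in> lmeasurable"
    using cl by (auto intro!: fmeasurable_Int_fmeasurable[OF S])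
  have i0: "i \<noteq> 0" using i by auto
  have "negligible {x. i \<bullet> x = c}"
    using i0 by (intro negligible_hyperplane) auto
  then have "negligible (S \<inter> {x. x \<bullet> i \<le> c} \<inter> (S \<inter> {x. x \<bullet> i \<ge> c}))"
    by (rule negligible_subset) (auto simp: inner_commute)
  from negligible_imp_measure0[OF this] measure_Un3[OF m]
  have "leb (S \<inter> {x. x \<bullet> i \<le> c} \<union> S \<inter> {x. x \<bullet> i \<ge> c}) = leb (S \<inter> {x. x \<bullet> i \<le> c}) + leb (S \<inter> {x. x \<bullet> i \<ge> c})"
    by simp
  moreover have "S \<inter> {x. x \<bullet> i \<le> c} \<union> S \<inter> {x. x \<bullet> i \<ge> c} = S" by auto
  ultimately show "leb S = leb (S \<inter> {x. x \<bullet> i \<le> c}) + leb (S \<inter> {x. x \<bullet> i \<ge> c})" by simp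
qed

text \<open>Along a sequence tending to \<open>c\<close> the indicators are eventually constant at
  every point off the null hyperplane x \<bullet> i = c, so dominated convergence applies.
  Continuity is what lets a cut realise a prescribed volume ratio.\<close>

lemma continuous_halfspace_measure:
  fixes S :: "'a::euclidean_space set"
  assumes S: "S \<in> lmeasurable" and i: "i \<in> Basis"
  shows "continuous_on UNIV (\<lambda>c. leb (S \<inter> {x. x \<bullet> i \<le> c}))"
  unfolding continuous_on_sequentially
proof (intro allI ballI impI, elim conjE)
  fix X :: "nat \<Rightarrow> real" and c :: real assume X: "X \<longlonglongrightarrow> c"
  have i0: "i \<noteq> 0" using i by auto
  have "{x. i \<bullet> x = c} \<in> null_sets lebesgue"
    using negligible_hyperplane[of i c] i0 by (simp add: negligible_iff_null_sets)
  then have ae: "AE x in lebesgue. x \<bullet> i \<noteq> c"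
    by (rule AE_I') (auto simp: inner_commute)
  have meas: "S \<inter> {x. x \<bullet> i \<le> d} \<in> lmeasurable" for d
    using halfspace_measure_split[OF S i] by blast
  have "(\<lambda>n. integral\<^sup>L lebesgue (indicat_real (S \<inter> {x. x \<bullet> i \<le> X n}))) \<longlonglongrightarrow> integral\<^sup>L lebesgue (indicat_real (S \<inter> {x. x \<bullet> i \<le> c}))"
  proof (rule integral_dominated_convergence[where w = "indicat_real S"])
    show "integrable lebesgue (indicat_real S)"
      using S by (simp add: lmeasurable_iff_integrable)
    show "AE x in lebesgue. (\<lambda>n. indicat_real (S \<inter> {x. x \<bullet> i \<le> X n}) x) \<longlonglongrightarrow> indicat_real (S \<inter> {x. x \<bullet> i \<le> c}) x"
      using ae
    proof eventually_elim
      case (elim x)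
      have "\<forall>\<^sub>F n in sequentially. indicat_real (S \<inter> {x. x \<bullet> i \<le> X n}) x = indicat_real (S \<inter> {x. x \<bullet> i \<le> c}) x"
      proof (cases "x \<bullet> i < c")
        case True
        show ?thesis using order_tendstoD(1)[OF X True] by (rule eventually_mono) (use True in \<open>auto simp: indicator_def\<close>)
      next
        case False
        then have cx: "c < x \<bullet> i" using elim by simp
        show ?thesis using order_tendstoD(2)[OF X cx] by (rule eventually_mono) (use cx in \<open>auto simp: indicator_def\<close>)
      qed
      then show ?case by (rule tendsto_eventually)
    qed
    show "AE x in lebesgue. norm (indicat_real (S \<inter> {x. x \<bullet> i \<le> X n}) x) \<le> indicat_real S x" for n
      by (auto simp: indicator_def)
  qed (intro borel_measurable_indicator fmeasurableD[OF meas])+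
  then show "((\<lambda>c. leb (S \<inter> {x. x \<bullet> i \<le> c})) \<circ> X) \<longlonglongrightarrow> leb (S \<inter> {x. x \<bullet> i \<le> c})"
    by (simp add: comp_def)
qed

lemma exists_halfspace_ratio:
  fixes S :: "'a::euclidean_space set"
  assumes S: "compact S" and i: "i \<in> Basis" and \<theta>: "0 \<le> \<theta>" "\<theta> \<le> 1"
  shows "\<exists>c. leb (S \<inter> {x. x \<bullet> i \<le> c}) = \<theta> * leb S"
proof -
  obtain B where B: "\<And>x. x \<in> S \<Longrightarrow> norm x \<le> B" and "B > 0"
    using compact_imp_bounded[OF S] bounded_pos by metis
  have ab: "\<bar>x \<bullet> i\<bar> \<le> B" if "x \<in> S" for x using Basis_le_norm[OF i, of x] B[OF that] by linarith
  let ?F = "\<lambda>c. leb (S \<inter> {x. x \<bullet> i \<le> c})"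
  \<comment> \<open>The half-spaces are closed, so the lower end has to lie strictly below
    \<open>- B\<close>.\<close>
  have 1: "S \<inter> {x. x \<bullet> i \<le> - B - 1} = {}" using ab by fastforce
  have 2: "S \<inter> {x. x \<bullet> i \<le> B} = S" using ab by fastforce
  have "\<exists>c. - B - 1 \<le> c \<and> c \<le> B \<and> ?F c = \<theta> * leb S"
  proof (rule IVT')
    show "?F (- B - 1) \<le> \<theta> * leb S" using \<theta> by (simp add: 1)
    show "\<theta> * leb S \<le> ?F B" using \<theta> by (simp add: 2 mult_left_le_one_le)
    show "continuous_on {- B - 1..B} ?F"
      by (rule continuous_on_subset[OF continuous_halfspace_measure[OF lmeasurable_compact[OF S] i]]) simp
  qed (use \<open>B > 0\<close> in simp)
  then show ?thesis by blast
qed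

text \<open>Closed boxes make unions and their Minkowski sums compact, hence measurable;
  nondegeneracy gives every nonempty family positive volume.\<close>

definition box_family :: "'a::euclidean_space set set \<Rightarrow> bool" where
  "box_family \<A> \<longleftrightarrow> finite \<A> \<and> (\<forall>Q\<in>\<A>. \<exists>a b. Q = cbox a b \<and> box a b \<noteq> {})
     \<and> pairwise (\<lambda>A B. interior A \<inter> interior B = {}) \<A>"

lemma box_family_compact: "box_family \<A> \<Longrightarrow> compact (\<Union>\<A>)"
  unfolding box_family_def by (auto intro!: compact_Union)

text \<open>Boxes left with empty interior by the cut are dropped. This costs only a null set, which
  is why the union is merely contained in the cut set while the volumes agree, and it is what lowers
  the number of boxes in the induction.\<close>

lemma box_family_cut:
  fixes \<A> :: "'a::euclidean_space set set"
  assumes A: "box_family \<A>" and i: "i \<in> Basis" and H: "H = {x. x \<bullet> i \<le> c} \<or> H = {x. x \<bullet> i \<ge> c}"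
  obtains \<A>' where "box_family \<A>'" "card \<A>' \<le> card \<A>" "\<Union>\<A>' \<subseteq> \<Union>\<A> \<inter> H" "leb (\<Union>\<A>') = leb (\<Union>\<A> \<inter> H)"
    "Q \<in> \<A> \<Longrightarrow> interior (Q \<inter> H) = {} \<Longrightarrow> card \<A>' < card \<A>"
proof -
  define \<A>' where "\<A>' = (\<lambda>Q. Q \<inter> H) ` {Q \<in> \<A>. interior (Q \<inter> H) \<noteq> {}}"
  have fin: "finite \<A>" using A by (simp add: box_family_def)
  have cb: "\<exists>a b. Q \<inter> H = cbox a b" if "Q \<in> \<A>" for Q
  proof -
    have "\<exists>a b. Q = cbox a b \<and> box a b \<noteq> {}" using A that by (simp add: box_family_def)
    then obtain a b where Q: "Q = cbox a b" by (elim exE conjE)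
    from H show ?thesis
    proof
      assume "H = {x. x \<bullet> i \<le> c}"
      then show ?thesis unfolding Q by (simp only: interval_split(1)[OF i]) (rule exI, rule exI, rule refl)
    next
      assume "H = {x. x \<bullet> i \<ge> c}"
      then show ?thesis unfolding Q by (simp only: interval_split(2)[OF i]) (rule exI, rule exI, rule refl)
    qed
  qed
  have bf: "box_family \<A>'"
    unfolding box_family_def
  proof (intro conjI ballI)
    show "finite \<A>'" using fin by (simp add: \<A>'_def)
    fix R assume "R \<in> \<A>'"
    then obtain Q where Q: "Q \<in> \<A>" "interior (Q \<inter> H) \<noteq> {}" "R = Q \<inter> H" by (auto simp: \<A>'_def)
    obtain a b where "Q \<inter> H = cbox a b" using cb[OF Q(1)] by blast
    with Q have "R = cbox a b" "box a b \<noteq> {}" by (simp_all add: interior_cbox)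
    then show "\<exists>a b. R = cbox a b \<and> box a b \<noteq> {}" by (intro exI conjI)
  next
    show "pairwise (\<lambda>A B. interior A \<inter> interior B = {}) \<A>'"
    proof (rule pairwiseI)
      fix R R' assume "R \<in> \<A>'" "R' \<in> \<A>'" "R \<noteq> R'"
      then obtain Q Q' where Q: "Q \<in> \<A>" "R = Q \<inter> H" "Q' \<in> \<A>" "R' = Q' \<inter> H" by (auto simp: \<A>'_def)
      with \<open>R \<noteq> R'\<close> have "Q \<noteq> Q'" by auto
      then have "interior Q \<inter> interior Q' = {}" using A Q unfolding box_family_def pairwise_def by metis
      then show "interior R \<inter> interior R' = {}" unfolding Q by (auto simp: interior_Int)
    qed
  qed
  show thesis
  proof (rule that[OF bf])
    have "card \<A>' \<le> card {Q \<in> \<A>. interior (Q \<inter> H) \<noteq> {}}"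
      unfolding \<A>'_def using fin by (intro card_image_le) auto
    also have "\<dots> \<le> card \<A>" using fin by (intro card_mono) auto
    finally show "card \<A>' \<le> card \<A>" .
    show sub: "\<Union>\<A>' \<subseteq> \<Union>\<A> \<inter> H" by (auto simp: \<A>'_def)
    have "negligible (\<Union>((\<lambda>Q. Q \<inter> H) ` {Q \<in> \<A>. interior (Q \<inter> H) = {}}))"
    proof (rule negligible_Union)
      fix R assume "R \<in> (\<lambda>Q. Q \<inter> H) ` {Q \<in> \<A>. interior (Q \<inter> H) = {}}"
      then obtain Q where Q: "Q \<in> \<A>" "interior (Q \<inter> H) = {}" "R = Q \<inter> H" by auto
      obtain a b where "Q \<inter> H = cbox a b" using cb[OF Q(1)] by blast
      then show "negligible R" using Q by (simp add: negligible_interval)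
    qed (use fin in simp)
    then have "negligible (\<Union>\<A> \<inter> H - \<Union>\<A>')"
      by (rule negligible_subset) (auto simp: \<A>'_def)
    moreover have "\<Union>\<A>' - \<Union>\<A> \<inter> H = {}" using sub by blast
    then have "negligible (\<Union>\<A>' - \<Union>\<A> \<inter> H)" by simp
    ultimately have "negligible (\<Union>\<A>' - \<Union>\<A> \<inter> H \<union> (\<Union>\<A> \<inter> H - \<Union>\<A>'))" by (simp add: negligible_Un)
    from measure_negligible_symdiff[OF lmeasurable_compact[OF box_family_compact[OF bf]] this]
    show "leb (\<Union>\<A>') = leb (\<Union>\<A> \<inter> H)" by (rule sym)
    assume Q: "Q \<in> \<A>" "interior (Q \<inter> H) = {}"
    have "card \<A>' \<le> card {Q \<in> \<A>. interior (Q \<inter> H) \<noteq> {}}"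
      unfolding \<A>'_def using fin by (intro card_image_le) auto
    also have "\<dots> < card \<A>" using fin Q by (intro psubset_card_mono) auto
    finally show "card \<A>' < card \<A>" .
  qed
qed

text \<open>If the open intervals overlapped in every coordinate, the midpoints of the overlaps
  would form a common point of the open boxes.\<close>

lemma separate_boxes:
  fixes a b c d :: "'a::euclidean_space"
  assumes "box a b \<noteq> {}" "box c d \<noteq> {}" "box a b \<inter> box c d = {}"
  shows "\<exists>i\<in>Basis. \<exists>t. (cbox a b \<subseteq> {x. x \<bullet> i \<le> t} \<and> cbox c d \<subseteq> {x. x \<bullet> i \<ge> t})
     \<or> (cbox c d \<subseteq> {x. x \<bullet> i \<le> t} \<and> cbox a b \<subseteq> {x. x \<bullet> i \<ge> t})"
proof -
  have ab: "a \<bullet> i < b \<bullet> i" "c \<bullet> i < d \<bullet> i" if "i \<in> Basis" for i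
    using assms that by (auto simp: box_ne_empty)
  have "\<exists>i\<in>Basis. b \<bullet> i \<le> c \<bullet> i \<or> d \<bullet> i \<le> a \<bullet> i"
  proof (rule ccontr)
    assume "\<not> (\<exists>i\<in>Basis. b \<bullet> i \<le> c \<bullet> i \<or> d \<bullet> i \<le> a \<bullet> i)"
    then have n: "a \<bullet> i < d \<bullet> i \<and> c \<bullet> i < b \<bullet> i" if "i \<in> Basis" for i using that by (auto simp: not_le)
    define x where "x = (\<Sum>i\<in>Basis. ((max (a \<bullet> i) (c \<bullet> i) + min (b \<bullet> i) (d \<bullet> i)) / 2) *\<^sub>R i)"
    have xi: "x \<bullet> i = (max (a \<bullet> i) (c \<bullet> i) + min (b \<bullet> i) (d \<bullet> i)) / 2" if "i \<in> Basis" for i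
      using that by (simp add: x_def)
    have "x \<in> box a b \<inter> box c d"
      unfolding Int_iff mem_box
    proof (intro conjI ballI)
      fix i :: 'a assume i: "i \<in> Basis"
      show "a \<bullet> i < x \<bullet> i" "x \<bullet> i < b \<bullet> i" "c \<bullet> i < x \<bullet> i" "x \<bullet> i < d \<bullet> i"
        unfolding xi[OF i] using n[OF i] ab[OF i] by (auto simp: max_def min_def)
    qed
    then show False using assms(3) by auto
  qed
  then obtain i where i: "i \<in> Basis" and sep: "b \<bullet> i \<le> c \<bullet> i \<or> d \<bullet> i \<le> a \<bullet> i" by blast
  from sep show ?thesis
  proof
    assume "b \<bullet> i \<le> c \<bullet> i"
    then show ?thesis using i by (intro bexI[of _ i] exI[of _ "b \<bullet> i"]) (auto simp: mem_box intro: order_trans)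
  next
    assume "d \<bullet> i \<le> a \<bullet> i"
    then show ?thesis using i by (intro bexI[of _ i] exI[of _ "d \<bullet> i"]) (auto simp: mem_box intro: order_trans)
  qed
qed

text \<open>Hadwiger and Ohmann: cut one family by a hyperplane separating two of its boxes and the other by a
  parallel hyperplane in the same volume ratio; both halves then have fewer boxes in total.\<close>

lemma brunn_minkowski_box_family_aux:
  fixes S T S1 S2 T1 T2 :: "'a::euclidean_space set"
  assumes "compact S" "compact T" and i: "i \<in> Basis"
    and sub: "S1 \<subseteq> S \<inter> {x. x \<bullet> i \<le> c}" "S2 \<subseteq> S \<inter> {x. x \<bullet> i \<ge> c}"
      "T1 \<subseteq> T \<inter> {x. x \<bullet> i \<le> d}" "T2 \<subseteq> T \<inter> {x. x \<bullet> i \<ge> d}"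
    and \<theta>: "0 < \<theta>" "\<theta> < 1"
    and m: "leb S1 = \<theta> * leb S" "leb S2 = (1 - \<theta>) * leb S" "leb T1 = \<theta> * leb T" "leb T2 = (1 - \<theta>) * leb T"
    and c: "compact S1" "compact S2" "compact T1" "compact T2"
    and bm1: "root DIM('a) (leb S1) + root DIM('a) (leb T1) \<le> root DIM('a) (leb (S1 + T1))"
    and bm2: "root DIM('a) (leb S2) + root DIM('a) (leb T2) \<le> root DIM('a) (leb (S2 + T2))"
  shows "root DIM('a) (leb S) + root DIM('a) (leb T) \<le> root DIM('a) (leb (S + T))"
proof -
  let ?n = "DIM('a)" and ?r = "root DIM('a) (leb S) + root DIM('a) (leb T)"
  have n: "0 < ?n" by simp
  have r0: "0 \<le> ?r" by simp
  \<comment> \<open>Both parts carry the same fraction \<open>t\<close> of their volumes, so the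
    n-th power of the inequality for the parts is linear in \<open>t\<close>, and the bounds for
    \<theta> and 1 - \<theta> can be added.\<close>
  have lower: "t * ?r ^ ?n \<le> leb (S' + T')"
    if "leb S' = t * leb S" "leb T' = t * leb T" "0 \<le> t"
      "root ?n (leb S') + root ?n (leb T') \<le> root ?n (leb (S' + T'))" for S' T' :: "'a set" and t
  proof -
    have "root ?n t * ?r \<le> root ?n (leb (S' + T'))"
      using that by (simp add: real_root_mult algebra_simps)
    then have "(root ?n t * ?r) ^ ?n \<le> root ?n (leb (S' + T')) ^ ?n"
      by (rule power_mono) (use that r0 in simp)
    then show ?thesis using that n by (simp add: power_mult_distrib del: real_root_mult)
  qed
  have ST: "S + T \<in> lmeasurable" by (intro lmeasurable_compact compact_set_plus assms)
  \<comment> \<open>The two partial sums lie on opposite sides of the hyperplane x \<bullet> i = c +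
    d, so their volumes add up inside \<open>S + T\<close>.\<close>
  have sum1: "S1 + T1 \<subseteq> (S + T) \<inter> {x. x \<bullet> i \<le> c + d}"
    using sub by (auto simp: set_plus_def inner_add_left) (fastforce intro: add_mono)+
  have sum2: "S2 + T2 \<subseteq> (S + T) \<inter> {x. x \<bullet> i \<ge> c + d}"
    using sub by (auto simp: set_plus_def inner_add_left) (fastforce intro: add_mono)+
  have "?r ^ ?n = \<theta> * ?r ^ ?n + (1 - \<theta>) * ?r ^ ?n" by (simp add: algebra_simps)
  also have "\<dots> \<le> leb (S1 + T1) + leb (S2 + T2)"
    using lower[OF m(1,3) _ bm1] lower[OF m(2,4) _ bm2] \<theta> by simp
  also have "\<dots> \<le> leb ((S + T) \<inter> {x. x \<bullet> i \<le> c + d}) + leb ((S + T) \<inter> {x. x \<bullet> i \<ge> c + d})"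
    by (intro add_mono measure_mono_fmeasurable sum1 sum2 halfspace_measure_split[OF ST i] fmeasurableD lmeasurable_compact compact_set_plus c)
  also have "\<dots> = leb (S + T)" using halfspace_measure_split(1)[OF ST i] by simp
  finally have "?r ^ ?n \<le> leb (S + T)" .
  then have "root ?n (?r ^ ?n) \<le> root ?n (leb (S + T))" using n by (simp only: real_root_le_mono)
  then show ?thesis using r0 n by (simp add: real_root_power_cancel)
qed

lemma box_family_measure_pos:
  fixes \<A> :: "'a::euclidean_space set set"
  assumes A: "box_family \<A>" and ne: "\<A> \<noteq> {}"
  shows "0 < leb (\<Union>\<A>)"
proof -
  obtain Q where Q: "Q \<in> \<A>" using ne by auto
  then obtain a b where ab: "Q = cbox a b" "box a b \<noteq> {}" using A unfolding box_family_def by metis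
  have "0 < leb (cbox a b)" using ab(2) by (simp add: content_pos_lt_eq box_ne_empty)
  also have "\<dots> \<le> leb (\<Union>\<A>)"
    by (intro measure_mono_fmeasurable lmeasurable_compact[OF box_family_compact[OF A]]) (use Q ab in auto)
  finally show ?thesis .
qed

text \<open>The induction hypothesis is an explicit assumption, so that the same step serves with
  the two families exchanged when it is the second one that contains two boxes.\<close>

lemma brunn_minkowski_box_family_step:
  fixes \<A> \<B> :: "'a::euclidean_space set set"
  assumes A: "box_family \<A>" and B: "box_family \<B>" "\<B> \<noteq> {}" and Q: "Q \<in> \<A>" "R \<in> \<A>" "Q \<noteq> R"
    and IH: "\<And>\<A>' \<B>' :: 'a set set. box_family \<A>' \<Longrightarrow> box_family \<B>' \<Longrightarrow> \<A>' \<noteq> {} \<Longrightarrow> \<B>' \<noteq> {} \<Longrightarrow>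
       card \<A>' + card \<B>' < card \<A> + card \<B> \<Longrightarrow>
       root DIM('a) (leb (\<Union>\<A>')) + root DIM('a) (leb (\<Union>\<B>')) \<le> root DIM('a) (leb (\<Union>\<A>' + \<Union>\<B>'))"
  shows "root DIM('a) (leb (\<Union>\<A>)) + root DIM('a) (leb (\<Union>\<B>)) \<le> root DIM('a) (leb (\<Union>\<A> + \<Union>\<B>))"
proof -
  have bx: "\<exists>a b. X = cbox a b \<and> box a b \<noteq> {}" if "X \<in> \<A>" for X
    using A that unfolding box_family_def by blast
  have "interior Q \<inter> interior R = {}" using A Q unfolding box_family_def pairwise_def by blast
  then have "\<exists>i\<in>Basis. \<exists>t. (Q \<subseteq> {x. x \<bullet> i \<le> t} \<and> R \<subseteq> {x. x \<bullet> i \<ge> t}) \<or> (R \<subseteq> {x. x \<bullet> i \<le> t} \<and> Q \<subseteq> {x. x \<bullet> i \<ge> t})"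
    using bx[OF Q(1)] bx[OF Q(2)] separate_boxes by (metis interior_cbox)
  then obtain i t Q1 Q2 where i: "i \<in> Basis" and Q12: "Q1 \<in> \<A>" "Q2 \<in> \<A>"
    "Q1 \<subseteq> {x. x \<bullet> i \<le> t}" "Q2 \<subseteq> {x. x \<bullet> i \<ge> t}" using Q by metis
  have i0: "i \<noteq> 0" using i by auto
  have flat: "interior ({x. x \<bullet> i \<le> t} \<inter> {x. x \<bullet> i \<ge> t}) = {}"
  proof -
    have "{x. x \<bullet> i \<le> t} \<inter> {x. x \<bullet> i \<ge> t} = {x. i \<bullet> x = t}" by (auto simp: inner_commute)
    then show ?thesis using i0 by (simp add: interior_hyperplane)
  qed
  \<comment> \<open>Each half-space flattens one of the two separated boxes, so both halves of
    \<open>\<A>\<close> have strictly fewer boxes.\<close>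
  have e1: "interior (Q1 \<inter> {x. x \<bullet> i \<ge> t}) = {}"
    using interior_mono[of "Q1 \<inter> {x. x \<bullet> i \<ge> t}" "{x. x \<bullet> i \<le> t} \<inter> {x. x \<bullet> i \<ge> t}"] Q12(3) flat by blast
  have e2: "interior (Q2 \<inter> {x. x \<bullet> i \<le> t}) = {}"
    using interior_mono[of "Q2 \<inter> {x. x \<bullet> i \<le> t}" "{x. x \<bullet> i \<le> t} \<inter> {x. x \<bullet> i \<ge> t}"] Q12(4) flat by blast
  let ?S = "\<Union>\<A>" and ?T = "\<Union>\<B>"
  have cS: "compact ?S" and cT: "compact ?T" using A B box_family_compact by auto
  have Sm: "?S \<in> lmeasurable" and Tm: "?T \<in> lmeasurable" using cS cT lmeasurable_compact by auto
  have pS: "0 < leb ?S" and pT: "0 < leb ?T" using box_family_measure_pos A B Q by blast+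
  obtain \<A>1 where A1: "box_family \<A>1" "card \<A>1 < card \<A>" "\<Union>\<A>1 \<subseteq> ?S \<inter> {x. x \<bullet> i \<le> t}"
     "leb (\<Union>\<A>1) = leb (?S \<inter> {x. x \<bullet> i \<le> t})"
    using box_family_cut[OF A i, of "{x. x \<bullet> i \<le> t}" t Q2] Q12(2) e2 by metis
  obtain \<A>2 where A2: "box_family \<A>2" "card \<A>2 < card \<A>" "\<Union>\<A>2 \<subseteq> ?S \<inter> {x. x \<bullet> i \<ge> t}"
     "leb (\<Union>\<A>2) = leb (?S \<inter> {x. x \<bullet> i \<ge> t})"
    using box_family_cut[OF A i, of "{x. x \<bullet> i \<ge> t}" t Q1] Q12(1) e1 by metis
  have posQ: "0 < leb (?S \<inter> H)" if X: "X \<in> \<A>" "X \<subseteq> H" and H: "?S \<inter> H \<in> lmeasurable" for X H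
  proof -
    obtain a b where ab: "X = cbox a b" "box a b \<noteq> {}" using bx[OF X(1)] by blast
    have "0 < leb (cbox a b)" using ab(2) by (simp add: content_pos_lt_eq box_ne_empty)
    also have "\<dots> \<le> leb (?S \<inter> H)"
      by (rule measure_mono_fmeasurable[OF _ _ H]) (use X ab in auto)
    finally show ?thesis .
  qed
  have p1: "0 < leb (\<Union>\<A>1)" unfolding A1(4)
    by (rule posQ[OF Q12(1,3)]) (rule halfspace_measure_split[OF Sm i])
  have p2: "0 < leb (\<Union>\<A>2)" unfolding A2(4)
    by (rule posQ[OF Q12(2,4)]) (rule halfspace_measure_split[OF Sm i])
  define \<theta> where "\<theta> = leb (\<Union>\<A>1) / leb ?S"
  have split: "leb ?S = leb (\<Union>\<A>1) + leb (\<Union>\<A>2)"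
    using halfspace_measure_split(1)[OF Sm i, of t] A1(4) A2(4) by simp
  have \<theta>: "0 < \<theta>" "\<theta> < 1" "leb (\<Union>\<A>1) = \<theta> * leb ?S" "leb (\<Union>\<A>2) = (1 - \<theta>) * leb ?S"
    using p1 p2 pS split by (auto simp: \<theta>_def field_simps)
  obtain d where d: "leb (?T \<inter> {x. x \<bullet> i \<le> d}) = \<theta> * leb ?T"
    using exists_halfspace_ratio[OF cT i, of \<theta>] \<theta> by auto
  then have d2: "leb (?T \<inter> {x. x \<bullet> i \<ge> d}) = (1 - \<theta>) * leb ?T"
    using halfspace_measure_split(1)[OF Tm i, of d] by (simp add: algebra_simps)
  obtain \<B>1 where B1: "box_family \<B>1" "card \<B>1 \<le> card \<B>" "\<Union>\<B>1 \<subseteq> ?T \<inter> {x. x \<bullet> i \<le> d}"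
     "leb (\<Union>\<B>1) = \<theta> * leb ?T"
    using box_family_cut[OF B(1) i, of "{x. x \<bullet> i \<le> d}" d] d by metis
  obtain \<B>2 where B2: "box_family \<B>2" "card \<B>2 \<le> card \<B>" "\<Union>\<B>2 \<subseteq> ?T \<inter> {x. x \<bullet> i \<ge> d}"
     "leb (\<Union>\<B>2) = (1 - \<theta>) * leb ?T"
    using box_family_cut[OF B(1) i, of "{x. x \<bullet> i \<ge> d}" d] d2 by metis
  have ne: "\<A>1 \<noteq> {}" "\<A>2 \<noteq> {}" "\<B>1 \<noteq> {}" "\<B>2 \<noteq> {}"
    using p1 p2 B1(4) B2(4) \<theta>(1,2) pT by auto
  show ?thesis
  proof (rule brunn_minkowski_box_family_aux[OF cS cT i A1(3) A2(3) B1(3) B2(3) \<theta>(1,2) \<theta>(3,4) B1(4) B2(4)])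
    show "root DIM('a) (leb (\<Union>\<A>1)) + root DIM('a) (leb (\<Union>\<B>1)) \<le> root DIM('a) (leb (\<Union>\<A>1 + \<Union>\<B>1))"
      by (rule IH) (use A1 B1 ne in auto)
    show "root DIM('a) (leb (\<Union>\<A>2)) + root DIM('a) (leb (\<Union>\<B>2)) \<le> root DIM('a) (leb (\<Union>\<A>2 + \<Union>\<B>2))"
      by (rule IH) (use A2 B2 ne in auto)
  qed (use A1 A2 B1 B2 box_family_compact in auto)
qed

lemma brunn_minkowski_box_family:
  fixes \<A> \<B> :: "'a::euclidean_space set set"
  assumes "box_family \<A>" "box_family \<B>" "\<A> \<noteq> {}" "\<B> \<noteq> {}"
  shows "root DIM('a) (leb (\<Union>\<A>)) + root DIM('a) (leb (\<Union>\<B>)) \<le> root DIM('a) (leb (\<Union>\<A> + \<Union>\<B>))"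
  using assms
proof (induction "card \<A> + card \<B>" arbitrary: \<A> \<B> rule: less_induct)
  case less
  have single: "\<exists>a b. \<C> = {cbox a b} \<and> box a b \<noteq> {}"
    if C: "box_family \<C>" "\<C> \<noteq> {}" and no: "\<not> (\<exists>Q\<in>\<C>. \<exists>R\<in>\<C>. Q \<noteq> R)" for \<C> :: "'a set set"
  proof -
    obtain Q where "Q \<in> \<C>" using C by auto
    with no have "\<C> = {Q}" by auto
    with C show ?thesis unfolding box_family_def by auto
  qed
  consider "\<exists>Q\<in>\<A>. \<exists>R\<in>\<A>. Q \<noteq> R" | "\<exists>Q\<in>\<B>. \<exists>R\<in>\<B>. Q \<noteq> R"
    | "\<not> (\<exists>Q\<in>\<A>. \<exists>R\<in>\<A>. Q \<noteq> R)" "\<not> (\<exists>Q\<in>\<B>. \<exists>R\<in>\<B>. Q \<noteq> R)" by blast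
  then show ?case
  proof cases
    case 1
    then obtain Q R where "Q \<in> \<A>" "R \<in> \<A>" "Q \<noteq> R" by blast
    from brunn_minkowski_box_family_step[OF less.prems(1,2,4) this] less.hyps show ?thesis by blast
  next
    case 2
    then obtain Q R where "Q \<in> \<B>" "R \<in> \<B>" "Q \<noteq> R" by blast
    then have "root DIM('a) (leb (\<Union>\<B>)) + root DIM('a) (leb (\<Union>\<A>)) \<le> root DIM('a) (leb (\<Union>\<B> + \<Union>\<A>))"
    proof (rule brunn_minkowski_box_family_step[OF less.prems(2,1,3)])
      fix \<A>' \<B>' :: "'a set set"
      assume "box_family \<A>'" "box_family \<B>'" "\<A>' \<noteq> {}" "\<B>' \<noteq> {}" "card \<A>' + card \<B>' < card \<B> + card \<A>"
      then show "root DIM('a) (leb (\<Union>\<A>')) + root DIM('a) (leb (\<Union>\<B>')) \<le> root DIM('a) (leb (\<Union>\<A>' + \<Union>\<B>'))"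
        using less.hyps[of \<A>' \<B>'] by simp
    qed
    then show ?thesis by (simp add: add.commute)
  next
    case 3
    then obtain a b c d where "\<A> = {cbox a b}" "box a b \<noteq> {}" "\<B> = {cbox c d}" "box c d \<noteq> {}"
      using single less.prems by metis
    then show ?thesis using brunn_minkowski_cbox[of a b c d] by simp
  qed
qed

section \<open>From families of boxes to compact sets\<close>

lemma open_box_family_approx:
  fixes G :: "'a::euclidean_space set"
  assumes G: "open G" "bounded G" "G \<noteq> {}" and e: "0 < e"
  obtains \<A> where "box_family \<A>" "\<A> \<noteq> {}" "\<Union>\<A> \<subseteq> G" "leb G - e \<le> leb (\<Union>\<A>)"
proof -
  obtain a where a: "G \<subseteq> box (-a) a" using bounded_subset_box_symmetric[OF G(2)] by blast
  with G have ne: "box (-a) a \<noteq> {}" "G \<subseteq> cbox (-a) a" using box_subset_cbox by blast+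
  \<comment> \<open>With this gauge every covering box, being contained in the gauge set of one of
    its points in \<open>G\<close>, lies in \<open>G\<close>; the union of the countable cover is
    then exactly \<open>G\<close>.\<close>
  have gauge: "gauge (\<lambda>x. if x \<in> G then G else UNIV)" using G by (auto simp: gauge_def)
  obtain \<D> where D: "countable \<D>" "\<And>K. K \<in> \<D> \<Longrightarrow> interior K \<noteq> {} \<and> (\<exists>c d. K = cbox c d)"
      "pairwise (\<lambda>A B. interior A \<inter> interior B = {}) \<D>"
      "\<And>K. K \<in> \<D> \<Longrightarrow> \<exists>x \<in> G \<inter> K. K \<subseteq> (if x \<in> G then G else UNIV)" "G \<subseteq> \<Union>\<D>"
    using covering_lemma[OF ne(2,1) gauge] by metis
  have UD: "\<Union>\<D> = G" using D(4,5) by fastforce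
  have Dne: "\<D> \<noteq> {}" using UD G by auto
  let ?A = "\<lambda>n. from_nat_into \<D> ` {..n::nat}"
  have fam: "box_family (?A n)" for n
    unfolding box_family_def
  proof (intro conjI ballI)
    fix Q assume "Q \<in> ?A n"
    then have Q: "Q \<in> \<D>" using from_nat_into[OF Dne] by auto
    then obtain c d where "Q = cbox c d" "interior Q \<noteq> {}" using D(2) by blast
    then show "\<exists>c d. Q = cbox c d \<and> box c d \<noteq> {}" by (metis interior_cbox)
  next
    show "pairwise (\<lambda>A B. interior A \<inter> interior B = {}) (?A n)"
      by (rule pairwise_subset[OF D(3)]) (use from_nat_into[OF Dne] in auto)
  qed simp
  have Gm: "G \<in> lmeasurable" using G by (simp add: lmeasurable_open)
  have U: "(\<Union>n. \<Union>(?A n)) = G"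
    using from_nat_into_surj[OF D(1)] from_nat_into[OF Dne] UD by fastforce
  have "(\<lambda>n. leb (\<Union>(?A n))) \<longlonglongrightarrow> leb (\<Union>n. \<Union>(?A n))"
  proof (rule Lim_measure_incseq)
    show "range (\<lambda>n. \<Union>(?A n)) \<subseteq> sets lebesgue"
      using lmeasurable_compact[OF box_family_compact[OF fam]] by (auto dest: fmeasurableD)
    show "incseq (\<lambda>n. \<Union>(?A n))" by (fastforce simp: incseq_def)
    show "emeasure lebesgue (\<Union>n. \<Union>(?A n)) \<noteq> \<infinity>" using Gm unfolding U by (auto simp: fmeasurable_def)
  qed
  then have lim: "(\<lambda>n. leb (\<Union>(?A n))) \<longlonglongrightarrow> leb G" unfolding U .
  have "\<forall>\<^sub>F n in sequentially. leb G - e < leb (\<Union>(?A n))"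
    using order_tendstoD(1)[OF lim, of "leb G - e"] e by simp
  then obtain n where "leb G - e < leb (\<Union>(?A n))" by (auto simp: eventually_sequentially)
  moreover have "\<Union>(?A n) \<subseteq> G" using U by blast
  ultimately show thesis using that[OF fam[of n]] by (simp add: less_imp_le)
qed

lemma lmeasurable_outer_open:
  fixes S :: "'a::euclidean_space set"
  assumes S: "S \<in> lmeasurable" and e: "0 < e"
  obtains U where "open U" "S \<subseteq> U" "U \<in> lmeasurable" "leb U < leb S + e"
proof -
  obtain U where U: "open U" "S \<subseteq> U" "U - S \<in> lmeasurable" "emeasure lebesgue (U - S) < ennreal e"
    using sets_lebesgue_outer_open[OF fmeasurableD[OF S] e] by blast
  have "U = S \<union> (U - S)" using U(2) by auto
  then have Um: "U \<in> lmeasurable" and le: "leb U \<le> leb S + leb (U - S)"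
    using fmeasurable.Un[OF S U(3)] measure_Un_le[OF fmeasurableD[OF S] fmeasurableD[OF U(3)]] by auto
  have "ennreal (leb (U - S)) < ennreal e"
    using U(3,4) by (simp add: emeasure_eq_measure2)
  then have "leb (U - S) < e" by (simp add: ennreal_less_iff)
  with le that[OF U(1,2) Um] show thesis by linarith
qed

text \<open>A compact set may have empty interior and then contains no boxes. The boxes are
  therefore inscribed in small open neighbourhoods of \<open>A\<close> and \<open>B\<close>, whose
  sum still lies in an open set of volume less than \<open>leb (A + B) + e\<close>.\<close>

theorem brunn_minkowski_compact:
  fixes A B :: "'a::euclidean_space set"
  assumes A: "compact A" "A \<noteq> {}" and B: "compact B" "B \<noteq> {}"
  shows "root DIM('a) (leb A) + root DIM('a) (leb B) \<le> root DIM('a) (leb (A + B))"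
proof -
  have C: "compact (A + B)" using compact_set_plus A B by blast
  have ev: "root DIM('a) (leb A - e) + root DIM('a) (leb B - e) \<le> root DIM('a) (leb (A + B) + e)" if e: "0 < e" for e
  proof -
    obtain U where U: "open U" "A + B \<subseteq> U" "U \<in> lmeasurable" "measure lebesgue U < measure lebesgue (A + B) + e"
      using lmeasurable_outer_open[OF lmeasurable_compact[OF C] e] by blast
    obtain \<delta> where \<delta>: "\<delta> > 0" "(\<Union>x\<in>A + B. cball x \<delta>) \<subseteq> U"
      using compact_subset_open_imp_cball_epsilon_subset[OF C U(1,2)] by blast
    define N where "N X = (\<Union>x\<in>X. ball x (\<delta> / 2))" for X :: "'a set"
    have Nprop: "open (N X)" "bounded (N X)" "N X \<noteq> {}" "X \<subseteq> N X" if X: "compact X" "X \<noteq> {}" for X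
    proof -
      show "open (N X)" by (auto simp: N_def)
      obtain M where M: "\<And>x. x \<in> X \<Longrightarrow> norm x \<le> M" using compact_imp_bounded[OF X(1)] by (auto simp: bounded_iff)
      have "norm y \<le> M + \<delta>" if y: "y \<in> N X" for y
      proof -
        obtain x where "x \<in> X" "dist x y < \<delta> / 2" using y by (auto simp: N_def)
        then show ?thesis using M[of x] \<delta>(1) norm_triangle_ineq2[of y x] by (simp add: dist_norm norm_minus_commute)
      qed
      then show "bounded (N X)" by (auto simp: bounded_iff)
      show "X \<subseteq> N X" using \<delta>(1) by (auto simp: N_def)
      then show "N X \<noteq> {}" using X(2) by auto
    qed
    obtain \<A> where FA: "box_family \<A>" "\<A> \<noteq> {}" "\<Union>\<A> \<subseteq> N A" "leb (N A) - e \<le> leb (\<Union>\<A>)"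
      using open_box_family_approx[OF Nprop(1,2,3)[OF A] e] by blast
    obtain \<B> where FB: "box_family \<B>" "\<B> \<noteq> {}" "\<Union>\<B> \<subseteq> N B" "leb (N B) - e \<le> leb (\<Union>\<B>)"
      using open_box_family_approx[OF Nprop(1,2,3)[OF B] e] by blast
    have mon: "leb X \<le> leb (N X)" if X: "compact X" "X \<noteq> {}" for X
      by (rule measure_mono_fmeasurable[OF Nprop(4)[OF X] fmeasurableD[OF lmeasurable_compact[OF X(1)]]
          lmeasurable_open[OF Nprop(2,1)[OF X]]])
    have "N A + N B \<subseteq> U"
    proof
      fix z assume "z \<in> N A + N B"
      then obtain u v x y where "z = u + v" "x \<in> A" "y \<in> B" "dist x u < \<delta> / 2" "dist y v < \<delta> / 2"
        by (auto simp: set_plus_def N_def)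
      note z = this
      have "dist (x + y) (u + v) \<le> \<delta>" using dist_triangle_add[of x y u v] z by linarith
      then have "z \<in> cball (x + y) \<delta>" using z(1) by simp
      moreover have "x + y \<in> A + B" using z by (intro set_plus_intro)
      ultimately show "z \<in> U" using \<delta>(2) by blast
    qed
    then have sub: "\<Union>\<A> + \<Union>\<B> \<subseteq> U" using FA(3) FB(3) set_plus_mono2 by blast
    \<comment> \<open>\<open>root\<close> is increasing and continuous on all reals, so a negative
      radicand \<open>leb A - e\<close> is harmless, also in the limit below.\<close>
    have "root DIM('a) (leb A - e) + root DIM('a) (leb B - e)
       \<le> root DIM('a) (leb (\<Union>\<A>)) + root DIM('a) (leb (\<Union>\<B>))"
      using FA(4) FB(4) mon[OF A] mon[OF B] by (intro add_mono real_root_le_mono) auto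
    also have "\<dots> \<le> root DIM('a) (leb (\<Union>\<A> + \<Union>\<B>))"
      by (rule brunn_minkowski_box_family[OF FA(1) FB(1) FA(2) FB(2)])
    also have "\<dots> \<le> root DIM('a) (leb U)"
      using box_family_compact[OF FA(1)] box_family_compact[OF FB(1)]
      by (intro real_root_le_mono measure_mono_fmeasurable sub U fmeasurableD lmeasurable_compact compact_set_plus) auto
    also have "\<dots> \<le> root DIM('a) (leb (A + B) + e)" using U(4) by (intro real_root_le_mono) auto
    finally show ?thesis .
  qed
  have L: "((\<lambda>e. root DIM('a) (leb A - e) + root DIM('a) (leb B - e)) \<longlongrightarrow> root DIM('a) (leb A - 0) + root DIM('a) (leb B - 0)) (at_right 0)"
    by (intro tendsto_intros)
  have R: "((\<lambda>e. root DIM('a) (leb (A + B) + e)) \<longlongrightarrow> root DIM('a) (leb (A + B) + 0)) (at_right 0)"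
    by (intro tendsto_intros)
  have "root DIM('a) (leb A - 0) + root DIM('a) (leb B - 0) \<le> root DIM('a) (leb (A + B) + 0)"
    by (rule tendsto_le[OF _ R L]) (use ev in \<open>auto simp: eventually_at_right_less eventually_at intro!: exI[of _ 1]\<close>)
  then show ?thesis by simp
qed

section \<open>Two-dimensional Hausdorff measure of plane sets\<close>

text \<open>Brunn-Minkowski for \<open>E\<close> and \<open>- E\<close>, which have equal area:
  their sum is the difference set, contained in the disc of radius \<open>d\<close> about the
  origin.\<close>

lemma isodiametric_plane:
  fixes E :: "(real^2) set"
  assumes E: "compact E" and d: "\<And>x y. x \<in> E \<Longrightarrow> y \<in> E \<Longrightarrow> dist x y \<le> d"
  shows "leb E \<le> pi / 4 * d\<^sup>2"
proof (cases "E = {}")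
  case False
  then obtain x where "x \<in> E" by auto
  then have d0: "0 \<le> d" using d[of x x] by simp
  have m: "leb (uminus ` E) = leb E"
    using measure_lebesgue_affine[of "-1" 0 E] by simp
  have cE: "compact (uminus ` E)" using E by (rule compact_negations)
  have sub: "E + uminus ` E \<subseteq> cball 0 d"
    using d by (auto simp: set_plus_def dist_norm)
  have "2 * root 2 (leb E) = root DIM(real^2) (leb E) + root DIM(real^2) (leb (uminus ` E))"
    by (simp add: m)
  also have "\<dots> \<le> root DIM(real^2) (leb (E + uminus ` E))"
    by (rule brunn_minkowski_compact) (use E cE False in auto)
  also have "\<dots> \<le> root DIM(real^2) (leb (cball 0 d :: (real^2) set))"
    by (intro real_root_le_mono measure_mono_fmeasurable sub fmeasurableD lmeasurable_compact compact_set_plus E cE) auto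
  finally have "2 * root 2 (leb E) \<le> root 2 (pi * d\<^sup>2)"
    using d0 by (simp add: content_cball unit_ball_vol_2)
  then have "(2 * root 2 (leb E))\<^sup>2 \<le> (root 2 (pi * d\<^sup>2))\<^sup>2"
    by (rule power_mono) simp
  then show ?thesis using d0 by (simp add: power_mult_distrib)
qed simp

section \<open>Outer-measure properties of the Hausdorff measure\<close>

lemma hausdorff2_pre_le_cover:
  assumes "A \<subseteq> (\<Union>i. C i)" "\<And>i. bounded (C i)" "\<And>i. diameter (C i) \<le> \<delta>"
  shows "hausdorff2_pre \<delta> A \<le> (\<Sum>i. ennreal (pi / 4 * (diameter (C i))\<^sup>2))"
  unfolding hausdorff2_pre_def by (rule INF_lower) (use assms in auto)

lemma hausdorff2_pre_mono: "A \<subseteq> B \<Longrightarrow> hausdorff2_pre \<delta> A \<le> hausdorff2_pre \<delta> B"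
  unfolding hausdorff2_pre_def by (intro INF_superset_mono) auto

lemma hausdorff2_pre_le_hausdorff2: "0 < \<delta> \<Longrightarrow> hausdorff2_pre \<delta> A \<le> hausdorff2 A"
  unfolding hausdorff2_def by (rule SUP_upper) simp

lemma hausdorff2_pre_UN:
  fixes A :: "nat \<Rightarrow> 'a::metric_space set"
  shows "hausdorff2_pre \<delta> (\<Union>n. A n) \<le> (\<Sum>n. hausdorff2_pre \<delta> (A n))"
proof (rule ennreal_le_epsilon)
  fix e :: real assume e: "0 < e" and fin: "(\<Sum>n. hausdorff2_pre \<delta> (A n)) < top"
  let ?s = "\<lambda>C i. ennreal (pi / 4 * (diameter (C i))\<^sup>2)"
  have "\<exists>C. A n \<subseteq> (\<Union>i. C i) \<and> (\<forall>i. bounded (C i) \<and> diameter (C i) \<le> \<delta>) \<and>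
      (\<Sum>i::nat. ?s C i) \<le> hausdorff2_pre \<delta> (A n) + ennreal (e * (1/2) ^ Suc n)" for n
  proof -
    have "hausdorff2_pre \<delta> (A n) < top"
      using fin ennreal_suminf_lessD by blast
    then have "hausdorff2_pre \<delta> (A n) < hausdorff2_pre \<delta> (A n) + ennreal (e * (1/2) ^ Suc n)"
      using e by (simp add: ennreal_add_left_cancel_less[of _ 0, simplified] ennreal_zero_less_mult_iff)
    then obtain C where "C \<in> {C. A n \<subseteq> (\<Union>i. C i) \<and> (\<forall>i. bounded (C i) \<and> diameter (C i) \<le> \<delta>)}"
      "(\<Sum>i. ?s C i) < hausdorff2_pre \<delta> (A n) + ennreal (e * (1/2) ^ Suc n)"
      unfolding hausdorff2_pre_def[of \<delta> "A n"] INF_less_iff by blast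
    then show ?thesis by (intro exI[of _ C]) auto
  qed
  then obtain C where C: "\<And>n. A n \<subseteq> (\<Union>i. C n i)" "\<And>n i. bounded (C n i)" "\<And>n i. diameter (C n i) \<le> \<delta>"
    "\<And>n. (\<Sum>i::nat. ?s (C n) i) \<le> hausdorff2_pre \<delta> (A n) + ennreal (e * (1/2) ^ Suc n)" by metis
  define D where "D k = (case prod_decode k of (n, i) \<Rightarrow> C n i)" for k
  have "(\<Union>n. A n) \<subseteq> (\<Union>k. D k)"
  proof
    fix x assume "x \<in> (\<Union>n. A n)"
    then obtain n i where "x \<in> C n i" using C(1) by blast
    then have "x \<in> D (prod_encode (n, i))" by (simp add: D_def)
    then show "x \<in> (\<Union>k. D k)" by blast
  qed
  then have "hausdorff2_pre \<delta> (\<Union>n. A n) \<le> (\<Sum>k. ?s D k)"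
    by (rule hausdorff2_pre_le_cover) (auto simp: D_def C split: prod.splits)
  also have "\<dots> = (\<Sum>k. (\<lambda>(n, i). ?s (C n) i) (prod_decode k))"
    by (simp add: D_def case_prod_unfold)
  also have "\<dots> = (\<Sum>n. \<Sum>i. ?s (C n) i)"
    by (rule suminf_ennreal_2dimen) simp
  also have "\<dots> \<le> (\<Sum>n. hausdorff2_pre \<delta> (A n) + ennreal (e * (1/2) ^ Suc n))"
    by (intro suminf_le C) auto
  also have "\<dots> = (\<Sum>n. hausdorff2_pre \<delta> (A n)) + (\<Sum>n. ennreal (e * (1/2) ^ Suc n))"
    by (intro suminf_add[symmetric]) auto
  also have "(\<Sum>n. ennreal (e * (1/2) ^ Suc n)) = ennreal (e * 1)"
    using e power_half_series by (intro suminf_ennreal_eq sums_mult) auto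
  finally show "hausdorff2_pre \<delta> (\<Union>n. A n) \<le> (\<Sum>n. hausdorff2_pre \<delta> (A n)) + ennreal e" by simp
qed

lemma hausdorff2_UN:
  fixes A :: "nat \<Rightarrow> 'a::metric_space set"
  shows "hausdorff2 (\<Union>n. A n) \<le> (\<Sum>n. hausdorff2 (A n))"
  unfolding hausdorff2_def[of "\<Union>n. A n"]
proof (rule SUP_least)
  fix \<delta> :: real assume "\<delta> \<in> {0<..}"
  then show "hausdorff2_pre \<delta> (\<Union>n. A n) \<le> (\<Sum>n. hausdorff2 (A n))"
    using hausdorff2_pre_UN[of \<delta> A] suminf_le[of "\<lambda>n. hausdorff2_pre \<delta> (A n)" "\<lambda>n. hausdorff2 (A n)"]
      hausdorff2_pre_le_hausdorff2[of \<delta>] by (force intro: order_trans)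
qed

lemma hausdorff2_empty [simp]: "hausdorff2 {} = 0"
proof -
  have "hausdorff2_pre \<delta> ({} :: 'a set) \<le> 0" if "0 < \<delta>" for \<delta> :: real
    using hausdorff2_pre_le_cover[of "{} :: 'a set" "\<lambda>_. {}" \<delta>] that by simp
  then have "hausdorff2 ({} :: 'a set) \<le> 0" unfolding hausdorff2_def by (intro SUP_least) simp
  then show ?thesis by simp
qed

lemma diameter_le_dist:
  assumes "0 \<le> d" "\<And>x y. x \<in> S \<Longrightarrow> y \<in> S \<Longrightarrow> dist x y \<le> d"
  shows "diameter S \<le> d"
  unfolding diameter_def by (auto intro!: cSUP_least assms)

lemma diameter_lipschitz_image_le:
  fixes f :: "'a::metric_space \<Rightarrow> 'b::metric_space"
  assumes C: "bounded C" and L: "0 \<le> L" and f: "\<And>x y. x \<in> C \<Longrightarrow> y \<in> C \<Longrightarrow> dist (f x) (f y) \<le> L * dist x y"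
  shows "bounded (f ` C)" "diameter (f ` C) \<le> L * diameter C"
proof -
  have d: "dist (f x) (f y) \<le> L * diameter C" if "x \<in> C" "y \<in> C" for x y
    using f[OF that] mult_left_mono[OF diameter_bounded_bound[OF C that] L] by linarith
  show "bounded (f ` C)"
  proof (cases "C = {}")
    case False
    then obtain x where "x \<in> C" by auto
    with d show ?thesis unfolding bounded_def by (intro exI[of _ "f x"] exI[of _ "L * diameter C"]) auto
  qed simp
  show "diameter (f ` C) \<le> L * diameter C"
  proof (rule diameter_le_dist)
    show "0 \<le> L * diameter C" using L C by (simp add: diameter_ge_0)
  qed (use d in auto)
qed

lemma hausdorff2_lipschitz_image:
  fixes f :: "'a::metric_space \<Rightarrow> 'b::metric_space"
  assumes L: "0 < L" and f: "\<And>x y. x \<in> A \<Longrightarrow> y \<in> A \<Longrightarrow> dist (f x) (f y) \<le> L * dist x y"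
  shows "hausdorff2 (f ` A) \<le> ennreal (L\<^sup>2) * hausdorff2 A"
  unfolding hausdorff2_def[of "f ` A"]
proof (rule SUP_least)
  fix \<delta> :: real assume "\<delta> \<in> {0<..}"
  then have \<delta>: "0 < \<delta>" "0 < \<delta> / L" using L by auto
  have "hausdorff2_pre \<delta> (f ` A) \<le> ennreal (L\<^sup>2) * hausdorff2_pre (\<delta> / L) A"
  proof -
    \<comment> \<open>The constant stands on the left so that the right side is a bare infimum over
      covers. The covers are intersected with \<open>A\<close> below, because \<open>f\<close> is
      controlled on \<open>A\<close> alone.\<close>
    have "ennreal (1 / L\<^sup>2) * hausdorff2_pre \<delta> (f ` A) \<le> hausdorff2_pre (\<delta> / L) A"
      unfolding hausdorff2_pre_def[of "\<delta> / L"]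
    proof (rule INF_greatest)
      fix C :: "nat \<Rightarrow> 'a set"
      assume "C \<in> {C. A \<subseteq> (\<Union>i. C i) \<and> (\<forall>i. bounded (C i) \<and> diameter (C i) \<le> \<delta> / L)}"
      then have C: "A \<subseteq> (\<Union>i. C i)" "\<And>i. bounded (C i)" "\<And>i. diameter (C i) \<le> \<delta> / L" by auto
      have b: "bounded (C i \<inter> A)" for i using C(2) by (meson bounded_Int)
      have lip: "bounded (f ` (C i \<inter> A))" "diameter (f ` (C i \<inter> A)) \<le> L * diameter (C i)" for i
      proof -
        show "bounded (f ` (C i \<inter> A))" by (rule diameter_lipschitz_image_le[OF b less_imp_le[OF L]]) (use f in auto)
        have "diameter (f ` (C i \<inter> A)) \<le> L * diameter (C i \<inter> A)"
          by (rule diameter_lipschitz_image_le[OF b less_imp_le[OF L]]) (use f in auto)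
        also have "\<dots> \<le> L * diameter (C i)"
          by (intro mult_left_mono diameter_subset C) (use L in auto)
        finally show "diameter (f ` (C i \<inter> A)) \<le> L * diameter (C i)" .
      qed
      have "hausdorff2_pre \<delta> (f ` A) \<le> (\<Sum>i. ennreal (pi / 4 * (diameter (f ` (C i \<inter> A)))\<^sup>2))"
      proof (rule hausdorff2_pre_le_cover)
        show "f ` A \<subseteq> (\<Union>i. f ` (C i \<inter> A))" using C(1) by blast
        fix i show "diameter (f ` (C i \<inter> A)) \<le> \<delta>"
          using lip(2)[of i] C(3)[of i] L by (simp add: field_simps)
      qed (rule lip)
      also have "\<dots> \<le> (\<Sum>i. ennreal (L\<^sup>2) * ennreal (pi / 4 * (diameter (C i))\<^sup>2))"
      proof (intro suminf_le)
        fix i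
        have "(diameter (f ` (C i \<inter> A)))\<^sup>2 \<le> (L * diameter (C i))\<^sup>2"
          by (rule power_mono[OF lip(2)]) (rule diameter_ge_0[OF lip(1)])
        then have "pi / 4 * (diameter (f ` (C i \<inter> A)))\<^sup>2 \<le> L\<^sup>2 * (pi / 4 * (diameter (C i))\<^sup>2)"
          by (simp add: power_mult_distrib)
        then show "ennreal (pi / 4 * (diameter (f ` (C i \<inter> A)))\<^sup>2) \<le> ennreal (L\<^sup>2) * ennreal (pi / 4 * (diameter (C i))\<^sup>2)"
          by (subst ennreal_mult[symmetric]) (auto intro: ennreal_leI)
      qed auto
      also have "\<dots> = ennreal (L\<^sup>2) * (\<Sum>i. ennreal (pi / 4 * (diameter (C i))\<^sup>2))" by simp
      finally have "ennreal (1 / L\<^sup>2) * hausdorff2_pre \<delta> (f ` A)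
          \<le> ennreal (1 / L\<^sup>2) * (ennreal (L\<^sup>2) * (\<Sum>i. ennreal (pi / 4 * (diameter (C i))\<^sup>2)))"
        by (rule mult_left_mono) simp
      also have "\<dots> = (\<Sum>i. ennreal (pi / 4 * (diameter (C i))\<^sup>2))"
        using L by (simp add: mult.assoc[symmetric] ennreal_mult[symmetric] del: ennreal_suminf_cmult)
      finally show "ennreal (1 / L\<^sup>2) * hausdorff2_pre \<delta> (f ` A) \<le> (\<Sum>i. ennreal (pi / 4 * (diameter (C i))\<^sup>2))" .
    qed
    then have "ennreal (L\<^sup>2) * (ennreal (1 / L\<^sup>2) * hausdorff2_pre \<delta> (f ` A)) \<le> ennreal (L\<^sup>2) * hausdorff2_pre (\<delta> / L) A"
      by (rule mult_left_mono) simp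
    then show ?thesis using L by (simp add: mult.assoc[symmetric] ennreal_mult[symmetric])
  qed
  also have "\<dots> \<le> ennreal (L\<^sup>2) * hausdorff2 A"
    by (intro mult_left_mono hausdorff2_pre_le_hausdorff2 \<delta>) simp
  finally show "hausdorff2_pre \<delta> (f ` A) \<le> ennreal (L\<^sup>2) * hausdorff2 A" .
qed


section \<open>Comparison with planar Lebesgue measure\<close>

text \<open>The term \<open>pi / 4 * (2 * r)^2\<close> of a disc of radius \<open>r\<close> is at
  most, indeed equal to, its area, and enlarging the radii by \<open>c\<close> costs the factor
  \<open>c^2\<close>. It is applied with \<open>c = 5\<close> after Vitali's covering lemma and with
  \<open>c = 1\<close> after the covering theorem.\<close>

lemma hausdorff2_pre_disjoint_balls:
  fixes a :: "'i \<Rightarrow> real^2"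
  assumes C: "countable C" and disj: "pairwise (\<lambda>i j. disjnt (ball (a i) (r i)) (ball (a j) (r j))) C"
    and r: "\<And>i. i \<in> C \<Longrightarrow> 0 < r i \<and> 2 * c * r i \<le> \<delta>" and c: "1 \<le> c" and \<delta>: "0 < \<delta>"
    and sub: "\<And>i. i \<in> C \<Longrightarrow> ball (a i) (r i) \<subseteq> U" and U: "U \<in> sets lebesgue"
  shows "hausdorff2_pre \<delta> (\<Union>i\<in>C. ball (a i) (c * r i)) \<le> ennreal (c\<^sup>2) * emeasure lebesgue U"
proof -
  let ?n = "to_nat_on C"
  define D where "D s k = (\<Union>i\<in>{i \<in> C. ?n i = k}. ball (a i) (s * r i))" for s :: real and k
  have inj: "inj_on ?n C" by (rule inj_on_to_nat_on[OF C])
  have D1: "D s (?n i) = ball (a i) (s * r i)" if "i \<in> C" for i s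
  proof -
    have "{j \<in> C. ?n j = ?n i} = {i}" using inj that by (auto simp: inj_on_def)
    then show ?thesis by (simp add: D_def)
  qed
  have D0: "D s k = {}" if "k \<notin> ?n ` C" for k s using that by (auto simp: D_def)
  have dia: "bounded (D c k) \<and> diameter (D c k) \<le> \<delta> \<and>
      ennreal (pi / 4 * (diameter (D c k))\<^sup>2) \<le> ennreal (c\<^sup>2) * emeasure lebesgue (D 1 k)" for k
  proof (cases "k \<in> ?n ` C")
    case True
    then obtain i where i: "i \<in> C" "k = ?n i" by auto
    have "diameter (ball (a i) (c * r i)) \<le> 2 * c * r i"
    proof (rule diameter_le_dist)
      fix x y assume "x \<in> ball (a i) (c * r i)" "y \<in> ball (a i) (c * r i)"
      then show "dist x y \<le> 2 * c * r i" using dist_triangle3[of x y "a i"] by simp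
    qed (use r[OF i(1)] c in simp)
    then have d: "diameter (D c k) \<le> 2 * c * r i" unfolding i(2) D1[OF i(1)] .
    have b: "bounded (D c k)" unfolding i(2) D1[OF i(1)] by simp
    have "(diameter (D c k))\<^sup>2 \<le> (2 * c * r i)\<^sup>2"
      by (rule power_mono[OF d diameter_ge_0[OF b]])
    then have "pi / 4 * (diameter (D c k))\<^sup>2 \<le> c\<^sup>2 * (pi * (r i)\<^sup>2)"
      by (simp add: power_mult_distrib)
    moreover have "emeasure lebesgue (D 1 k) = ennreal (pi * (r i)\<^sup>2)"
      unfolding i(2) D1[OF i(1)] using r[OF i(1)] by (simp add: emeasure_ball unit_ball_vol_2)
    ultimately show ?thesis using d b r[OF i(1)]
      by (auto simp: ennreal_mult[symmetric] intro: ennreal_leI)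
  qed (use \<delta> in \<open>simp add: D0\<close>)
  have df: "disjoint_family (D 1)"
    using disj by (fastforce simp: disjoint_family_on_def D_def pairwise_def disjnt_def)
  have meas: "D 1 k \<in> sets lebesgue" for k
    by (cases "k \<in> ?n ` C") (auto simp: D1 D0)
  have "hausdorff2_pre \<delta> (\<Union>i\<in>C. ball (a i) (c * r i)) \<le> (\<Sum>k. ennreal (pi / 4 * (diameter (D c k))\<^sup>2))"
    by (rule hausdorff2_pre_le_cover) (use dia in \<open>auto simp: D_def\<close>)
  also have "\<dots> \<le> (\<Sum>k. ennreal (c\<^sup>2) * emeasure lebesgue (D 1 k))"
    using dia by (intro suminf_le) auto
  also have "\<dots> = ennreal (c\<^sup>2) * (\<Sum>k. emeasure lebesgue (D 1 k))" by simp
  also have "(\<Sum>k. emeasure lebesgue (D 1 k)) = emeasure lebesgue (\<Union>k. D 1 k)"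
    by (rule suminf_emeasure) (use meas df in auto)
  also have "\<dots> \<le> emeasure lebesgue U"
    by (rule emeasure_mono[OF _ U]) (use sub in \<open>auto simp: D_def\<close>)
  finally show ?thesis by (simp add: mult_left_mono)
qed

text \<open>Vitali's covering theorem leaves a null set uncovered, so null sets are treated
  beforehand with the covering lemma, whose discs are enlarged five times. The factor 25 is absorbed
  by the choice of \<open>U\<close>, and radii up to \<delta> / 10 keep the enlarged diameters below
  \<delta>.\<close>

lemma hausdorff2_negligible:
  fixes N :: "(real^2) set"
  assumes N: "negligible N"
  shows "hausdorff2 N = 0"
proof -
  have "hausdorff2_pre \<delta> N \<le> 0" if \<delta>: "0 < \<delta>" for \<delta>
  proof (rule ennreal_le_epsilon)
    fix e :: real assume e: "0 < e"
    have Nm: "N \<in> lmeasurable" "leb N = 0"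
      using N negligible_imp_measurable negligible_imp_measure0 by blast+
    obtain U where U: "open U" "N \<subseteq> U" "U \<in> lmeasurable" "leb U < leb N + e / 25"
      using lmeasurable_outer_open[OF Nm(1), of "e / 25"] e by auto
    define K where "K = {i. fst i \<in> N \<and> 0 < snd i \<and> snd i \<le> \<delta> / 10 \<and> ball (fst i) (snd i) \<subseteq> U}"
    have "N \<subseteq> (\<Union>i\<in>K. ball (fst i) (snd i))"
    proof
      fix x assume x: "x \<in> N"
      then obtain s where s: "0 < s" "ball x s \<subseteq> U" using U by (meson open_contains_ball subsetD)
      then have "(x, min s (\<delta> / 10)) \<in> K" using x \<delta> by (auto simp: K_def)
      moreover have "x \<in> ball x (min s (\<delta> / 10))" using s \<delta> by simp
      ultimately show "x \<in> (\<Union>i\<in>K. ball (fst i) (snd i))" by force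
    qed
    note cov = this
    have rK: "0 < snd i \<and> snd i \<le> \<delta> / 10" if "i \<in> K" for i using that unfolding K_def by blast
    obtain C where C: "countable C" "C \<subseteq> K"
       "pairwise (\<lambda>i j. disjnt (ball (fst i) (snd i)) (ball (fst j) (snd j))) C"
       "N \<subseteq> (\<Union>i\<in>C. ball (fst i) (5 * snd i))"
      by (rule Vitali_covering_lemma_balls[OF cov rK])
    have Ci1: "0 < snd i \<and> 2 * 5 * snd i \<le> \<delta>" if "i \<in> C" for i
    proof -
      have "0 < snd i" "snd i \<le> \<delta> / 10"
        using subsetD[OF C(2) that] unfolding K_def by blast+
      then show ?thesis by linarith
    qed
    have Ci2: "ball (fst i) (snd i) \<subseteq> U" if "i \<in> C" for i
      using subsetD[OF C(2) that] unfolding K_def by blast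
    have "hausdorff2_pre \<delta> N \<le> hausdorff2_pre \<delta> (\<Union>i\<in>C. ball (fst i) (5 * snd i))"
      by (rule hausdorff2_pre_mono[OF C(4)])
    also have "\<dots> \<le> ennreal (5\<^sup>2) * emeasure lebesgue U"
      by (rule hausdorff2_pre_disjoint_balls[OF C(1,3) Ci1 _ \<delta> Ci2 fmeasurableD[OF U(3)]]) simp_all
    also have "\<dots> = ennreal (5\<^sup>2) * ennreal (leb U)" by (subst emeasure_eq_measure2[OF U(3)]) (rule refl)
    also have "\<dots> = ennreal (25 * leb U)" by (subst ennreal_mult[symmetric]) simp_all
    also have "\<dots> \<le> ennreal e" using U(4) Nm(2) by (intro ennreal_leI) simp
    finally show "hausdorff2_pre \<delta> N \<le> 0 + ennreal e" by simp
  qed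
  then have "hausdorff2 N \<le> 0" unfolding hausdorff2_def by (intro SUP_least) simp
  then show ?thesis by simp
qed

text \<open>Small disjoint discs inside an open set slightly larger than \<open>E\<close> cover
  \<open>E\<close> up to a null set. The opposite estimate enters later through
  \<open>isodiametric_plane\<close>, one covering set at a time.\<close>

lemma hausdorff2_le_lebesgue_plane:
  fixes E :: "(real^2) set"
  assumes E: "E \<in> lmeasurable"
  shows "hausdorff2 E \<le> emeasure lebesgue E"
  unfolding hausdorff2_def
proof (rule SUP_least)
  fix \<delta> :: real assume "\<delta> \<in> {0<..}"
  then have \<delta>: "0 < \<delta>" by simp
  show "hausdorff2_pre \<delta> E \<le> emeasure lebesgue E"
  proof (rule ennreal_le_epsilon)
    fix e :: real assume e: "0 < e"
    obtain U where U: "open U" "E \<subseteq> U" "U \<in> lmeasurable" "leb U < leb E + e"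
      using lmeasurable_outer_open[OF E e] by blast
    define K where "K = {i. fst i \<in> E \<and> 0 < snd i \<and> snd i \<le> \<delta> / 2 \<and> ball (fst i) (snd i) \<subseteq> U}"
    have cov: "\<exists>i. i \<in> K \<and> x \<in> ball (fst i) (snd i) \<and> snd i < d" if x: "x \<in> E" and d: "0 < d" for x d
    proof -
      obtain s where s: "0 < s" "ball x s \<subseteq> U" using U x by (meson open_contains_ball subsetD)
      then have "(x, min s (min (\<delta> / 2) (d / 2))) \<in> K" using x \<delta> d by (auto simp: K_def)
      moreover have "x \<in> ball x (min s (min (\<delta> / 2) (d / 2)))" "min s (min (\<delta> / 2) (d / 2)) < d" using s \<delta> d by auto
      ultimately show ?thesis by force
    qed
    obtain C where C: "countable C" "C \<subseteq> K"
       "pairwise (\<lambda>i j. disjnt (ball (fst i) (snd i)) (ball (fst j) (snd j))) C"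
       "negligible (E - (\<Union>i\<in>C. ball (fst i) (snd i)))"
      using Vitali_covering_theorem_balls[of E K fst snd] cov by blast
    have Ci1: "0 < snd i \<and> 2 * 1 * snd i \<le> \<delta>" if "i \<in> C" for i
    proof -
      have "0 < snd i" "snd i \<le> \<delta> / 2"
        using subsetD[OF C(2) that] unfolding K_def by blast+
      then show ?thesis by linarith
    qed
    have Ci2: "ball (fst i) (snd i) \<subseteq> U" if "i \<in> C" for i
      using subsetD[OF C(2) that] unfolding K_def by blast
    let ?B = "\<Union>i\<in>C. ball (fst i) (1 * snd i)" and ?N = "E - (\<Union>i\<in>C. ball (fst i) (snd i))"
    \<comment> \<open>Countable subadditivity for two sets: index 0 carries the discs, every other
      index the null remainder, which contributes 0.\<close>
    have "hausdorff2_pre \<delta> E \<le> hausdorff2_pre \<delta> (\<Union>n::nat. if n = 0 then ?B else ?N)"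
    proof (rule hausdorff2_pre_mono, rule subsetI)
      fix x assume "x \<in> E"
      then consider "x \<in> ?B" | "x \<in> ?N" by auto
      then show "x \<in> (\<Union>n::nat. if n = 0 then ?B else ?N)"
        by cases (rule UN_I[of 0], simp, simp, rule UN_I[of 1], simp, simp)
    qed
    also have "\<dots> \<le> (\<Sum>n::nat. hausdorff2_pre \<delta> (if n = 0 then ?B else ?N))" by (rule hausdorff2_pre_UN)
    also have "\<dots> = (\<Sum>n\<in>{0::nat}. hausdorff2_pre \<delta> (if n = 0 then ?B else ?N))"
    proof (rule suminf_finite)
      have "hausdorff2_pre \<delta> ?N \<le> 0"
        using hausdorff2_pre_le_hausdorff2[OF \<delta>, of ?N] hausdorff2_negligible[OF C(4)] by simp
      then show "hausdorff2_pre \<delta> (if n = 0 then ?B else ?N) = 0" if "n \<notin> {0}" for n :: nat using that by simp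
    qed simp
    also have "\<dots> = hausdorff2_pre \<delta> ?B" by simp
    also have "\<dots> \<le> ennreal (1\<^sup>2) * emeasure lebesgue U"
      by (rule hausdorff2_pre_disjoint_balls[OF C(1,3) Ci1 _ \<delta> Ci2 fmeasurableD[OF U(3)]]) simp_all
    also have "\<dots> = ennreal (leb U)" by (subst emeasure_eq_measure2[OF U(3)]) simp
    also have "\<dots> \<le> ennreal (leb E + e)" using U(4) by (intro ennreal_leI) simp
    also have "\<dots> = emeasure lebesgue E + ennreal e"
      using e by (subst emeasure_eq_measure2[OF E]) (simp add: ennreal_plus)
    finally show "hausdorff2_pre \<delta> E \<le> emeasure lebesgue E + ennreal e" .
  qed
qed

section \<open>Relative quermassintegrals\<close>

text \<open>\<open>lse_grad Y\<close> and \<open>lse_hess Y x\<close> are the gradient and the Hessian of \<open>ln (exp_sum Y)\<close>.\<close>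

definition exp_sum :: "'a::euclidean_space set \<Rightarrow> 'a \<Rightarrow> real" where
  "exp_sum Y x = (\<Sum>y\<in>Y. exp (x \<bullet> y))"

definition lse_grad :: "'a::euclidean_space set \<Rightarrow> 'a \<Rightarrow> 'a" where
  "lse_grad Y x = inverse (exp_sum Y x) *\<^sub>R (\<Sum>y\<in>Y. exp (x \<bullet> y) *\<^sub>R y)"

definition lse_hess :: "'a::euclidean_space set \<Rightarrow> 'a \<Rightarrow> 'a \<Rightarrow> 'a" where
  "lse_hess Y x v = inverse (exp_sum Y x) *\<^sub>R (\<Sum>y\<in>Y. (exp (x \<bullet> y) * (v \<bullet> y)) *\<^sub>R y)
     - (inverse (exp_sum Y x) * (\<Sum>y\<in>Y. exp (x \<bullet> y) * (v \<bullet> y)) * inverse (exp_sum Y x)) *\<^sub>R (\<Sum>y\<in>Y. exp (x \<bullet> y) *\<^sub>R y)"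

lemma exp_sum_pos: "finite Y \<Longrightarrow> Y \<noteq> {} \<Longrightarrow> 0 < exp_sum Y x"
  unfolding exp_sum_def by (rule sum_pos) auto

lemma exp_sum_derivative:
  "(exp_sum Y has_derivative (\<lambda>v. \<Sum>y\<in>Y. exp (x \<bullet> y) * (v \<bullet> y))) (at x within S)"
  unfolding exp_sum_def[abs_def]
  by (rule has_derivative_sum) (auto intro!: derivative_eq_intros simp: mult.commute)

lemma lse_grad_derivative:
  assumes "finite Y" "Y \<noteq> {}"
  shows "(lse_grad Y has_derivative lse_hess Y x) (at x within S)"
proof -
  have s: "exp_sum Y x \<noteq> 0" using exp_sum_pos[OF assms, of x] by simp
  have m: "((\<lambda>x. \<Sum>y\<in>Y. exp (x \<bullet> y) *\<^sub>R y) has_derivative (\<lambda>v. \<Sum>y\<in>Y. (exp (x \<bullet> y) * (v \<bullet> y)) *\<^sub>R y)) (at x within S)"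
    by (rule has_derivative_sum) (auto intro!: derivative_eq_intros simp: mult.commute)
  have i: "((\<lambda>x. inverse (exp_sum Y x)) has_derivative
      (\<lambda>v. - (inverse (exp_sum Y x) * (\<Sum>y\<in>Y. exp (x \<bullet> y) * (v \<bullet> y)) * inverse (exp_sum Y x)))) (at x within S)"
    by (rule Deriv.has_derivative_inverse[OF s exp_sum_derivative])
  show ?thesis
    unfolding lse_grad_def[abs_def] lse_hess_def[abs_def]
    by (rule has_derivative_eq_rhs[OF has_derivative_scaleR[OF i m]]) (simp add: fun_eq_iff)
qed

text \<open>The quadratic form is the variance of v \<bullet> y for the probability weights
  proportional to exp (x \<bullet> y).\<close>

lemma lse_hess_psd:
  assumes "finite Y" "Y \<noteq> {}"
  shows "0 \<le> v \<bullet> lse_hess Y x v"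
proof -
  let ?s = "exp_sum Y x" and ?e = "\<lambda>y. exp (x \<bullet> y)"
  have s: "0 < ?s" by (rule exp_sum_pos[OF assms])
  have "(\<Sum>y\<in>Y. sqrt (?e y) * (sqrt (?e y) * (v \<bullet> y)))\<^sup>2 \<le> (\<Sum>y\<in>Y. (sqrt (?e y))\<^sup>2) * (\<Sum>y\<in>Y. (sqrt (?e y) * (v \<bullet> y))\<^sup>2)"
    by (rule Cauchy_Schwarz_ineq_sum)
  then have cs: "(\<Sum>y\<in>Y. ?e y * (v \<bullet> y))\<^sup>2 \<le> ?s * (\<Sum>y\<in>Y. ?e y * (v \<bullet> y)\<^sup>2)"
    by (simp add: exp_sum_def power_mult_distrib mult.assoc[symmetric])
  have "v \<bullet> lse_hess Y x v = inverse ?s * (\<Sum>y\<in>Y. ?e y * (v \<bullet> y)\<^sup>2) - inverse ?s * inverse ?s * (\<Sum>y\<in>Y. ?e y * (v \<bullet> y))\<^sup>2"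
    by (simp add: lse_hess_def inner_diff_right inner_sum_right power2_eq_square algebra_simps)
  also have "\<dots> = inverse ?s * inverse ?s * (?s * (\<Sum>y\<in>Y. ?e y * (v \<bullet> y)\<^sup>2) - (\<Sum>y\<in>Y. ?e y * (v \<bullet> y))\<^sup>2)"
    using s by (simp add: field_simps)
  also have "\<dots> \<ge> 0" using s cs by simp
  finally show ?thesis .
qed

text \<open>Chebyshev's argument: after symmetrisation the difference becomes a double sum over
  pairs \<open>y\<close>, \<open>z\<close> whose terms are products of two factors of equal sign.
  The strict version yields injectivity of the gradient map.\<close>

lemma lse_grad_mono:
  assumes Y: "finite Y" "Y \<noteq> {}"
  shows "0 \<le> (lse_grad Y x' - lse_grad Y x) \<bullet> (x' - x)"
    and "y \<in> Y \<Longrightarrow> z \<in> Y \<Longrightarrow> (x' - x) \<bullet> y \<noteq> (x' - x) \<bullet> z \<Longrightarrow> 0 < (lse_grad Y x' - lse_grad Y x) \<bullet> (x' - x)"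
proof -
  let ?s = "exp_sum Y x" and ?s' = "exp_sum Y x'"
  let ?e = "\<lambda>y. exp (x \<bullet> y)" and ?f = "\<lambda>y. exp (x' \<bullet> y)" and ?t = "\<lambda>y. (x' - x) \<bullet> y"
  let ?g = "\<lambda>y z. (?f y * ?e z - ?f z * ?e y) * (?t y - ?t z)"
  have s: "0 < ?s" "0 < ?s'" by (rule exp_sum_pos[OF Y])+
  have gpos: "0 \<le> ?g y z" and gpos': "?t y \<noteq> ?t z \<Longrightarrow> 0 < ?g y z" for y z
  proof -
    have "?f y * ?e z - ?f z * ?e y = ?e y * ?e z * (exp (?t y) - exp (?t z))"
      by (simp add: inner_diff_left exp_add[symmetric] algebra_simps)
    moreover have "0 \<le> (exp (?t y) - exp (?t z)) * (?t y - ?t z)"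
      by (cases "?t y \<le> ?t z") (auto intro: mult_nonpos_nonpos mult_nonneg_nonneg)
    moreover have "0 < (exp (?t y) - exp (?t z)) * (?t y - ?t z)" if "?t y \<noteq> ?t z"
      using that by (cases "?t y < ?t z") (auto intro: mult_neg_neg mult_pos_pos)
    ultimately show "0 \<le> ?g y z" "?t y \<noteq> ?t z \<Longrightarrow> 0 < ?g y z" by (simp_all add: mult.assoc)
  qed
  have a: "(\<Sum>y\<in>Y. ?f y * ?t y) * ?s - (\<Sum>z\<in>Y. ?e z * ?t z) * ?s' = (\<Sum>y\<in>Y. \<Sum>z\<in>Y. ?f y * ?e z * (?t y - ?t z))"
    (is "?L = ?D")
    unfolding exp_sum_def sum_product
    by (subst (2) sum.swap) (simp add: sum_subtractf[symmetric] algebra_simps)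
  have b: "?D = (\<Sum>y\<in>Y. \<Sum>z\<in>Y. ?f z * ?e y * (?t z - ?t y))" (is "_ = ?D'") by (rule sum.swap)
  have c: "?D + ?D' = (\<Sum>y\<in>Y. \<Sum>z\<in>Y. ?g y z)"
    unfolding sum.distrib[symmetric] by (intro sum.cong refl) (simp only: algebra_simps)
  have "2 * ?L = ?L + ?L" by (rule mult_2)
  also have "\<dots> = ?D + ?D'" by (rule arg_cong2[where f = "(+)", OF a trans[OF a b]])
  finally have L: "2 * ?L = (\<Sum>y\<in>Y. \<Sum>z\<in>Y. ?g y z)" unfolding c .
  have inn: "lse_grad Y w \<bullet> d = inverse (exp_sum Y w) * (\<Sum>y\<in>Y. exp (w \<bullet> y) * (d \<bullet> y))" for w d
    by (simp add: lse_grad_def inner_sum_right inner_commute[of _ d])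
  have "(lse_grad Y x' - lse_grad Y x) \<bullet> (x' - x) = inverse ?s' * (\<Sum>y\<in>Y. ?f y * ?t y) - inverse ?s * (\<Sum>y\<in>Y. ?e y * ?t y)"
    unfolding inner_diff_left[of "lse_grad Y x'"] inn ..
  also have "\<dots> = inverse ?s' * inverse ?s * ?L" using s by (simp add: field_simps)
  finally have eq: "(lse_grad Y x' - lse_grad Y x) \<bullet> (x' - x) = inverse ?s' * inverse ?s * (\<Sum>y\<in>Y. \<Sum>z\<in>Y. ?g y z) / 2"
    unfolding L[symmetric] by simp
  show "0 \<le> (lse_grad Y x' - lse_grad Y x) \<bullet> (x' - x)"
  proof -
    have "0 \<le> (\<Sum>y\<in>Y. \<Sum>z\<in>Y. ?g y z)" by (intro sum_nonneg gpos)
    then show ?thesis unfolding eq using s by (intro divide_nonneg_pos mult_nonneg_nonneg) simp_all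
  qed
  assume yz: "y \<in> Y" "z \<in> Y" "?t y \<noteq> ?t z"
  have "0 < (\<Sum>y\<in>Y. \<Sum>z\<in>Y. ?g y z)"
  proof (rule sum_pos2[where i = y])
    show "0 < (\<Sum>z\<in>Y. ?g y z)" by (rule sum_pos2[where i = z]) (use Y yz gpos gpos' in auto)
    show "0 \<le> (\<Sum>z\<in>Y. ?g i z)" for i by (intro sum_nonneg gpos)
  qed (use Y yz in auto)
  then show "0 < (lse_grad Y x' - lse_grad Y x) \<bullet> (x' - x)"
    unfolding eq using s by simp
qed

lemma lse_grad_in_hull:
  assumes Y: "finite Y" "Y \<noteq> {}"
  shows "lse_grad Y x \<in> convex hull Y"
proof -
  have s: "0 < exp_sum Y x" by (rule exp_sum_pos[OF Y])
  have "(\<Sum>y\<in>Y. (inverse (exp_sum Y x) * exp (x \<bullet> y)) *\<^sub>R y) \<in> convex hull Y"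
  proof (rule convex_sum[OF Y(1) convex_convex_hull])
    show "(\<Sum>y\<in>Y. inverse (exp_sum Y x) * exp (x \<bullet> y)) = 1"
      using s by (simp add: sum_distrib_left[symmetric] exp_sum_def[symmetric])
  qed (use s in \<open>auto intro: hull_inc\<close>)
  then show ?thesis by (simp add: lse_grad_def scaleR_sum_right)
qed

text \<open>Log-sum-exp dominates the support function of the hull; this supplies the coercivity in
  the surjectivity argument that follows.\<close>

lemma inner_le_ln_exp_sum:
  assumes Y: "finite Y" "y \<in> convex hull Y"
  shows "x \<bullet> y \<le> ln (exp_sum Y x)"
proof -
  have ne: "Y \<noteq> {}" using Y(2) by auto
  have "Y \<subseteq> {y. x \<bullet> y \<le> ln (exp_sum Y x)}"
  proof
    fix z assume z: "z \<in> Y"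
    have "exp (x \<bullet> z) \<le> exp_sum Y x" unfolding exp_sum_def using Y(1) z by (intro member_le_sum) auto
    then show "z \<in> {y. x \<bullet> y \<le> ln (exp_sum Y x)}"
      using exp_sum_pos[OF Y(1) ne, of x] by (simp add: ln_ge_iff)
  qed
  then have "convex hull Y \<subseteq> {y. x \<bullet> y \<le> ln (exp_sum Y x)}"
    by (rule hull_minimal) (rule convex_halfspace_le)
  then show ?thesis using Y(2) by blast
qed

lemma ln_exp_sum_derivative:
  assumes Y: "finite Y" "Y \<noteq> {}"
  shows "((\<lambda>x. ln (exp_sum Y x)) has_derivative (\<lambda>v. v \<bullet> lse_grad Y x)) (at x)"
proof -
  have s: "0 < exp_sum Y x" by (rule exp_sum_pos[OF Y])
  show ?thesis
    by (rule has_derivative_eq_rhs[OF has_derivative_ln[OF s exp_sum_derivative]])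
      (simp add: fun_eq_iff lse_grad_def inner_sum_right divide_inverse mult.commute)
qed

text \<open>A preimage of \<open>p\<close> is a minimiser of \<phi> + t \<psi> - x \<bullet> p,
  whose derivative vanishes there. Since \<open>p\<close> is an interior point, this function grows
  at least like \<open>e * norm x\<close>, so a minimiser exists.\<close>

lemma interior_subset_lse_image:
  fixes Y Z :: "'a::euclidean_space set"
  assumes Y: "finite Y" "Y \<noteq> {}" and Z: "finite Z" "Z \<noteq> {}" and t: "0 \<le> t"
    and p: "p \<in> interior (convex hull Y + (*\<^sub>R) t ` (convex hull Z))"
  shows "\<exists>x. lse_grad Y x + t *\<^sub>R lse_grad Z x = p"
proof -
  obtain e where e: "0 < e" "cball p e \<subseteq> convex hull Y + (*\<^sub>R) t ` (convex hull Z)"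
    using p mem_interior_cball by blast
  define F where "F x = ln (exp_sum Y x) + t * ln (exp_sum Z x) - x \<bullet> p" for x
  have coercive: "e * norm x \<le> F x" for x
  proof -
    \<comment> \<open>The point of the ball farthest in direction \<open>x\<close>; for
      \<open>x = 0\<close> the quotient is 0 and the point is \<open>p\<close> itself.\<close>
    have "p + (e / norm x) *\<^sub>R x \<in> cball p e" using e by (cases "x = 0") (auto simp: dist_norm)
    then obtain y z where yz: "y \<in> convex hull Y" "z \<in> convex hull Z" "p + (e / norm x) *\<^sub>R x = y + t *\<^sub>R z"
      using e(2) by (auto simp: set_plus_def)
    have "x \<bullet> (p + (e / norm x) *\<^sub>R x) = x \<bullet> y + t * (x \<bullet> z)" by (simp add: yz(3) inner_add_right)
    also have "\<dots> \<le> ln (exp_sum Y x) + t * ln (exp_sum Z x)"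
      by (intro add_mono mult_left_mono inner_le_ln_exp_sum Y Z yz t)
    finally have "x \<bullet> p + e / norm x * (x \<bullet> x) \<le> ln (exp_sum Y x) + t * ln (exp_sum Z x)"
      by (simp add: inner_add_right)
    moreover have "e / norm x * (x \<bullet> x) = e * norm x"
      by (cases "x = 0") (simp_all add: dot_square_norm power2_eq_square)
    ultimately show ?thesis by (simp add: F_def)
  qed
  have der: "(F has_derivative (\<lambda>v. v \<bullet> lse_grad Y x + t * (v \<bullet> lse_grad Z x) - v \<bullet> p)) (at x)" for x
    unfolding F_def[abs_def]
    by (intro derivative_intros ln_exp_sum_derivative Y Z)
  have cont: "continuous_on (cball 0 (F 0 / e)) F"
    by (intro continuous_at_imp_continuous_on ballI has_derivative_continuous[OF der])
  have F0: "0 \<le> F 0" using coercive[of 0] by simp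
  have "cball 0 (F 0 / e) \<noteq> ({} :: 'a set)" using F0 e by (simp add: not_less)
  then obtain x where x: "x \<in> cball 0 (F 0 / e)" "\<And>y. y \<in> cball 0 (F 0 / e) \<Longrightarrow> F x \<le> F y"
    using continuous_attains_inf[OF compact_cball _ cont] by metis
  \<comment> \<open>Outside the ball of radius \<open>F 0 / e\<close> coercivity makes
    \<open>F\<close> exceed \<open>F 0\<close>, so the minimum over the ball is global.\<close>
  have min: "F x \<le> F y" for y
  proof (cases "y \<in> cball 0 (F 0 / e)")
    case False
    then have "F 0 < e * norm y" using e by (simp add: field_simps)
    also have "\<dots> \<le> F y" by (rule coercive)
    moreover have "F x \<le> F 0" using x(2)[of 0] F0 e by simp
    ultimately show ?thesis by linarith
  qed (rule x(2))
  have "(\<lambda>v. v \<bullet> lse_grad Y x + t * (v \<bullet> lse_grad Z x) - v \<bullet> p) = (\<lambda>v. 0)"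
    by (rule differential_zero_maxmin[OF _ open_UNIV der]) (use min in auto)
  from fun_cong[OF this, of "lse_grad Y x + t *\<^sub>R lse_grad Z x - p"]
  have "(lse_grad Y x + t *\<^sub>R lse_grad Z x - p) \<bullet> (lse_grad Y x + t *\<^sub>R lse_grad Z x - p) = 0"
    by (simp add: inner_diff_right inner_add_right)
  then show ?thesis by (intro exI[of _ x]) simp
qed

section \<open>Determinants and cubic interpolation\<close>

text \<open>Deformation to the identity: \<open>M s\<close> has a positive quadratic form for
  \<open>s < 1\<close> and is therefore invertible, so its determinant keeps the sign of
  \<open>det (mat 1) = 1\<close>; the case \<open>s = 1\<close> follows by continuity.\<close>

lemma det_nonneg_if_psd:
  fixes A :: "real^'n^'n"
  assumes A: "\<And>v. 0 \<le> v \<bullet> (A *v v)"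
  shows "0 \<le> det A"
proof -
  define M where "M s = (1 - s) *\<^sub>R mat 1 + s *\<^sub>R A" for s :: real
  have nz: "det (M s) \<noteq> 0" if s: "0 \<le> s" "s < 1" for s
  proof
    assume "det (M s) = 0"
    then obtain v where v: "v \<noteq> 0" "M s *v v = 0"
      using invertible_det_nz[of "M s"] matrix_left_invertible_ker[of "M s"] invertible_left_inverse[of "M s"] by metis
    have "0 = v \<bullet> (M s *v v)" using v by simp
    also have "\<dots> = (1 - s) * (v \<bullet> v) + s * (v \<bullet> (A *v v))"
      by (simp add: M_def matrix_vector_mult_add_rdistrib scaleR_matrix_vector_assoc[symmetric] inner_add_right)
    also have "\<dots> > 0" using s v(1) A[of v] by (intro add_pos_nonneg) auto
    finally show False by simp
  qed
  have cont: "continuous_on {0..1} (\<lambda>s. det (M s))"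
    unfolding M_def det_def by (intro continuous_intros) 
  have pos: "0 < det (M s)" if s: "0 \<le> s" "s < 1" for s
  proof (rule ccontr)
    assume "\<not> 0 < det (M s)"
    then have "\<exists>x. 0 \<le> x \<and> x \<le> s \<and> det (M x) = 0"
      by (intro IVT2') (use s in \<open>auto simp: M_def intro: continuous_on_subset[OF cont[unfolded M_def]]\<close>)
    then show False using nz s by force
  qed
  have "((\<lambda>s. det (M s)) \<longlongrightarrow> det (M 1)) (at 1 within {0..1})"
    using cont by (simp add: continuous_on)
  then have "((\<lambda>s. det (M s)) \<longlongrightarrow> det (M 1)) (at 1 within {0..<1})"
    by (rule tendsto_within_subset) auto
  moreover have "eventually (\<lambda>s. 0 \<le> det (M s)) (at 1 within {0..<1})"
    using pos by (auto simp: eventually_at_filter less_imp_le)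
  moreover have "at (1::real) within {0..<1} \<noteq> bot"
    by (simp add: trivial_limit_within islimpt_Ico)
  ultimately have "0 \<le> det (M 1)" by (rule tendsto_lowerbound)
  then show ?thesis by (simp add: M_def)
qed


text \<open>Lagrange interpolation at 0, 1, 2, 3. Being reproduced by this operator is a closed condition, so
  it passes from polytopes to convex bodies.\<close>

definition cubic_interpolation :: "(real \<Rightarrow> real) \<Rightarrow> real \<Rightarrow> real" where
  "cubic_interpolation f t = - ((t - 1) * (t - 2) * (t - 3) / 6) * f 0 + t * (t - 2) * (t - 3) / 2 * f 1
     - t * (t - 1) * (t - 3) / 2 * f 2 + t * (t - 1) * (t - 2) / 6 * f 3"

lemma cubic_interpolation_prod:
  "cubic_interpolation (\<lambda>t. (a + t * a') * (b + t * b') * (c + t * c')) t = (a + t * a') * (b + t * b') * (c + t * c')"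
  unfolding cubic_interpolation_def by (simp add: field_simps)

lemma cubic_interpolation_add:
  "cubic_interpolation (\<lambda>t. f t + g t) t = cubic_interpolation f t + cubic_interpolation g t"
proof -
  have "A * (f 0 + g 0) + B * (f 1 + g 1) - C * (f 2 + g 2) + D * (f 3 + g 3)
      = (A * f 0 + B * f 1 - C * f 2 + D * f 3) + (A * g 0 + B * g 1 - C * g 2 + D * g 3)" for A B C D :: real
    by (simp add: algebra_simps)
  then show ?thesis unfolding cubic_interpolation_def .
qed

lemma cubic_interpolation_diff:
  "cubic_interpolation (\<lambda>t. f t - g t) t = cubic_interpolation f t - cubic_interpolation g t"
proof -
  have "A * (f 0 - g 0) + B * (f 1 - g 1) - C * (f 2 - g 2) + D * (f 3 - g 3)
      = (A * f 0 + B * f 1 - C * f 2 + D * f 3) - (A * g 0 + B * g 1 - C * g 2 + D * g 3)" for A B C D :: real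
    by (simp add: algebra_simps)
  then show ?thesis unfolding cubic_interpolation_def .
qed

text \<open>The expanded determinant is a signed sum of products of three entries, each affine in
  \<open>t\<close>.\<close>

lemma det_cubic_interpolation:
  fixes A B :: "real^3^3"
  shows "cubic_interpolation (\<lambda>t. det (A + t *\<^sub>R B)) t = det (A + t *\<^sub>R B)"
proof -
  have add: "cubic_interpolation (\<lambda>t. f t + g t) t = f t + g t"
    if "cubic_interpolation f t = f t" "cubic_interpolation g t = g t" for f g
    using that by (simp only: cubic_interpolation_add)
  have diff: "cubic_interpolation (\<lambda>t. f t - g t) t = f t - g t"
    if "cubic_interpolation f t = f t" "cubic_interpolation g t = g t" for f g
    using that by (simp only: cubic_interpolation_diff)
  have entry: "(A + t *\<^sub>R B) $ i $ j = A $ i $ j + t * B $ i $ j" for t i j by simp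
  show ?thesis
    unfolding det_3 entry
    by (rule add diff cubic_interpolation_prod)+
qed

lemma spanning_if_interior_hull:
  fixes Y :: "'a::euclidean_space set"
  assumes "interior (convex hull Y) \<noteq> {}" "v \<noteq> 0"
  shows "\<exists>y\<in>Y. \<exists>z\<in>Y. v \<bullet> y \<noteq> v \<bullet> z"
proof (rule ccontr)
  assume H: "\<not> ?thesis"
  have "Y \<noteq> {}" using assms(1) by auto
  then obtain y where "y \<in> Y" by auto
  then have "Y \<subseteq> {z. v \<bullet> z = v \<bullet> y}" using H by blast
  then have "convex hull Y \<subseteq> {z. v \<bullet> z = v \<bullet> y}" by (rule hull_minimal) (rule convex_hyperplane)
  then have "interior (convex hull Y) \<subseteq> {}"
    using interior_mono[of "convex hull Y" "{z. v \<bullet> z = v \<bullet> y}"] interior_hyperplane[OF assms(2)] by simp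
  then show False using assms(1) by simp
qed

lemma convex_set_plus_scaled:
  assumes "convex A" "convex B" shows "convex (A + (*\<^sub>R) t ` B)"
  by (intro convex_set_plus assms convex_scaling)

lemma compact_set_plus_scaled:
  fixes A B :: "'a::real_normed_vector set"
  assumes "compact A" "compact B" shows "compact (A + (*\<^sub>R) t ` B)"
  by (intro compact_set_plus assms compact_scaling)

text \<open>The image of the injective gradient map lies between the interior of the convex body and
  the body itself, and the boundary of a convex set is null. Positive semidefiniteness of the
  Hessians removes the absolute value from the Jacobian.\<close>

lemma volume_polytope_sum_has_integral:
  fixes Y Z :: "(real^3) set"
  assumes Y: "finite Y" "interior (convex hull Y) \<noteq> {}" and Z: "finite Z" "Z \<noteq> {}" and t: "0 \<le> t"
  shows "((\<lambda>x. det (matrix (lse_hess Y x) + t *\<^sub>R matrix (lse_hess Z x))) has_integral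
           leb (convex hull Y + (*\<^sub>R) t ` (convex hull Z))) UNIV"
proof -
  let ?F = "\<lambda>x. lse_grad Y x + t *\<^sub>R lse_grad Z x" and ?F' = "\<lambda>x v. lse_hess Y x v + t *\<^sub>R lse_hess Z x v"
  let ?K = "convex hull Y + (*\<^sub>R) t ` (convex hull Z)"
  have Yne: "Y \<noteq> {}" using Y(2) by auto
  have der: "(?F has_derivative ?F' x) (at x within UNIV)" for x
    by (intro derivative_intros lse_grad_derivative Y Yne Z)
  have inj: "inj_on ?F UNIV"
  proof (rule inj_onI, rule ccontr)
    fix x x' assume eq: "?F x = ?F x'" and ne: "x \<noteq> x'"
    obtain y z where yz: "y \<in> Y" "z \<in> Y" "(x' - x) \<bullet> y \<noteq> (x' - x) \<bullet> z"
      using spanning_if_interior_hull[OF Y(2), of "x' - x"] ne by auto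
    have "0 < (lse_grad Y x' - lse_grad Y x) \<bullet> (x' - x)" by (rule lse_grad_mono(2)[OF Y(1) Yne yz])
    moreover have "0 \<le> t * ((lse_grad Z x' - lse_grad Z x) \<bullet> (x' - x))"
      using lse_grad_mono(1)[OF Z] t by simp
    moreover have "(lse_grad Y x' - lse_grad Y x) \<bullet> (x' - x) + t * ((lse_grad Z x' - lse_grad Z x) \<bullet> (x' - x)) = (?F x' - ?F x) \<bullet> (x' - x)"
      by (simp add: inner_diff_left inner_add_left algebra_simps)
    ultimately show False using eq by simp
  qed
  have cK: "compact ?K" by (intro compact_set_plus_scaled finite_imp_compact_convex_hull Y Z)
  have vK: "convex ?K" by (intro convex_set_plus_scaled convex_convex_hull)
  have sub: "range ?F \<subseteq> ?K"
    using lse_grad_in_hull[OF Y(1) Yne] lse_grad_in_hull[OF Z] by (auto intro!: set_plus_intro)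
  have sup: "interior ?K \<subseteq> range ?F"
    using interior_subset_lse_image[OF Y(1) Yne Z t] by (metis (no_types, lifting) rangeI subsetI)
  have "?K - range ?F \<union> (range ?F - ?K) \<subseteq> frontier ?K"
    using sub sup compact_imp_closed[OF cK] by (auto simp: frontier_def)
  then have neg: "negligible (?K - range ?F \<union> (range ?F - ?K))"
    by (rule negligible_subset[OF negligible_convex_frontier[OF vK]])
  have "range ?F \<in> lmeasurable \<and> leb (range ?F) = leb ?K"
    using lmeasurable_negligible_symdiff[OF lmeasurable_compact[OF cK] neg]
      measure_negligible_symdiff[OF lmeasurable_compact[OF cK] neg] by simp
  then have int: "((\<lambda>x. \<bar>det (matrix (?F' x))\<bar>) has_integral leb ?K) UNIV"
    using has_measure_differentiable_image[of UNIV ?F ?F' "leb ?K", OF _ der inj] by simp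
  have M: "matrix (?F' x) = matrix (lse_hess Y x) + t *\<^sub>R matrix (lse_hess Z x)" for x
    by (simp add: matrix_def vec_eq_iff)
  have "0 \<le> det (matrix (?F' x))" for x
  proof (rule det_nonneg_if_psd)
    fix v
    have "linear (?F' x)" using der[of x] by (rule has_derivative_linear)
    then have "matrix (?F' x) *v v = ?F' x v" by (simp add: matrix_works linear_matrix_vector_mul_eq)
    then show "0 \<le> v \<bullet> (matrix (?F' x) *v v)"
      using lse_hess_psd[OF Y(1) Yne, of v x] lse_hess_psd[OF Z, of v x] t by (simp add: inner_add_right)
  qed
  then show ?thesis using int by (simp add: M)
qed

text \<open>Interpolation is a linear combination of values and so commutes with the integral, while
  the integrand is reproduced at each \<open>x\<close>.\<close>

lemma volume_polytope_sum_cubic: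
  fixes Y Z :: "(real^3) set"
  assumes Y: "finite Y" "interior (convex hull Y) \<noteq> {}" and Z: "finite Z" "Z \<noteq> {}" and t: "0 \<le> t"
  shows "cubic_interpolation (\<lambda>t. leb (convex hull Y + (*\<^sub>R) t ` (convex hull Z))) t
           = leb (convex hull Y + (*\<^sub>R) t ` (convex hull Z))"
proof -
  let ?D = "\<lambda>t x. det (matrix (lse_hess Y x) + t *\<^sub>R matrix (lse_hess Z x))"
  let ?V = "\<lambda>t. leb (convex hull Y + (*\<^sub>R) t ` (convex hull Z))"
  have V: "(?D s has_integral ?V s) UNIV" if "0 \<le> s" for s
    by (rule volume_polytope_sum_has_integral[OF Y Z that])
  have "((\<lambda>x. cubic_interpolation (\<lambda>s. ?D s x) t) has_integral cubic_interpolation ?V t) UNIV"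
    unfolding cubic_interpolation_def
    by (intro has_integral_add has_integral_diff has_integral_mult_right V) auto
  then have "(?D t has_integral cubic_interpolation ?V t) UNIV"
    by (simp only: det_cubic_interpolation)
  then show ?thesis using V[OF t] has_integral_unique by blast
qed

section \<open>From polytopes to convex bodies\<close>

text \<open>The vertices of a box inside \<open>K\<close> belong to every \<open>Y n\<close> and
  give all hulls interior points; the remaining points run through a countable dense subset.\<close>

lemma convex_body_hull_sequence:
  fixes K :: "'a::euclidean_space set"
  assumes K: "compact K" "convex K" "interior K \<noteq> {}"
  obtains Y :: "nat \<Rightarrow> 'a set" where "\<And>n. finite (Y n)" "\<And>n. interior (convex hull (Y n)) \<noteq> {}"
    "\<And>n. Y n \<subseteq> K" "\<And>m n. m \<le> n \<Longrightarrow> Y m \<subseteq> Y n" "K \<subseteq> closure (\<Union>n. Y n)"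
proof -
  obtain x where "x \<in> interior K" using K by auto
  then obtain a b where ab: "x \<in> box a b" "cbox a b \<subseteq> K"
    using open_contains_cbox[of "interior K" x] interior_subset[of K] open_interior
    by (metis order_trans)
  obtain S where S: "finite S" "cbox a b = convex hull S" using closed_interval_as_convex_hull by blast
  obtain D where D: "countable D" "D \<subseteq> K" "K \<subseteq> closure D" using separable by blast
  have "K \<noteq> {}" using K(3) by auto
  then have Dne: "D \<noteq> {}" using D(3) by auto
  define Y where "Y n = S \<union> from_nat_into D ` {..n}" for n :: nat
  show thesis
  proof (rule that[of Y])
    show "finite (Y n)" for n using S(1) by (simp add: Y_def)
    show "interior (convex hull (Y n)) \<noteq> {}" for n
    proof -
      have "box a b \<subseteq> interior (convex hull (Y n))"
        using hull_mono[of S "Y n" convex] S(2) box_subset_cbox[of a b]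
        by (intro interior_maximal) (auto simp: Y_def)
      then show ?thesis using ab(1) by auto
    qed
    have "S \<subseteq> K" using ab(2) S(2) hull_subset[of S convex] by auto
    then show "Y n \<subseteq> K" for n using from_nat_into[OF Dne] D(2) by (auto simp: Y_def)
    show "Y m \<subseteq> Y n" if "m \<le> n" for m n using that by (auto simp: Y_def)
    have "D \<subseteq> (\<Union>n. Y n)" using from_nat_into_surj[OF D(1)] by (fastforce simp: Y_def)
    then show "K \<subseteq> closure (\<Union>n. Y n)" using D(3) closure_mono by blast
  qed
qed

text \<open>The increasing union \<open>U\<close> of the polytope sums is convex and satisfies U
  \<subseteq> K + t L \<subseteq> closure U, so the two sets differ only within the null frontier of
  \<open>U\<close>.\<close>

lemma volume_sum_limit:
  fixes K L :: "'a::euclidean_space set"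
  assumes K: "compact K" "convex K" and L: "compact L" "convex L"
    and Y: "\<And>n. finite (Y n)" "\<And>n. Y n \<subseteq> K" "\<And>m n. m \<le> n \<Longrightarrow> Y m \<subseteq> Y n" "K \<subseteq> closure (\<Union>n. Y n)"
    and Z: "\<And>n. finite (Z n)" "\<And>n. Z n \<subseteq> L" "\<And>m n. m \<le> n \<Longrightarrow> Z m \<subseteq> Z n" "L \<subseteq> closure (\<Union>n. Z n)"
  shows "(\<lambda>n::nat. leb (convex hull (Y n) + (*\<^sub>R) t ` (convex hull (Z n)))) \<longlonglongrightarrow> leb (K + (*\<^sub>R) t ` L)"
proof -
  let ?P = "\<lambda>n. convex hull (Y n) + (*\<^sub>R) t ` (convex hull (Z n))"
  let ?M = "K + (*\<^sub>R) t ` L"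
  have cM: "compact ?M" by (intro compact_set_plus_scaled K L)
  have cP: "compact (?P n)" for n
    by (intro compact_set_plus_scaled finite_imp_compact_convex_hull Y Z)
  have sub: "?P n \<subseteq> ?M" for n
    by (intro set_plus_mono2 image_mono hull_minimal Y Z K L)
  have inc: "?P m \<subseteq> ?P n" if "m \<le> n" for m n
    by (intro set_plus_mono2 image_mono hull_mono Y(3) Z(3) that)
  define U where "U = (\<Union>n. ?P n)"
  have vP: "convex (?P n)" for n by (intro convex_set_plus_scaled convex_convex_hull)
  have vU: "convex U"
  proof (rule convexI)
    fix x y u v :: real and a b assume ab: "a \<in> U" "b \<in> U" and uv: "0 \<le> u" "0 \<le> v" "u + v = 1"
    from ab obtain m n where "a \<in> ?P m" "b \<in> ?P n" unfolding U_def by blast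
    then have "a \<in> ?P (max m n)" "b \<in> ?P (max m n)"
      using inc[of m "max m n"] inc[of n "max m n"] by auto
    then have "u *\<^sub>R a + v *\<^sub>R b \<in> ?P (max m n)" by (rule convexD[OF vP _ _ uv])
    then show "u *\<^sub>R a + v *\<^sub>R b \<in> U" unfolding U_def by blast
  qed
  have "(\<Union>n. Y n) + (*\<^sub>R) t ` (\<Union>n. Z n) \<subseteq> U"
  proof
    fix x assume "x \<in> (\<Union>n. Y n) + (*\<^sub>R) t ` (\<Union>n. Z n)"
    then obtain m n y z where x: "x = y + t *\<^sub>R z" and yz: "y \<in> Y m" "z \<in> Z n"
      by (auto simp: set_plus_def)
    have "y \<in> convex hull Y (max m n)" "z \<in> convex hull Z (max m n)"
      using yz Y(3)[of m "max m n"] Z(3)[of n "max m n"] by (auto intro: hull_inc)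
    then have "x \<in> ?P (max m n)" unfolding x by (intro set_plus_intro imageI)
    then show "x \<in> U" unfolding U_def by blast
  qed
  then have cl: "closure ((\<Union>n. Y n) + (*\<^sub>R) t ` (\<Union>n. Z n)) \<subseteq> closure U" by (rule closure_mono)
  have "?M \<subseteq> closure (\<Union>n. Y n) + (*\<^sub>R) t ` closure (\<Union>n. Z n)"
    by (intro set_plus_mono2 image_mono Y Z)
  also have "\<dots> \<subseteq> closure ((\<Union>n. Y n) + (*\<^sub>R) t ` (\<Union>n. Z n))"
    unfolding closure_scaleR by (rule closure_sum)
  finally have M: "?M \<subseteq> closure U" using cl by blast
  have UM: "U \<subseteq> ?M" using sub by (auto simp: U_def)
  have "?M - U \<union> (U - ?M) \<subseteq> frontier U"
    using M UM interior_subset[of U] by (auto simp: frontier_def)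
  then have neg: "negligible (?M - U \<union> (U - ?M))"
    by (rule negligible_subset[OF negligible_convex_frontier[OF vU]])
  have Um: "U \<in> lmeasurable" and eq: "leb U = leb ?M"
    using lmeasurable_negligible_symdiff[OF lmeasurable_compact[OF cM] neg]
      measure_negligible_symdiff[OF lmeasurable_compact[OF cM] neg] by simp_all
  have "(\<lambda>n. leb (?P n)) \<longlonglongrightarrow> leb (\<Union>n. ?P n)"
  proof (rule Lim_measure_incseq)
    show "range ?P \<subseteq> sets lebesgue" using lmeasurable_compact[OF cP] by (auto dest: fmeasurableD)
    show "incseq ?P" using inc by (auto simp: incseq_def)
    show "emeasure lebesgue (\<Union>n. ?P n) \<noteq> \<infinity>" using Um unfolding U_def by (auto simp: fmeasurable_def)
  qed
  then show ?thesis unfolding U_def[symmetric] eq .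
qed

theorem volume_sum_cubic:
  fixes K L :: "(real^3) set"
  assumes K: "convex_body K" and L: "convex_body L" and t: "0 \<le> t"
  shows "cubic_interpolation (\<lambda>t. leb (K + (*\<^sub>R) t ` L)) t = leb (K + (*\<^sub>R) t ` L)"
proof -
  note K' = K[unfolded convex_body_def] and L' = L[unfolded convex_body_def]
  obtain Y :: "nat \<Rightarrow> (real^3) set" where Y: "\<And>n. finite (Y n)" "\<And>n. interior (convex hull (Y n)) \<noteq> {}"
    "\<And>n. Y n \<subseteq> K" "\<And>m n. m \<le> n \<Longrightarrow> Y m \<subseteq> Y n" "K \<subseteq> closure (\<Union>n. Y n)"
    using convex_body_hull_sequence[of K] K' by metis
  obtain Z :: "nat \<Rightarrow> (real^3) set" where Z: "\<And>n. finite (Z n)" "\<And>n. interior (convex hull (Z n)) \<noteq> {}"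
    "\<And>n. Z n \<subseteq> L" "\<And>m n. m \<le> n \<Longrightarrow> Z m \<subseteq> Z n" "L \<subseteq> closure (\<Union>n. Z n)"
    using convex_body_hull_sequence[of L] L' by metis
  let ?V = "\<lambda>n t. leb (convex hull (Y n) + (*\<^sub>R) t ` (convex hull (Z n)))"
  have lim: "(\<lambda>n. ?V n s) \<longlonglongrightarrow> leb (K + (*\<^sub>R) s ` L)" for s
    by (rule volume_sum_limit) (use K' L' Y Z in auto)
  have Zne: "Z n \<noteq> {}" for n using Z(2)[of n] by auto
  have "(\<lambda>n. cubic_interpolation (?V n) t) \<longlonglongrightarrow> cubic_interpolation (\<lambda>t. leb (K + (*\<^sub>R) t ` L)) t"
    unfolding cubic_interpolation_def by (intro tendsto_intros lim)
  then have "(\<lambda>n. ?V n t) \<longlonglongrightarrow> cubic_interpolation (\<lambda>t. leb (K + (*\<^sub>R) t ` L)) t"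
    by (simp only: volume_polytope_sum_cubic[OF Y(1,2) Z(1) Zne t])
  then show ?thesis using LIMSEQ_unique[OF _ lim] by blast
qed

lemma cubic_interpolation_coeffs:
  "\<exists>W :: nat \<Rightarrow> real. (\<forall>t. cubic_interpolation f t = (\<Sum>i\<le>3. real (3 choose i) * W i * t ^ i)) \<and> (\<forall>i>3. W i = 0)"
proof -
  \<comment> \<open>The Lagrange polynomial expanded in powers of \<open>t\<close>; the divisor 3 in
    \<open>W 1\<close> and \<open>W 2\<close> cancels the binomial coefficient.\<close>
  define W where "W i = (if i = 0 then f 0
     else if i = 1 then (- 11 / 6 * f 0 + 3 * f 1 - 3 / 2 * f 2 + 1 / 3 * f 3) / 3
     else if i = 2 then (f 0 - 5 / 2 * f 1 + 2 * f 2 - 1 / 2 * f 3) / 3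
     else if i = 3 then - 1 / 6 * f 0 + 1 / 2 * f 1 - 1 / 2 * f 2 + 1 / 6 * f 3 else 0)" for i :: nat
  have "cubic_interpolation f t = (\<Sum>i\<le>3. real (3 choose i) * W i * t ^ i)" for t
    by (simp add: numeral_3_eq_3 W_def cubic_interpolation_def choose_two field_simps power2_eq_square power3_eq_cube)
  then show ?thesis by (intro exI[of _ W]) (simp add: W_def)
qed

lemma cubic_coeffs_unique:
  fixes W W' :: "nat \<Rightarrow> real"
  assumes "\<And>t. 0 \<le> t \<Longrightarrow> (\<Sum>i\<le>3. real (3 choose i) * W i * t ^ i) = (\<Sum>i\<le>3. real (3 choose i) * W' i * t ^ i)"
    and i: "i \<le> 3"
  shows "W i = W' i"
proof -
  have e: "(\<Sum>i\<le>3. real (3 choose i) * W i * t ^ i) = W 0 + 3 * W 1 * t + 3 * W 2 * t^2 + W 3 * t^3" for t and W :: "nat \<Rightarrow> real"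
    by (simp add: numeral_3_eq_3 numeral_2_eq_2 choose_two)
  have "W 0 = W' 0" "W 1 = W' 1" "W 2 = W' 2" "W 3 = W' 3"
    using assms(1)[of 0] assms(1)[of 1] assms(1)[of 2] assms(1)[of 3] unfolding e by simp_all
  moreover have "i = 0 \<or> i = 1 \<or> i = 2 \<or> i = 3" using i by linarith
  ultimately show ?thesis by auto
qed

text \<open>Interpolation gives existence of the coefficients; the values at 0, 1, 2, 3 together
  with the normalisation for \<open>i > 3\<close> give uniqueness. This justifies the definite
  description in \<open>rel_quermass\<close>.\<close>

theorem rel_quermass_volume:
  fixes K L :: "(real^3) set"
  assumes K: "convex_body K" and L: "convex_body L" and t: "0 \<le> t"
  shows "leb (K + (*\<^sub>R) t ` L) = rel_quermass K L 0 + 3 * rel_quermass K L 1 * t + 3 * rel_quermass K L 2 * t^2 + rel_quermass K L 3 * t^3"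
proof -
  let ?P = "\<lambda>W :: nat \<Rightarrow> real. (\<forall>t\<ge>0. leb (K + (*\<^sub>R) t ` L) = (\<Sum>i\<le>3. real (3 choose i) * W i * t ^ i)) \<and> (\<forall>i>3. W i = 0)"
  obtain W where W0: "\<And>t. cubic_interpolation (\<lambda>t. leb (K + (*\<^sub>R) t ` L)) t = (\<Sum>i\<le>3. real (3 choose i) * W i * t ^ i)"
      "\<forall>i>3. W i = 0"
    using cubic_interpolation_coeffs by blast
  have W: "?P W" using W0(2) by (simp add: W0(1)[symmetric] volume_sum_cubic[OF K L])
  have "?P (THE W. ?P W)"
  proof (rule theI[of ?P, OF W])
    fix W' assume W': "?P W'"
    show "W' = W"
    proof
      fix i show "W' i = W i"
        using cubic_coeffs_unique[of W' W i] W W' by (cases "i \<le> 3") auto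
    qed
  qed
  then have "leb (K + (*\<^sub>R) t ` L) = (\<Sum>i\<le>3. real (3 choose i) * rel_quermass K L i * t ^ i)"
    using t unfolding rel_quermass_def by blast
  also have "\<dots> = rel_quermass K L 0 + 3 * rel_quermass K L 1 * t + 3 * rel_quermass K L 2 * t^2 + rel_quermass K L 3 * t^3"
    by (simp add: numeral_3_eq_3 numeral_2_eq_2 choose_two)
  finally show ?thesis .
qed

section \<open>Gauge function and regular boundary points\<close>

lemma support_fun_upper:
  assumes "compact A" "a \<in> A" shows "x \<bullet> a \<le> support_fun A x"
  unfolding support_fun_def
proof (rule cSUP_upper[OF assms(2)])
  have "compact ((\<lambda>y. x \<bullet> y) ` A)" by (intro compact_continuous_image continuous_intros assms)
  then show "bdd_above ((\<lambda>y. x \<bullet> y) ` A)" by (intro bounded_imp_bdd_above compact_imp_bounded)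
qed

lemma support_fun_attained:
  assumes "compact A" "A \<noteq> {}" obtains a where "a \<in> A" "x \<bullet> a = support_fun A x"
proof -
  have "continuous_on A (\<lambda>y. x \<bullet> y)" by (intro continuous_intros)
  then obtain a where a: "a \<in> A" "\<And>b. b \<in> A \<Longrightarrow> x \<bullet> b \<le> x \<bullet> a"
    using continuous_attains_sup[OF assms] by metis
  have "support_fun A x \<le> x \<bullet> a" unfolding support_fun_def by (rule cSUP_least) (use a assms in auto)
  then show thesis using that[OF a(1)] support_fun_upper[OF assms(1) a(1), of x] by simp
qed

lemma support_fun_least:
  assumes "A \<noteq> {}" "\<And>a. a \<in> A \<Longrightarrow> x \<bullet> a \<le> c" shows "support_fun A x \<le> c"
  unfolding support_fun_def by (rule cSUP_least) (use assms in auto)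

lemma support_fun_scale:
  assumes A: "compact A" "A \<noteq> {}" and c: "0 \<le> c"
  shows "support_fun A (c *\<^sub>R x) = c * support_fun A x"
proof (rule antisym)
  show "support_fun A (c *\<^sub>R x) \<le> c * support_fun A x"
    by (rule support_fun_least[OF A(2)]) (auto intro!: mult_left_mono support_fun_upper A c)
  obtain a where a: "a \<in> A" "x \<bullet> a = support_fun A x" using support_fun_attained[OF A] .
  show "c * support_fun A x \<le> support_fun A (c *\<^sub>R x)"
    using support_fun_upper[OF A(1) a(1), of "c *\<^sub>R x"] a(2) by simp
qed

lemma support_fun_lipschitz:
  assumes A: "compact A" "A \<noteq> {}" and M: "\<And>a. a \<in> A \<Longrightarrow> norm a \<le> M"
  shows "\<bar>support_fun A x - support_fun A y\<bar> \<le> M * norm (x - y)"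
proof -
  have "support_fun A u \<le> support_fun A v + M * norm (u - v)" for u v
  proof (rule support_fun_least[OF A(2)])
    fix a assume a: "a \<in> A"
    have "u \<bullet> a = v \<bullet> a + (u - v) \<bullet> a" by (simp add: inner_diff_left)
    also have "(u - v) \<bullet> a \<le> norm (u - v) * norm a" by (rule norm_cauchy_schwarz)
    also have "\<dots> \<le> norm (u - v) * M" by (intro mult_left_mono M a) simp
    finally show "u \<bullet> a \<le> support_fun A v + M * norm (u - v)"
      using support_fun_upper[OF A(1) a, of v] by (simp add: mult.commute)
  qed
  from this[of x y] this[of y x] show ?thesis by (simp add: norm_minus_commute abs_le_iff)
qed

lemma continuous_on_support_fun:
  assumes A: "compact A" "A \<noteq> {}" shows "continuous_on S (support_fun A)"
proof -
  obtain M where M: "\<And>a. a \<in> A \<Longrightarrow> norm a \<le> M" using compact_imp_bounded[OF A(1)] by (auto simp: bounded_iff)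
  have "M-lipschitz_on S (support_fun A)"
  proof (rule lipschitz_onI)
    show "dist (support_fun A x) (support_fun A y) \<le> M * dist x y" for x y
      using support_fun_lipschitz[OF A M, of x y] by (simp add: dist_norm)
    obtain a where "a \<in> A" using A by auto
    then show "0 \<le> M" using M[of a] norm_ge_zero[of a] by linarith
  qed
  then show ?thesis by (rule lipschitz_on_continuous_on)
qed

locale origin_body =
  fixes K :: "(real^3) set"
  assumes body: "convex_body K" and origin: "0 \<in> interior K"
begin

lemma compact: "compact K" and convex: "convex K" and origin_in: "0 \<in> K" and nonempty: "K \<noteq> {}"
  using body origin interior_subset unfolding convex_body_def by blast+

text \<open>The gauge of \<open>K\<close> is encoded as the support function of the polar body. Its
  subgradients at \<open>y\<close> are then the points of this compact set that attain the maximum,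
  which makes closedness arguments available.\<close>

definition polar :: "(real^3) set" where
  "polar = {a. \<forall>y\<in>K. a \<bullet> y \<le> 1}"

abbreviation gauge_fun :: "real^3 \<Rightarrow> real" where
  "gauge_fun \<equiv> support_fun polar"

definition inner_radius :: real where "inner_radius = (SOME r. 0 < r \<and> cball 0 r \<subseteq> K)"
definition outer_radius :: real where "outer_radius = (SOME R. 0 < R \<and> K \<subseteq> cball 0 R)"

lemma inner_radius: "0 < inner_radius" "cball 0 inner_radius \<subseteq> K"
proof -
  have "\<exists>r. 0 < r \<and> cball 0 r \<subseteq> K" using origin mem_interior_cball by blast
  from someI_ex[OF this] show "0 < inner_radius" "cball 0 inner_radius \<subseteq> K"
    unfolding inner_radius_def by blast+
qed

lemma outer_radius: "0 < outer_radius" "K \<subseteq> cball 0 outer_radius"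
proof -
  obtain R where "0 < R" "\<And>x. x \<in> K \<Longrightarrow> norm x \<le> R"
    using compact_imp_bounded[OF compact] bounded_pos by metis
  then have "\<exists>R. 0 < R \<and> K \<subseteq> cball 0 R" by (auto intro!: exI[of _ R])
  from someI_ex[OF this] show "0 < outer_radius" "K \<subseteq> cball 0 outer_radius"
    unfolding outer_radius_def by blast+
qed

lemma norm_le_outer: "x \<in> K \<Longrightarrow> norm x \<le> outer_radius"
  using outer_radius by auto

lemma zero_in_polar: "0 \<in> polar"
  by (simp add: polar_def)

lemma polar_nonempty: "polar \<noteq> {}"
  using zero_in_polar by blast

lemma polar_norm_le: assumes "a \<in> polar" shows "norm a \<le> 1 / inner_radius"
proof (cases "a = 0")
  case False
  have "(inner_radius / norm a) *\<^sub>R a \<in> K" using inner_radius False by (intro subsetD[OF inner_radius(2)]) simp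
  then have "a \<bullet> ((inner_radius / norm a) *\<^sub>R a) \<le> 1" using assms by (auto simp: polar_def)
  then have "inner_radius * norm a \<le> 1" using False by (simp add: dot_square_norm power2_eq_square)
  then show ?thesis using inner_radius(1) by (simp add: field_simps)
qed (use inner_radius in simp)

lemma compact_polar: "compact polar"
proof -
  have "polar = (\<Inter>y\<in>K. {a. y \<bullet> a \<le> 1})" by (auto simp: polar_def inner_commute)
  then have "closed polar" by (auto intro: closed_halfspace_le)
  moreover have "bounded polar" using polar_norm_le by (auto simp: bounded_iff)
  ultimately show ?thesis by (simp add: compact_eq_bounded_closed)
qed

lemma ball_in_polar: assumes "norm a \<le> 1 / outer_radius" shows "a \<in> polar"
proof -
  have "a \<bullet> y \<le> 1" if y: "y \<in> K" for y
  proof -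
    have "a \<bullet> y \<le> norm a * norm y" by (rule norm_cauchy_schwarz)
    also have "\<dots> \<le> 1 / outer_radius * outer_radius"
      using assms norm_le_outer[OF y] outer_radius(1) by (intro mult_mono) auto
    finally show ?thesis using outer_radius(1) by simp
  qed
  then show ?thesis by (simp add: polar_def)
qed

lemma gauge_upper: "a \<in> polar \<Longrightarrow> a \<bullet> y \<le> gauge_fun y"
  using support_fun_upper[OF compact_polar, of a y] by (simp add: inner_commute)

lemma gauge_attained: obtains a where "a \<in> polar" "a \<bullet> y = gauge_fun y"
  using support_fun_attained[OF compact_polar polar_nonempty, of y] by (metis inner_commute)

lemmas gauge_scale = support_fun_scale[OF compact_polar polar_nonempty]
lemmas continuous_on_gauge = continuous_on_support_fun[OF compact_polar polar_nonempty]

lemma gauge_lower: "norm y / outer_radius \<le> gauge_fun y"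
proof (cases "y = 0")
  case True
  then show ?thesis using gauge_upper[OF zero_in_polar, of 0] by simp
next
  case False
  let ?a = "(1 / (outer_radius * norm y)) *\<^sub>R y"
  have "?a \<in> polar" using outer_radius(1) False by (intro ball_in_polar) simp
  then have "?a \<bullet> y \<le> gauge_fun y" by (rule gauge_upper)
  moreover have "?a \<bullet> y = norm y / outer_radius"
    using False by (simp add: dot_square_norm power2_eq_square)
  ultimately show ?thesis by simp
qed

lemma gauge_pos: "y \<noteq> 0 \<Longrightarrow> 0 < gauge_fun y"
  using gauge_lower[of y] outer_radius(1) by (smt (verit) divide_pos_pos zero_less_norm_iff)

lemma gauge_zero [simp]: "gauge_fun 0 = 0"
  using gauge_scale[of 0 0] by simp

lemma mem_iff_gauge: "y \<in> K \<longleftrightarrow> gauge_fun y \<le> 1"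
proof
  assume y: "y \<in> K"
  obtain a where "a \<in> polar" "a \<bullet> y = gauge_fun y" by (rule gauge_attained)
  then show "gauge_fun y \<le> 1" using y by (auto simp: polar_def)
next
  assume g: "gauge_fun y \<le> 1"
  show "y \<in> K"
  proof (rule ccontr)
    assume "y \<notin> K"
    then obtain a b where ab: "a \<bullet> y < b" "\<And>x. x \<in> K \<Longrightarrow> b < a \<bullet> x"
      using separating_hyperplane_closed_point[OF convex compact_imp_closed[OF compact], of y] by blast
    \<comment> \<open>\<open>K\<close> lies on the side b < a \<bullet> x, so \<open>b\<close> is
      negative, and division by it turns this inequality into the one that defines
      \<open>polar\<close>: the bipolar theorem.\<close>
    have b: "b < 0" using ab(2)[OF origin_in] by simp
    have "(1 / b) *\<^sub>R a \<in> polar"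
      unfolding polar_def using ab(2) b by (auto simp: field_simps less_imp_le)
    then have "((1 / b) *\<^sub>R a) \<bullet> y \<le> 1" using gauge_upper g by (meson order_trans)
    then show False using ab(1) b by (simp add: field_simps)
  qed
qed

lemma interior_eq: "interior K = {y. gauge_fun y < 1}"
proof
  have "open {y. gauge_fun y < 1}"
    by (intro open_Collect_less continuous_on_gauge continuous_intros)
  then show "{y. gauge_fun y < 1} \<subseteq> interior K"
    by (intro interior_maximal) (auto simp: mem_iff_gauge)
  show "interior K \<subseteq> {y. gauge_fun y < 1}"
  proof
    fix y assume "y \<in> interior K"
    then obtain e where e: "0 < e" "cball y e \<subseteq> K" using mem_interior_cball by blast
    show "y \<in> {y. gauge_fun y < 1}"
    proof (cases "y = 0")
      case False
      have "y + (e / norm y) *\<^sub>R y \<in> cball y e" using e False by (simp add: dist_norm)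
      then have "(1 + e / norm y) *\<^sub>R y \<in> K" using e(2) by (auto simp: algebra_simps)
      then have "(1 + e / norm y) * gauge_fun y \<le> 1"
        using e(1) by (simp add: mem_iff_gauge gauge_scale)
      moreover have "0 < e / norm y * gauge_fun y" using e(1) False gauge_pos[OF False] by simp
      ultimately show ?thesis by (simp add: algebra_simps)
    qed simp
  qed
qed

lemma frontier_eq: "frontier K = {y. gauge_fun y = 1}"
  unfolding frontier_def interior_eq closure_closed[OF compact_imp_closed[OF compact]]
  by (auto simp: mem_iff_gauge)

lemma support_polar: assumes "a \<in> polar" "x \<in> K" "a \<bullet> x = 1" shows "support_fun K a = 1"
proof (rule antisym)
  show "support_fun K a \<le> 1" by (rule support_fun_least[OF nonempty]) (use assms in \<open>auto simp: polar_def\<close>)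
  show "1 \<le> support_fun K a" using support_fun_upper[OF compact assms(2), of a] assms(3) by simp
qed

text \<open>A normal \<open>u\<close> is rescaled by u \<bullet> x, which is positive because
  \<open>K\<close> contains a ball about the origin.\<close>

lemma outer_unit_normal_iff:
  assumes x: "gauge_fun x = 1"
  shows "outer_unit_normal K x u \<longleftrightarrow> (\<exists>a\<in>polar. a \<bullet> x = 1 \<and> u = a /\<^sub>R norm a)"
proof
  assume u: "outer_unit_normal K x u"
  have nu: "norm u = 1" and le: "\<And>y. y \<in> K \<Longrightarrow> u \<bullet> y \<le> u \<bullet> x" using u by (auto simp: outer_unit_normal_def)
  have "inner_radius *\<^sub>R u \<in> K" using inner_radius nu by (intro subsetD[OF inner_radius(2)]) simp
  from le[OF this] have p: "0 < u \<bullet> x" using inner_radius(1) nu by (simp add: dot_square_norm)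
  let ?a = "(1 / (u \<bullet> x)) *\<^sub>R u"
  have "?a \<in> polar" unfolding polar_def using le p by (auto simp: field_simps)
  moreover have "?a \<bullet> x = 1" "u = ?a /\<^sub>R norm ?a" using p nu by simp_all
  ultimately show "\<exists>a\<in>polar. a \<bullet> x = 1 \<and> u = a /\<^sub>R norm a" by blast
next
  assume "\<exists>a\<in>polar. a \<bullet> x = 1 \<and> u = a /\<^sub>R norm a"
  then obtain a where a: "a \<in> polar" "a \<bullet> x = 1" "u = a /\<^sub>R norm a" by blast
  have "a \<noteq> 0" using a(2) by auto
  then show "outer_unit_normal K x u"
    using a by (auto simp: outer_unit_normal_def polar_def divide_inverse intro!: mult_left_mono)
qed

text \<open>Points with more than one subgradient of the gauge; elements of \<open>polar\<close> with \<open>a \<bullet> x = 1\<close> correspond to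
  outer normals at the boundary point \<open>x\<close>.\<close>

definition singular :: "(real^3) set" where
  "singular = {y. \<exists>a\<in>polar. \<exists>b\<in>polar. a \<noteq> b \<and> a \<bullet> y = gauge_fun y \<and> b \<bullet> y = gauge_fun y}"

definition gauge_grad :: "real^3 \<Rightarrow> real^3" where
  "gauge_grad y = (THE a. a \<in> polar \<and> a \<bullet> y = gauge_fun y)"

lemma gauge_grad_unique:
  assumes "y \<notin> singular" "a \<in> polar" "a \<bullet> y = gauge_fun y" shows "gauge_grad y = a"
  unfolding gauge_grad_def by (rule the_equality) (use assms in \<open>auto simp: singular_def\<close>)

lemma gauge_grad: assumes "y \<notin> singular" shows "gauge_grad y \<in> polar" "gauge_grad y \<bullet> y = gauge_fun y"
proof -
  obtain a where "a \<in> polar" "a \<bullet> y = gauge_fun y" by (rule gauge_attained)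
  with gauge_grad_unique[OF assms this] show "gauge_grad y \<in> polar" "gauge_grad y \<bullet> y = gauge_fun y" by auto
qed

lemma singular_scale: assumes c: "0 < c" shows "c *\<^sub>R y \<in> singular \<longleftrightarrow> y \<in> singular"
  using c by (simp add: singular_def gauge_scale)

lemma gauge_grad_scale: assumes c: "0 < c" and y: "y \<notin> singular" shows "gauge_grad (c *\<^sub>R y) = gauge_grad y"
  by (rule gauge_grad_unique) (use c y gauge_grad[OF y] in \<open>auto simp: singular_scale gauge_scale\<close>)

lemma zero_singular: "0 \<in> singular"
proof -
  have "(1 / outer_radius) *\<^sub>R axis 1 1 \<in> polar" by (rule ball_in_polar) (use outer_radius in simp)
  moreover have "(1 / outer_radius) *\<^sub>R axis 1 1 \<noteq> (0 :: real^3)" using outer_radius by (simp add: axis_eq_0_iff)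
  ultimately show ?thesis unfolding singular_def
    by (intro CollectI bexI[of _ 0] bexI[of _ "(1 / outer_radius) *\<^sub>R axis 1 1"] conjI zero_in_polar) auto
qed

text \<open>Distinct \<open>a\<close>, \<open>b\<close> with a \<bullet> x = b \<bullet> x = 1 are
  not positive multiples of each other, so they give different unit normals; uniqueness of the
  normal and of the subgradient thus coincide.\<close>

lemma regular_boundary_eq: "regular_boundary K = {x. gauge_fun x = 1 \<and> x \<notin> singular}"
proof -
  have "(\<exists>!u. outer_unit_normal K x u) \<longleftrightarrow> x \<notin> singular" if x: "gauge_fun x = 1" for x
  proof
    assume ex: "\<exists>!u. outer_unit_normal K x u"
    show "x \<notin> singular"
    proof
      assume "x \<in> singular"
      then obtain a b where ab: "a \<in> polar" "b \<in> polar" "a \<noteq> b" "a \<bullet> x = 1" "b \<bullet> x = 1"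
        using x by (auto simp: singular_def)
      then have "a /\<^sub>R norm a = b /\<^sub>R norm b" using ex outer_unit_normal_iff[OF x] by blast
      moreover have nz: "a \<noteq> 0" "b \<noteq> 0" using ab by auto
      moreover have "norm b *\<^sub>R a = (norm a * norm b) *\<^sub>R (a /\<^sub>R norm a)"
        "norm a *\<^sub>R b = (norm a * norm b) *\<^sub>R (b /\<^sub>R norm b)" using nz by simp_all
      ultimately have "norm b *\<^sub>R a = norm a *\<^sub>R b" by (simp only:)
      then have "norm b * (a \<bullet> x) = norm a * (b \<bullet> x)" by (metis inner_scaleR_left)
      then show False using ab nz \<open>norm b *\<^sub>R a = norm a *\<^sub>R b\<close> by simp
    qed
  next
    assume ns: "x \<notin> singular"
    show "\<exists>!u. outer_unit_normal K x u"
      unfolding outer_unit_normal_iff[OF x] using gauge_grad[OF ns] gauge_grad_unique[OF ns] x by metis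
  qed
  then show ?thesis unfolding regular_boundary_def frontier_eq by blast
qed

lemma gauss_map_eq:
  assumes "x \<in> regular_boundary K" shows "gauss_map K x = gauge_grad x /\<^sub>R norm (gauge_grad x)"
proof -
  have x: "gauge_fun x = 1" "x \<notin> singular" using assms by (auto simp: regular_boundary_eq)
  have "outer_unit_normal K x (gauge_grad x /\<^sub>R norm (gauge_grad x))"
    unfolding outer_unit_normal_iff[OF x(1)] using gauge_grad[OF x(2)] x(1) by auto
  moreover have "\<exists>!u. outer_unit_normal K x u" using assms by (simp add: regular_boundary_def)
  ultimately show ?thesis unfolding gauss_map_def by (metis the1_equality)
qed

text \<open>Closed graph argument with compact target \<open>polar\<close>: the relation a \<bullet>
  y = gauge_fun y is closed, and off \<open>singular\<close> it determines \<open>a\<close>.\<close>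

lemma continuous_on_gauge_grad: "continuous_on (- singular) gauge_grad"
proof -
  have "(\<lambda>y. (y, gauge_grad y)) ` (- singular) = ((- singular) \<times> polar) \<inter> {z. snd z \<bullet> fst z = gauge_fun (fst z)}"
    using gauge_grad gauge_grad_unique by (auto simp: image_iff)
  moreover have "closed {z :: (real^3) \<times> (real^3). snd z \<bullet> fst z = gauge_fun (fst z)}"
    by (intro closed_Collect_eq continuous_intros continuous_on_compose2[OF continuous_on_gauge[of UNIV]]) auto
  ultimately have "closedin (top_of_set ((- singular) \<times> polar)) ((\<lambda>y. (y, gauge_grad y)) ` (- singular))"
    by (auto simp: closedin_closed)
  then show ?thesis
    using continuous_closed_graph_eq[OF compact_polar, of gauge_grad "- singular"] gauge_grad(1) by auto
qed

end

text \<open>Infinitely many small translates of a bounded part of \<open>F\<close> along \<open>e\<close> are disjoint and lie in a fixed ball.\<close>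

lemma negligible_closed_line_transversal:
  fixes F :: "'a::euclidean_space set"
  assumes F: "closed F" and e: "e \<noteq> 0" and tr: "\<And>x s. x \<in> F \<Longrightarrow> 0 < s \<Longrightarrow> x + s *\<^sub>R e \<notin> F"
  shows "negligible F"
proof -
  have "negligible (F \<inter> cball 0 k)" if k: "0 \<le> k" for k
  proof -
    let ?A = "F \<inter> cball 0 k"
    have cA: "compact ?A" by (intro closed_Int_compact F) simp
    have Am: "?A \<in> lmeasurable" by (rule lmeasurable_compact[OF cA])
    let ?T = "\<lambda>n::nat. (+) ((1 / Suc n) *\<^sub>R e) ` ?A"
    have disj: "disjoint_family ?T"
    proof -
      have no: "?T m \<inter> ?T n = {}" if "m < n" for m n
      proof (rule ccontr)
        assume "?T m \<inter> ?T n \<noteq> {}"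
        then obtain x y where xy: "x \<in> F" "y \<in> F" "(1 / Suc m) *\<^sub>R e + x = (1 / Suc n) *\<^sub>R e + y" by blast
        then have "y = x + (1 / Suc m - 1 / Suc n) *\<^sub>R e" by (simp add: algebra_simps)
        moreover have "1 / real (Suc n) < 1 / real (Suc m)"
          using that by (intro divide_strict_left_mono) auto
        then have "0 < 1 / real (Suc m) - 1 / real (Suc n)" by simp
        ultimately show False using tr[OF xy(1)] xy(2) by blast
      qed
      show ?thesis
        unfolding disjoint_family_on_def
      proof (intro ballI impI)
        fix m n :: nat assume "m \<noteq> n"
        then show "?T m \<inter> ?T n = {}" using no[of m n] no[of n m] by (cases "m < n") auto
      qed
    qed
    have Tm: "?T n \<in> lmeasurable" for n by (rule measurable_translation[OF Am])
    have sub: "(\<Union>n. ?T n) \<subseteq> cball 0 (k + norm e)"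
    proof
      fix z assume "z \<in> (\<Union>n. ?T n)"
      then obtain n x where z: "x \<in> ?A" "z = (1 / real (Suc n)) *\<^sub>R e + x" by blast
      have "norm z \<le> (1 / real (Suc n)) * norm e + norm x"
        unfolding z(2) by (rule norm_triangle_le) simp
      moreover have "(1 / real (Suc n)) * norm e \<le> 1 * norm e" by (intro mult_right_mono) auto
      ultimately show "z \<in> cball 0 (k + norm e)" using z(1) by simp
    qed
    have "(\<Sum>n. emeasure lebesgue (?T n)) = emeasure lebesgue (\<Union>n. ?T n)"
      by (rule suminf_emeasure) (use Tm disj in \<open>auto dest: fmeasurableD\<close>)
    also have "\<dots> \<le> emeasure lebesgue (cball 0 (k + norm e) :: 'a set)"
      by (rule emeasure_mono[OF sub]) auto
    also have "\<dots> < \<infinity>" using lmeasurable_cball[of 0 "k + norm e"] by (simp add: fmeasurable_def)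
    finally have fin: "(\<Sum>n. emeasure lebesgue (?T n)) < \<infinity>" .
    have eT: "emeasure lebesgue (?T n) = ennreal (leb ?A)" for n
      by (subst emeasure_eq_measure2[OF Tm]) (simp only: measure_translation)
    from fin have fin': "(\<Sum>n::nat. ennreal (leb ?A)) < \<infinity>" by (simp only: eT)
    have "leb ?A = 0"
    proof (rule ccontr)
      assume "leb ?A \<noteq> 0"
      then have p: "0 < leb ?A" using measure_nonneg[of lebesgue ?A] by linarith
      have "summable (\<lambda>n::nat. leb ?A)"
        by (rule summable_suminf_not_top) (use fin' in auto)
      then have "(\<lambda>n::nat. leb ?A) \<longlonglongrightarrow> 0" by (rule summable_LIMSEQ_zero)
      then show False using p by (simp add: LIMSEQ_const_iff)
    qed
    then show ?thesis using Am by (simp add: negligible_iff_measure0)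
  qed
  then have "negligible (\<Union>k::nat. F \<inter> cball 0 (real k))" by (intro negligible_countable_Union) auto
  moreover have "F \<subseteq> (\<Union>k::nat. F \<inter> cball 0 (real k))"
    using real_arch_simple by auto
  ultimately show ?thesis by (rule negligible_subset)
qed

section \<open>Negligibility of the singular set\<close>

context origin_body begin

text \<open>Two subgradients at \<open>y\<close> are kept apart by fixed levels in one coordinate.
  This makes each piece closed, by compactness of \<open>polar\<close>, and rational levels exhaust
  \<open>singular\<close> by countably many pieces.\<close>

definition singular_piece :: "3 \<Rightarrow> real \<Rightarrow> real \<Rightarrow> (real^3) set" where
  "singular_piece i p q = {y. \<exists>a\<in>polar. \<exists>b\<in>polar. a $ i \<le> p \<and> q \<le> b $ i \<and> a \<bullet> y = gauge_fun y \<and> b \<bullet> y = gauge_fun y}"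

lemma closed_singular_piece: "closed (singular_piece i p q)"
proof -
  have T: "closed {z :: (real^3) \<times> (real^3). fst z \<bullet> snd z = gauge_fun (snd z)}"
    by (intro closed_Collect_eq continuous_intros continuous_on_compose2[OF continuous_on_gauge[of UNIV]]) auto
  have proj: "closed {y. \<exists>a\<in>S. a \<bullet> y = gauge_fun y}" if S: "compact S" for S
    using closed_compact_projection[OF S T] by (simp add: Bex_def)
  have "compact (polar \<inter> {a. a $ i \<le> p})" "compact (polar \<inter> {a. a $ i \<ge> q})"
    by (intro compact_Int_closed compact_polar closed_halfspace_component_le_cart closed_halfspace_component_ge_cart)+
  then have "closed ({y. \<exists>a\<in>polar \<inter> {a. a $ i \<le> p}. a \<bullet> y = gauge_fun y} \<inter> {y. \<exists>a\<in>polar \<inter> {a. a $ i \<ge> q}. a \<bullet> y = gauge_fun y})"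
    by (intro closed_Int proj)
  also have "\<dots> = singular_piece i p q" by (auto simp: singular_piece_def)
  finally show ?thesis .
qed

text \<open>Subgradients are monotone: along the i-th axis their i-th coordinate cannot fall from at
  least \<open>q\<close> to at most \<open>p\<close>. Hence a line in that direction meets the piece
  at most once.\<close>

lemma negligible_singular_piece:
  assumes "p < q" shows "negligible (singular_piece i p q)"
proof (rule negligible_closed_line_transversal[OF closed_singular_piece])
  show "axis i (1 :: real) \<noteq> 0" by (simp add: axis_eq_0_iff)
  fix x s assume x: "x \<in> singular_piece i p q" and s: "0 < (s :: real)"
  show "x + s *\<^sub>R axis i 1 \<notin> singular_piece i p q"
  proof
    assume "x + s *\<^sub>R axis i 1 \<in> singular_piece i p q"
    then obtain a where a: "a \<in> polar" "a $ i \<le> p" "a \<bullet> (x + s *\<^sub>R axis i 1) = gauge_fun (x + s *\<^sub>R axis i 1)"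
      by (auto simp: singular_piece_def)
    obtain b where b: "b \<in> polar" "q \<le> b $ i" "b \<bullet> x = gauge_fun x" using x by (auto simp: singular_piece_def)
    have "b \<bullet> (x + s *\<^sub>R axis i 1) \<le> a \<bullet> (x + s *\<^sub>R axis i 1)" unfolding a(3) by (rule gauge_upper[OF b(1)])
    moreover have "a \<bullet> x \<le> b \<bullet> x" unfolding b(3) by (rule gauge_upper[OF a(1)])
    ultimately have "s * b $ i \<le> s * a $ i" by (simp add: inner_add_right inner_axis)
    then have "b $ i \<le> a $ i" using s by simp
    then show False using a(2) b(2) assms by linarith
  qed
qed

lemma singular_eq: "singular = (\<Union>(i, p, q)\<in>{(i, p, q). p \<in> \<rat> \<and> q \<in> \<rat> \<and> p < q}. singular_piece i p q)"
proof
  show "singular \<subseteq> (\<Union>(i, p, q)\<in>{(i, p, q). p \<in> \<rat> \<and> q \<in> \<rat> \<and> p < q}. singular_piece i p q)"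
  proof
    fix y assume "y \<in> singular"
    then obtain a b where ab: "a \<in> polar" "b \<in> polar" "a \<noteq> b" "a \<bullet> y = gauge_fun y" "b \<bullet> y = gauge_fun y"
      by (auto simp: singular_def)
    then obtain i where "a $ i \<noteq> b $ i" by (auto simp: vec_eq_iff)
    then obtain a' b' where ab': "a' \<in> polar" "b' \<in> polar" "a' $ i < b' $ i" "a' \<bullet> y = gauge_fun y" "b' \<bullet> y = gauge_fun y"
      using ab by (metis linorder_neqE_linordered_idom)
    obtain p where p: "p \<in> \<rat>" "a' $ i < p" "p < b' $ i" using Rats_dense_in_real[OF ab'(3)] by blast
    obtain q where q: "q \<in> \<rat>" "p < q" "q < b' $ i" using Rats_dense_in_real[OF p(3)] by blast
    have "y \<in> singular_piece i p q" unfolding singular_piece_def using ab' p q by (intro CollectI bexI[of _ a'] bexI[of _ b'] conjI) auto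
    then show "y \<in> (\<Union>(i, p, q)\<in>{(i, p, q). p \<in> \<rat> \<and> q \<in> \<rat> \<and> p < q}. singular_piece i p q)"
      using p q by blast
  qed
  show "(\<Union>(i, p, q)\<in>{(i, p, q). p \<in> \<rat> \<and> q \<in> \<rat> \<and> p < q}. singular_piece i p q) \<subseteq> singular"
  proof clarsimp
    fix y i and p q :: real assume "y \<in> singular_piece i p q" "p < q"
    then obtain a b where ab: "a \<in> polar" "b \<in> polar" "a $ i < b $ i" "a \<bullet> y = gauge_fun y" "b \<bullet> y = gauge_fun y"
      unfolding singular_piece_def by (auto dest: order.strict_trans1 order.strict_trans2)
    then have "a \<noteq> b" by auto
    with ab show "y \<in> singular" unfolding singular_def by blast
  qed
qed

lemma countable_singular_index: "countable {(i :: 3, p :: real, q :: real). p \<in> \<rat> \<and> q \<in> \<rat> \<and> p < q}"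
proof (rule countable_subset)
  show "{(i :: 3, p :: real, q :: real). p \<in> \<rat> \<and> q \<in> \<rat> \<and> p < q} \<subseteq> UNIV \<times> \<rat> \<times> \<rat>" by auto
qed (intro countable_SIGMA countable_rat countable_finite finite)

lemma negligible_singular: "negligible singular"
  unfolding singular_eq
  by (rule negligible_countable_Union) (auto intro!: countable_image countable_singular_index negligible_singular_piece)

lemma borel_singular: "singular \<in> sets borel"
  unfolding singular_eq
  by (rule sets.countable_UN'[OF countable_singular_index]) (auto intro: borel_closed closed_singular_piece)

end

section \<open>Flat cones\<close>

text \<open>Identifies \<open>real^2 \<times> real\<close> with \<open>real^3\<close>, so that cones
  over plane sets can be measured slice by slice with Fubini.\<close>

definition join3 :: "(real^2) \<times> real \<Rightarrow> real^3" where
  "join3 p = (\<chi> i. if i = 1 then fst p $ 1 else if i = 2 then fst p $ 2 else snd p)"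

lemma join3_nth [simp]: "join3 p $ 1 = fst p $ 1" "join3 p $ 2 = fst p $ 2" "join3 p $ 3 = snd p"
  by (simp_all add: join3_def)

lemma join3_scale: "s *\<^sub>R join3 (y, z) = join3 (s *\<^sub>R y, s * z)"
  by (simp add: vec_eq_iff forall_3)

lemma join3_eq_iff: "join3 p = join3 q \<longleftrightarrow> p = q"
proof
  assume "join3 p = join3 q"
  then have "join3 p $ i = join3 q $ i" for i by simp
  from this[of 1] this[of 2] this[of 3] show "p = q"
    by (simp add: prod_eq_iff vec_eq_iff forall_2)
qed simp

lemma continuous_on_join3: "continuous_on S join3"
  unfolding join3_def[abs_def]
proof (rule continuous_on_vec_lambda)
  fix i :: 3
  show "continuous_on S (\<lambda>p. if i = 1 then fst p $ 1 else if i = 2 then fst p $ 2 else snd p)"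
    by (cases "i = 1"; cases "i = 2") (auto intro!: continuous_intros)
qed

lemma prod_Basis_cart: "(\<Prod>b\<in>Basis. x \<bullet> b) = (\<Prod>i\<in>UNIV. x $ i)" for x :: "real^'n"
proof -
  have B: "(Basis :: (real^'n) set) = (\<lambda>i. axis i 1) ` UNIV" by (auto simp: Basis_vec_def)
  have "inj (\<lambda>i::'n. axis i (1::real))" by (auto simp: inj_on_def axis_eq_axis)
  then show ?thesis unfolding B by (simp add: prod.reindex inner_axis)
qed

lemma lborel_join3: "distr (lborel :: ((real^2) \<times> real) measure) borel join3 = lborel"
proof (rule lborel_eqI[symmetric])
  have m: "join3 \<in> borel_measurable borel" by (rule borel_measurable_continuous_onI[OF continuous_on_join3])
  fix l u :: "real^3" assume lu: "\<And>b. b \<in> Basis \<Longrightarrow> l \<bullet> b \<le> u \<bullet> b"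
  have lui: "l $ i \<le> u $ i" for i using lu[of "axis i 1"] by (simp add: inner_axis axis_in_Basis_iff)
  let ?l = "\<chi> i::2. if i = 1 then l $ 1 else l $ 2" and ?u = "\<chi> i::2. if i = 1 then u $ 1 else u $ 2"
  have "join3 -` box l u = box ?l ?u \<times> box (l $ 3) (u $ 3)"
    by (auto simp: mem_box_cart forall_2 forall_3)
  then have "emeasure (distr (lborel :: ((real^2) \<times> real) measure) borel join3) (box l u)
      = emeasure (lborel \<Otimes>\<^sub>M lborel) (box ?l ?u \<times> box (l $ 3) (u $ 3))"
    using m by (subst emeasure_distr) (simp_all add: lborel_prod)
  also have "\<dots> = emeasure lborel (box ?l ?u) * emeasure lborel (box (l $ 3) (u $ 3))"
    by (rule lborel.emeasure_pair_measure_Times) auto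
  also have "emeasure lborel (box ?l ?u) = ennreal ((u $ 1 - l $ 1) * (u $ 2 - l $ 2))"
  proof (subst emeasure_lborel_box)
    show "?l \<bullet> b \<le> ?u \<bullet> b" if "b \<in> Basis" for b
      using that lui by (auto simp: Basis_vec_def inner_axis)
    show "ennreal (\<Prod>b\<in>Basis. (?u - ?l) \<bullet> b) = ennreal ((u $ 1 - l $ 1) * (u $ 2 - l $ 2))"
      by (simp add: prod_Basis_cart UNIV_2)
  qed
  also have "emeasure lborel (box (l $ 3) (u $ 3)) = ennreal (u $ 3 - l $ 3)"
    using lui[of 3] by simp
  also have "ennreal ((u $ 1 - l $ 1) * (u $ 2 - l $ 2)) * ennreal (u $ 3 - l $ 3) = ennreal (\<Prod>b\<in>Basis. (u - l) \<bullet> b)"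
    unfolding prod_Basis_cart UNIV_3
    using lui[of 1] lui[of 2] lui[of 3] by (subst ennreal_mult[symmetric]) (simp_all add: mult.assoc)
  finally show "emeasure (distr (lborel :: ((real^2) \<times> real) measure) borel join3) (box l u) = ennreal (\<Prod>b\<in>Basis. (u - l) \<bullet> b)" .
qed simp

text \<open>The slice at height \<open>z\<close> is \<open>E\<close> scaled by \<open>z / h\<close>,
  of area \<open>(z / h)^2\<close> times that of \<open>E\<close>; integration over
  \<open>[0, h]\<close> gives the factor \<open>h / 3\<close>.\<close>

lemma emeasure_flat_cone:
  fixes E :: "(real^2) set"
  assumes E: "E \<in> sets borel" and h: "0 < h"
  defines "C \<equiv> {s *\<^sub>R join3 (y, h) |s y. y \<in> E \<and> 0 < s \<and> s \<le> 1}"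
  shows "C \<in> sets borel" "emeasure lborel C = ennreal (h / 3) * emeasure lborel E"
proof -
  define X where "X = {p :: (real^2) \<times> real. 0 < snd p \<and> snd p \<le> h \<and> (h / snd p) *\<^sub>R fst p \<in> E}"
  have [measurable]: "E \<in> sets borel" by (rule E)
  have Xb: "X \<in> sets (borel \<Otimes>\<^sub>M borel)"
  proof -
    have "X = {p \<in> space (borel \<Otimes>\<^sub>M borel). 0 < snd p \<and> snd p \<le> h \<and> (h / snd p) *\<^sub>R fst p \<in> E}"
      by (simp add: X_def space_pair_measure)
    also have "\<dots> \<in> sets (borel \<Otimes>\<^sub>M borel)" by measurable
    finally show ?thesis .
  qed
  have Xb': "X \<in> sets borel" using Xb unfolding borel_prod .
  have m: "join3 \<in> borel_measurable borel" by (rule borel_measurable_continuous_onI[OF continuous_on_join3])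
  have C: "join3 -` C = X"
  proof (rule set_eqI)
    fix p :: "(real^2) \<times> real"
    obtain x z where p: "p = (x, z)" by (cases p)
    have "join3 (x, z) \<in> C \<longleftrightarrow> (\<exists>s y. y \<in> E \<and> 0 < s \<and> s \<le> 1 \<and> x = s *\<^sub>R y \<and> z = s * h)"
      unfolding C_def by (auto simp: join3_scale join3_eq_iff)
    also have "\<dots> \<longleftrightarrow> 0 < z \<and> z \<le> h \<and> (h / z) *\<^sub>R x \<in> E"
    proof
      assume "\<exists>s y. y \<in> E \<and> 0 < s \<and> s \<le> 1 \<and> x = s *\<^sub>R y \<and> z = s * h"
      then show "0 < z \<and> z \<le> h \<and> (h / z) *\<^sub>R x \<in> E" using h by auto
    next
      assume "0 < z \<and> z \<le> h \<and> (h / z) *\<^sub>R x \<in> E"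
      then show "\<exists>s y. y \<in> E \<and> 0 < s \<and> s \<le> 1 \<and> x = s *\<^sub>R y \<and> z = s * h"
        using h by (intro exI[of _ "z / h"] exI[of _ "(h / z) *\<^sub>R x"]) auto
    qed
    finally show "p \<in> join3 -` C \<longleftrightarrow> p \<in> X" by (simp add: p X_def)
  qed
  \<comment> \<open>The continuous inverse of \<open>join3\<close>; it exhibits \<open>C\<close> as
    the preimage of the Borel set \<open>X\<close>.\<close>
  define split3 where "split3 x = ((\<chi> i. if i = 1 then x $ 1 else x $ 2) :: real^2, x $ 3)" for x :: "real^3"
  have js: "join3 (split3 x) = x" for x by (simp add: split3_def vec_eq_iff forall_3)
  have "continuous_on UNIV split3"
    unfolding split3_def[abs_def]
  proof (intro continuous_on_Pair continuous_on_vec_lambda)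
    show "continuous_on UNIV (\<lambda>x :: real^3. if i = 1 then x $ 1 else x $ 2)" for i :: 2
      by (cases "i = 1") (auto intro!: continuous_intros)
    show "continuous_on UNIV (\<lambda>x :: real^3. x $ 3)" by (intro continuous_intros)
  qed
  then have sm: "split3 \<in> borel_measurable borel" by (rule borel_measurable_continuous_onI)
  have "C = split3 -` X"
  proof (rule set_eqI)
    fix x
    have "x \<in> C \<longleftrightarrow> split3 x \<in> join3 -` C" by (simp add: js)
    then show "x \<in> C \<longleftrightarrow> x \<in> split3 -` X" by (simp add: C)
  qed
  then show Cb: "C \<in> sets borel" using measurable_sets[OF sm Xb'] by simp
  have "emeasure lborel C = emeasure (distr (lborel :: ((real^2) \<times> real) measure) borel join3) C"
    unfolding lborel_join3 ..
  also have "\<dots> = emeasure (lborel \<Otimes>\<^sub>M lborel) X"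
    using m Cb by (subst emeasure_distr) (simp_all add: lborel_prod C)
  also have "\<dots> = (\<integral>\<^sup>+z. emeasure lborel ((\<lambda>x. (x, z)) -` X) \<partial>lborel)"
    by (rule lborel_pair.emeasure_pair_measure_alt2) (use Xb in simp)
  also have "\<dots> = (\<integral>\<^sup>+z. emeasure lborel E * (ennreal ((z / h)\<^sup>2) * indicator {0..h} z) \<partial>lborel)"
  proof (intro nn_integral_cong)
    fix z :: real
    show "emeasure lborel ((\<lambda>x. (x, z)) -` X) = emeasure lborel E * (ennreal ((z / h)\<^sup>2) * indicator {0..h} z)"
    proof (cases "0 < z \<and> z \<le> h")
      case True
      have "(\<lambda>x. (x, z)) -` X = (\<lambda>x. (z / h) *\<^sub>R x + 0) ` E"
      proof (rule set_eqI)
        fix x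
        have "x \<in> (\<lambda>x. (z / h) *\<^sub>R x + 0) ` E \<longleftrightarrow> (h / z) *\<^sub>R x \<in> E"
        proof
          assume "(h / z) *\<^sub>R x \<in> E"
          then show "x \<in> (\<lambda>x. (z / h) *\<^sub>R x + 0) ` E"
            using True h by (intro image_eqI[of _ _ "(h / z) *\<^sub>R x"]) auto
        qed (use True h in auto)
        then show "x \<in> (\<lambda>x. (x, z)) -` X \<longleftrightarrow> x \<in> (\<lambda>x. (z / h) *\<^sub>R x + 0) ` E" using True by (simp add: X_def)
      qed
      then have "emeasure lebesgue ((\<lambda>x. (x, z)) -` X) = ennreal (\<bar>z / h\<bar> ^ 2) * emeasure lebesgue E"
        using emeasure_lebesgue_affine[of "z / h" "0 :: real^2" E] by simp
      moreover have "(\<lambda>x. (x, z)) -` X \<in> sets borel" using measurable_sets[OF _ Xb', of "\<lambda>x. (x, z)" borel] by simp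
      ultimately show ?thesis using True E by (simp add: mult.commute)
    next
      case False
      then have e: "(\<lambda>x. (x, z)) -` X = {}" by (auto simp: X_def)
      \<comment> \<open>At \<open>z = 0\<close> the slice is empty although 0 lies in
        \<open>{0..h}\<close>; there the factor \<open>(z / h)^2\<close> vanishes.\<close>
      show ?thesis
      proof (cases "z = 0")
        case True then show ?thesis unfolding e by simp
      next
        case nz: False
        then have "z \<notin> {0..h}" using False by auto
        then show ?thesis unfolding e by simp
      qed
    qed
  qed
  also have "\<dots> = emeasure lborel E * (\<integral>\<^sup>+z. ennreal ((z / h)\<^sup>2) * indicator {0..h} z \<partial>lborel)"
    by (rule nn_integral_cmult) measurable
  also have "(\<integral>\<^sup>+z. ennreal ((z / h)\<^sup>2) * indicator {0..h} z \<partial>lborel) = ennreal (h ^ 3 / (3 * h\<^sup>2) - 0 ^ 3 / (3 * h\<^sup>2))"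
  proof (rule nn_integral_FTC_Icc)
    fix z :: real
    have "((\<lambda>z. z ^ 3 / (3 * h\<^sup>2)) has_real_derivative 3 * z\<^sup>2 / (3 * h\<^sup>2)) (at z)"
      by (intro DERIV_cdivide) (auto intro!: derivative_eq_intros)
    then show "((\<lambda>z. z ^ 3 / (3 * h\<^sup>2)) has_real_derivative (z / h)\<^sup>2) (at z)"
      by (simp add: power_divide)
  qed (use h in auto)
  also have "h ^ 3 / (3 * h\<^sup>2) - 0 ^ 3 / (3 * h\<^sup>2) = h / 3" using h by (simp add: power3_eq_cube power2_eq_square)
  finally show "emeasure lborel C = ennreal (h / 3) * emeasure lborel E" by (simp add: mult.commute)
qed

text \<open>The plane a \<bullet> z = 1 lies at distance \<open>1 / norm a\<close> from the origin.
  After a rotation that makes it horizontal, the factor \<open>3 * norm a\<close> inverts the volume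
  formula for flat cones.\<close>

lemma plane_chart:
  fixes a :: "real^3"
  assumes a: "a \<noteq> 0"
  obtains \<psi> :: "real^2 \<Rightarrow> real^3" where "\<And>x y. dist (\<psi> x) (\<psi> y) = dist x y" "range \<psi> = {z. a \<bullet> z = 1}"
    "\<And>E. E \<in> sets borel \<Longrightarrow> bounded E \<Longrightarrow> {s *\<^sub>R \<psi> y |s y. y \<in> E \<and> 0 < s \<and> s \<le> 1} \<in> lmeasurable"
    "\<And>E. E \<in> sets borel \<Longrightarrow> bounded E \<Longrightarrow> leb E = 3 * norm a * leb {s *\<^sub>R \<psi> y |s y. y \<in> E \<and> 0 < s \<and> s \<le> 1}"
proof -
  define h where "h = 1 / norm a"
  have h: "0 < h" using a by (simp add: h_def)
  have "norm a = norm (norm a *\<^sub>R axis 3 1 :: real^3)" by simp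
  then obtain T :: "real^3 \<Rightarrow> real^3" where T: "orthogonal_transformation T" "T a = norm a *\<^sub>R axis 3 1"
    by (rule orthogonal_transformation_exists)
  define S where "S = inv T"
  have S: "orthogonal_transformation S" unfolding S_def by (rule orthogonal_transformation_inv[OF T(1)])
  have ST: "S (T x) = x" "T (S x) = x" for x
    using orthogonal_transformation_bij[OF T(1)] unfolding S_def by (simp_all add: bij_is_inj bij_is_surj surj_f_inv_f)
  have linS: "linear S" by (rule orthogonal_transformation_linear[OF S])
  define \<psi> where "\<psi> y = S (join3 (y, h))" for y
  have iso: "dist (\<psi> x) (\<psi> y) = dist x y" for x y
  proof -
    have "dist (\<psi> x) (\<psi> y) = norm (S (join3 (x, h) - join3 (y, h)))"
      by (simp add: \<psi>_def dist_norm linear_diff[OF linS])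
    also have "\<dots> = norm (join3 (x, h) - join3 (y, h))" by (rule orthogonal_transformation_norm[OF S])
    also have "\<dots> = dist x y"
      by (simp add: norm_eq_sqrt_inner inner_vec_def sum_3 sum_2 dist_norm)
    finally show ?thesis .
  qed
  have aT: "a \<bullet> z = norm a * (T z $ 3)" for z
  proof -
    have "a \<bullet> z = T a \<bullet> T z" using T(1) by (simp add: orthogonal_transformation_def)
    then show ?thesis by (simp add: T(2) inner_axis' )
  qed
  have rng: "range \<psi> = {z. a \<bullet> z = 1}"
  proof
    show "range \<psi> \<subseteq> {z. a \<bullet> z = 1}" using a by (auto simp: aT \<psi>_def ST h_def)
    show "{z. a \<bullet> z = 1} \<subseteq> range \<psi>"
    proof
      fix z assume "z \<in> {z. a \<bullet> z = 1}"
      then have "T z $ 3 = h" using a by (simp add: aT h_def field_simps)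
      then have "T z = join3 ((\<chi> i. if i = 1 then T z $ 1 else T z $ 2), h)"
        by (simp add: vec_eq_iff forall_3)
      then have "z = \<psi> (\<chi> i. if i = 1 then T z $ 1 else T z $ 2)" unfolding \<psi>_def by (metis ST(1))
      then show "z \<in> range \<psi>" by blast
    qed
  qed
  have cone: "{s *\<^sub>R \<psi> y |s y. y \<in> E \<and> 0 < s \<and> s \<le> 1} \<in> lmeasurable
      \<and> leb E = 3 * norm a * leb {s *\<^sub>R \<psi> y |s y. y \<in> E \<and> 0 < s \<and> s \<le> 1}"
    if E: "E \<in> sets borel" "bounded E" for E
  proof -
    let ?C = "{s *\<^sub>R join3 (y, h) |s y. y \<in> E \<and> 0 < s \<and> s \<le> 1}"
    note fc = emeasure_flat_cone[OF E(1) h]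
    have Em: "E \<in> lmeasurable" by (rule bounded_set_imp_lmeasurable[OF E(2)]) (use E(1) in simp)
    have eE: "emeasure lborel E = ennreal (leb E)"
      using emeasure_eq_measure2[OF Em] E(1) by simp
    have "emeasure lebesgue ?C = ennreal (h / 3 * leb E)"
      using fc h by (simp add: eE ennreal_mult[symmetric])
    then have Cm: "?C \<in> lmeasurable" and mC: "leb ?C = h / 3 * leb E"
      using fc(1) h by (auto simp: fmeasurable_def measure_def)
    have im: "{s *\<^sub>R \<psi> y |s y. y \<in> E \<and> 0 < s \<and> s \<le> 1} = S ` ?C"
    proof -
      have "s *\<^sub>R \<psi> y = S (s *\<^sub>R join3 (y, h))" for s y by (simp only: \<psi>_def linear_scale[OF linS])
      then show ?thesis unfolding image_Collect by auto
    qed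
    show ?thesis
      unfolding im using measurable_orthogonal_image[OF S Cm] measure_orthogonal_image[OF S Cm] mC a
      by (simp add: h_def)
  qed
  show thesis by (rule that[OF iso rng]) (use cone in blast)+
qed

section \<open>Hausdorff measure of the boundary\<close>

text \<open>Removes the distortion factors of the boundary charts, which are available for
  tolerances below \<open>1 / 4\<close>.\<close>

lemma ennreal_le_limit:
  fixes X Y :: ennreal and \<kappa> :: "real \<Rightarrow> real"
  assumes \<kappa>: "(\<kappa> \<longlongrightarrow> 1) (at_right 0)" and le: "\<And>t. 0 < t \<Longrightarrow> t < 1 / 4 \<Longrightarrow> X \<le> ennreal (\<kappa> t) * Y"
  shows "X \<le> Y"
proof (rule tendsto_lowerbound)
  have "((\<lambda>t. ennreal (\<kappa> t) * Y) \<longlongrightarrow> ennreal 1 * Y) (at_right 0)"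
    by (rule tendsto_mult_ennreal[OF tendsto_ennrealI[OF \<kappa>] tendsto_const]) auto
  then show "((\<lambda>t. ennreal (\<kappa> t) * Y) \<longlongrightarrow> Y) (at_right 0)" by simp
  show "\<forall>\<^sub>F t in at_right 0. X \<le> ennreal (\<kappa> t) * Y"
    unfolding eventually_at_right_field by (rule exI[of _ "1 / 4"]) (use le in auto)
qed simp

context origin_body begin

lemma gauge_measurable [measurable]: "gauge_fun \<in> borel_measurable borel"
  by (rule borel_measurable_continuous_onI[OF continuous_on_gauge])

text \<open>The cone over \<open>A\<close> without its apex, written through the radial projection
  of its points so that measurability follows from that of the gauge.\<close>

definition boundary_cone :: "(real^3) set \<Rightarrow> (real^3) set" where
  "boundary_cone A = {y \<in> K. y \<noteq> 0 \<and> y /\<^sub>R gauge_fun y \<in> A}"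

lemma boundary_cone_borel: assumes A: "A \<in> sets borel" shows "boundary_cone A \<in> sets borel"
proof -
  have [measurable]: "A \<in> sets borel" "K \<in> sets borel"
    using A compact_imp_closed[OF compact] by (auto intro: borel_closed)
  have "boundary_cone A = {y \<in> space borel. y \<in> K \<and> y \<noteq> 0 \<and> inverse (gauge_fun y) *\<^sub>R y \<in> A}"
    by (auto simp: boundary_cone_def)
  also have "\<dots> \<in> sets borel" by measurable
  finally show ?thesis .
qed

lemma boundary_cone_lmeasurable: assumes A: "A \<in> sets borel" shows "boundary_cone A \<in> lmeasurable"
proof (rule bounded_set_imp_lmeasurable)
  show "bounded (boundary_cone A)"
    by (rule bounded_subset[OF compact_imp_bounded[OF compact]]) (auto simp: boundary_cone_def)
  show "boundary_cone A \<in> sets lebesgue" using boundary_cone_borel[OF A] by simp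
qed

text \<open>A globally Borel version of \<open>gauge_grad\<close>, with the junk value 0 on the null set \<open>singular\<close>.\<close>

definition grad0 :: "real^3 \<Rightarrow> real^3" where
  "grad0 y = indicator (- singular) y *\<^sub>R gauge_grad y"

lemma grad0_measurable [measurable]: "grad0 \<in> borel_measurable borel"
  unfolding grad0_def[abs_def]
  by (rule borel_measurable_continuous_on_indicator[OF _ continuous_on_gauge_grad]) (use borel_singular in simp)

lemma grad0_eq: "y \<notin> singular \<Longrightarrow> grad0 y = gauge_grad y"
  by (simp add: grad0_def)

lemma regularD:
  assumes "x \<in> regular_boundary K"
  shows "gauge_fun x = 1" "x \<notin> singular" "grad0 x \<in> polar" "grad0 x \<bullet> x = 1" "x \<in> K" "norm x \<le> outer_radius" "x \<noteq> 0"
proof -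
  show x: "gauge_fun x = 1" "x \<notin> singular" using assms by (auto simp: regular_boundary_eq)
  show "grad0 x \<in> polar" "grad0 x \<bullet> x = 1" using gauge_grad[OF x(2)] x by (auto simp: grad0_eq)
  show "x \<in> K" using x by (simp add: mem_iff_gauge)
  then show "norm x \<le> outer_radius" by (rule norm_le_outer)
  show "x \<noteq> 0" using x(1) by auto
qed

lemma regular_boundary_borel: "regular_boundary K \<in> sets borel"
proof -
  have [measurable]: "singular \<in> sets borel" by (rule borel_singular)
  have "regular_boundary K = {x \<in> space borel. gauge_fun x = 1 \<and> x \<notin> singular}" by (auto simp: regular_boundary_eq)
  also have "\<dots> \<in> sets borel" by measurable
  finally show ?thesis .
qed

lemma grad0_norm_lower: assumes "x \<in> regular_boundary K" shows "1 / outer_radius \<le> norm (grad0 x)"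
proof -
  have "1 = grad0 x \<bullet> x" using regularD(4)[OF assms] by simp
  also have "\<dots> \<le> norm (grad0 x) * norm x" by (rule norm_cauchy_schwarz)
  also have "\<dots> \<le> norm (grad0 x) * outer_radius" by (intro mult_left_mono regularD(6)[OF assms]) simp
  finally show ?thesis using outer_radius(1) by (simp add: field_simps)
qed

lemma boundary_coneD:
  assumes "y \<in> boundary_cone A" "A \<subseteq> regular_boundary K"
  obtains x where "x \<in> A" "y = gauge_fun y *\<^sub>R x" "0 < gauge_fun y" "gauge_fun y \<le> 1" "grad0 y = grad0 x" "y \<notin> singular"
proof -
  have y: "y \<in> K" "y \<noteq> 0" "y /\<^sub>R gauge_fun y \<in> A" using assms(1) by (auto simp: boundary_cone_def)
  let ?x = "y /\<^sub>R gauge_fun y"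
  have g: "0 < gauge_fun y" by (rule gauge_pos[OF y(2)])
  have yx: "y = gauge_fun y *\<^sub>R ?x" using g by simp
  have xs: "?x \<notin> singular" using y(3) assms(2) regularD(2) by blast
  have ys: "y \<notin> singular" using xs singular_scale[OF g, of ?x] yx by simp
  have "gauge_grad y = gauge_grad ?x" using gauge_grad_scale[OF g xs] yx by simp
  then have "grad0 y = grad0 ?x" using xs ys by (simp add: grad0_eq)
  then show thesis using that[OF y(3) yx g _ _ ys] y(1) mem_iff_gauge by blast
qed

lemma boundary_coneI:
  assumes "x \<in> A" "A \<subseteq> regular_boundary K" "0 < s" "s \<le> 1"
  shows "s *\<^sub>R x \<in> boundary_cone A"
proof -
  have "gauge_fun x = 1" "x \<noteq> 0" using regularD assms by blast+
  then show ?thesis using assms by (auto simp: boundary_cone_def mem_iff_gauge gauge_scale)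
qed

text \<open>Area is three times cone volume divided by height, and the tangent plane at a regular
  point \<open>x\<close> lies at distance \<open>1 / norm (grad0 x)\<close> from the origin.\<close>

definition area_meas :: "(real^3) measure" where
  "area_meas = density lborel (\<lambda>y. ennreal (3 * norm (grad0 y)))"

lemma emeasure_area_meas:
  "C \<in> sets borel \<Longrightarrow> emeasure area_meas C = (\<integral>\<^sup>+y. ennreal (3 * norm (grad0 y)) * indicator C y \<partial>lborel)"
  unfolding area_meas_def by (rule emeasure_density) simp_all

lemma sets_area_meas [simp]: "sets area_meas = sets borel"
  by (simp add: area_meas_def)

section \<open>Boundary pieces with nearly constant normal\<close>

context
  fixes B :: "(real^3) set" and a :: "real^3" and \<tau> :: real
  assumes B: "B \<in> sets borel" "B \<subseteq> regular_boundary K"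
    and a: "a \<in> polar" "1 / outer_radius \<le> norm a"
    and near: "\<And>x. x \<in> B \<Longrightarrow> norm (grad0 x - a) \<le> (\<tau> / outer_radius)"
    and tau: "0 \<le> \<tau>" "\<tau> < 1 / 4"
begin

lemma tolerance_nonneg: "0 \<le> (\<tau> / outer_radius)"
  using tau outer_radius by simp

text \<open>Points of \<open>K\<close> have norm at most \<open>outer_radius\<close>, so the
  tolerance \<tau> / outer_radius for gradients becomes the tolerance \<tau> for heights.\<close>

lemma chart_height: assumes x: "x \<in> B" shows "1 - \<tau> \<le> a \<bullet> x" "a \<bullet> x \<le> 1"
proof -
  have r: "x \<in> regular_boundary K" using x B by auto
  show "a \<bullet> x \<le> 1" using gauge_upper[OF a(1), of x] regularD(1)[OF r] by simp
  have "(grad0 x - a) \<bullet> x \<le> norm (grad0 x - a) * norm x" by (rule norm_cauchy_schwarz)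
  also have "\<dots> \<le> (\<tau> / outer_radius) * outer_radius" by (intro mult_mono near x regularD(6)[OF r]) (use tolerance_nonneg in auto)
  also have "\<dots> = \<tau>" using outer_radius(1) by simp
  finally show "1 - \<tau> \<le> a \<bullet> x" using regularD(4)[OF r] by (simp add: inner_diff_left)
qed

text \<open>Convexity gives \<open>grad0 x \<bullet> (x' - x) \<le> 0 \<le> grad0 x' \<bullet> (x' - x)\<close>, and both gradients are close to \<open>a\<close>.\<close>

lemma chart_flat: assumes x: "x \<in> B" and x': "x' \<in> B" shows "\<bar>a \<bullet> (x' - x)\<bar> \<le> (\<tau> / outer_radius) * norm (x' - x)"
proof -
  have one: "a \<bullet> (v - u) \<le> (\<tau> / outer_radius) * norm (v - u)" if u: "u \<in> B" and v: "v \<in> B" for u v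
  proof -
    have ru: "u \<in> regular_boundary K" and rv: "v \<in> regular_boundary K" using u v B by auto
    have "grad0 u \<bullet> v \<le> 1" using gauge_upper[OF regularD(3)[OF ru], of v] regularD(1)[OF rv] by simp
    then have "grad0 u \<bullet> (v - u) \<le> 0" using regularD(4)[OF ru] by (simp add: inner_diff_right)
    then have "a \<bullet> (v - u) \<le> (a - grad0 u) \<bullet> (v - u)" by (simp add: inner_diff_left)
    also have "\<dots> \<le> norm (a - grad0 u) * norm (v - u)" by (rule norm_cauchy_schwarz)
    also have "\<dots> \<le> (\<tau> / outer_radius) * norm (v - u)" using near[OF u] by (intro mult_right_mono) (simp_all add: norm_minus_commute)
    finally show ?thesis .
  qed
  from one[OF x x'] one[OF x' x] show ?thesis by (simp add: inner_diff_right norm_minus_commute abs_le_iff)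
qed

text \<open>Central projection onto the plane a \<bullet> z = 1. Up to the factor
  \<open>1 / ?s'\<close>, the images differ by \<open>x' - x\<close> minus the radial vector
  \<open>w\<close>, which is small because the piece is nearly orthogonal to
  \<open>a\<close>.\<close>

lemma chart_dist:
  assumes x: "x \<in> B" and x': "x' \<in> B"
  defines "D \<equiv> norm (x' /\<^sub>R (a \<bullet> x') - x /\<^sub>R (a \<bullet> x))"
  shows "D \<le> (1 / (1 - \<tau>)\<^sup>2) * norm (x' - x)" "(1 - 2 * \<tau>) * norm (x' - x) \<le> D"
proof -
  let ?t = \<tau>
  let ?d = "norm (x' - x)" and ?s = "a \<bullet> x" and ?s' = "a \<bullet> x'"
  have s: "1 - ?t \<le> ?s" "?s \<le> 1" "1 - ?t \<le> ?s'" "?s' \<le> 1" using chart_height x x' by auto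
  have t: "0 \<le> ?t" "?t < 1 / 4" by (rule tau)+
  have pos: "0 < ?s" "0 < ?s'" using s t by linarith+
  define w where "w = (a \<bullet> (x' - x) / ?s) *\<^sub>R x"
  have eq: "x' /\<^sub>R ?s' - x /\<^sub>R ?s = (1 / ?s') *\<^sub>R ((x' - x) - w)"
  proof -
    have "(x' - x) - w = x' - (1 + (?s' - ?s) / ?s) *\<^sub>R x" by (simp add: w_def inner_diff_right algebra_simps)
    also have "1 + (?s' - ?s) / ?s = ?s' / ?s" using pos by (simp add: field_simps)
    finally have F: "(x' - x) - w = x' - (?s' / ?s) *\<^sub>R x" .
    show ?thesis unfolding F using pos by (simp add: scaleR_diff_right divide_inverse)
  qed
  have "norm w = \<bar>a \<bullet> (x' - x)\<bar> / ?s * norm x" using pos by (simp add: w_def)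
  also have "\<dots> \<le> ((\<tau> / outer_radius) * ?d) / (1 - ?t) * outer_radius"
    using x B s t pos by (intro mult_mono frac_le chart_flat x x' regularD(6)) (use tau outer_radius(1) in \<open>auto simp: zero_le_mult_iff zero_le_divide_iff\<close>)
  also have "\<dots> = ?t / (1 - ?t) * ?d" using outer_radius(1) by simp
  finally have w: "norm w \<le> ?t / (1 - ?t) * ?d" .
  have D: "D = (1 / ?s') * norm ((x' - x) - w)" unfolding D_def eq using pos by simp
  have "norm ((x' - x) - w) \<le> ?d + norm w" by (rule norm_triangle_ineq4)
  also have "\<dots> \<le> (1 / (1 - ?t)) * ?d" using w t by (simp add: field_simps)
  finally have "D \<le> (1 / (1 - ?t)) * ((1 / (1 - ?t)) * ?d)"
    unfolding D using s t pos by (intro mult_mono frac_le) auto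
  then show "D \<le> (1 / (1 - \<tau>)\<^sup>2) * ?d" by (simp add: power2_eq_square)
  have "(1 - 2 * ?t) * ?d \<le> (1 - ?t / (1 - ?t)) * ?d"
  proof (rule mult_right_mono)
    have "?t \<le> 2 * ?t * (1 - ?t)" using t mult_left_mono[of "?t" "1 / 2" "2 * ?t"] by (simp add: algebra_simps)
    then have "?t / (1 - ?t) \<le> 2 * ?t" using t by (simp add: field_simps)
    then show "1 - 2 * ?t \<le> 1 - ?t / (1 - ?t)" by simp
  qed simp
  also have "\<dots> \<le> ?d - norm w" using w by (simp add: algebra_simps)
  also have "\<dots> \<le> norm ((x' - x) - w)" by (rule norm_triangle_ineq2)
  also have "\<dots> \<le> D" unfolding D using s pos mult_right_mono[of 1 "1 / ?s'" "norm ((x' - x) - w)"] by simp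
  finally show "(1 - 2 * ?t) * ?d \<le> D" .
qed

text \<open>\<open>E\<close> is the central projection of the piece, seen in an isometric chart of
  the plane. Heights between 1 - \<tau> and 1 place the flat cone over \<open>E\<close> between
  \<open>boundary_cone B\<close> and its dilate by 1 / (1 - \<tau>), whence the cube in the last
  estimate.\<close>

lemma boundary_chart:
  obtains E :: "(real^2) set" and f :: "real^2 \<Rightarrow> real^3" where "E \<in> sets borel" "bounded E" "f ` E = B"
    "\<And>y y'. y \<in> E \<Longrightarrow> y' \<in> E \<Longrightarrow> dist y y' \<le> (1 / (1 - \<tau>)\<^sup>2) * dist (f y) (f y')"
    "\<And>y y'. y \<in> E \<Longrightarrow> y' \<in> E \<Longrightarrow> (1 - 2 * \<tau>) * dist (f y) (f y') \<le> dist y y'"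
    "3 * norm a * leb (boundary_cone B) \<le> leb E"
    "leb E \<le> (1 / (1 - \<tau>) ^ 3) * (3 * norm a * leb (boundary_cone B))"
proof -
  have "a \<noteq> 0" using a(2) outer_radius(1) by auto
  then obtain \<psi> :: "real^2 \<Rightarrow> real^3" where \<psi>: "\<And>x y. dist (\<psi> x) (\<psi> y) = dist x y" "range \<psi> = {z. a \<bullet> z = 1}"
    "\<And>E. E \<in> sets borel \<Longrightarrow> bounded E \<Longrightarrow> {s *\<^sub>R \<psi> y |s y. y \<in> E \<and> 0 < s \<and> s \<le> 1} \<in> lmeasurable"
    "\<And>E. E \<in> sets borel \<Longrightarrow> bounded E \<Longrightarrow> leb E = 3 * norm a * leb {s *\<^sub>R \<psi> y |s y. y \<in> E \<and> 0 < s \<and> s \<le> 1}"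
    by (rule plane_chart) blast
  let ?t = \<tau>
  have t: "0 \<le> ?t" "?t < 1 / 4" by (rule tau)+
  define f where "f y = \<psi> y /\<^sub>R gauge_fun (\<psi> y)" for y
  define E where "E = f -` B"
  have "continuous_on UNIV \<psi>"
    unfolding continuous_on_iff using \<psi>(1) by auto
  then have [measurable]: "\<psi> \<in> borel_measurable borel" by (rule borel_measurable_continuous_onI)
  have fm: "f \<in> borel_measurable borel" unfolding f_def[abs_def] by measurable
  have Eb: "E \<in> sets borel" unfolding E_def using measurable_sets[OF fm B(1)] by simp
  have a1: "a \<bullet> \<psi> y = 1" for y using \<psi>(2) by auto
  have inv_f: "\<psi> y = f y /\<^sub>R (a \<bullet> f y)" and gp: "0 < gauge_fun (\<psi> y)" for y
  proof -
    have "\<psi> y \<noteq> 0" using a1[of y] by auto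
    then show g: "0 < gauge_fun (\<psi> y)" by (rule gauge_pos)
    have "a \<bullet> f y = inverse (gauge_fun (\<psi> y))" by (simp add: f_def a1)
    then show "\<psi> y = f y /\<^sub>R (a \<bullet> f y)" using g by (simp add: f_def)
  qed
  have surj: "\<exists>y. f y = x \<and> x = (a \<bullet> x) *\<^sub>R \<psi> y" if x: "x \<in> B" for x
  proof -
    have p: "0 < a \<bullet> x" using chart_height(1)[OF x] t by linarith
    then have "a \<bullet> (x /\<^sub>R (a \<bullet> x)) = 1" by simp
    then have "x /\<^sub>R (a \<bullet> x) \<in> range \<psi>" unfolding \<psi>(2) by simp
    then obtain y where y: "\<psi> y = x /\<^sub>R (a \<bullet> x)" by auto
    have "gauge_fun x = 1" using regularD(1) B x by blast
    then have "gauge_fun (\<psi> y) = inverse (a \<bullet> x)" unfolding y using p by (simp add: gauge_scale)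
    then have "f y = x" unfolding f_def using p by (simp add: y)
    then show ?thesis using p y by (intro exI[of _ y]) simp
  qed
  have img: "f ` E = B" unfolding E_def
  proof
    show "B \<subseteq> f ` (f -` B)"
    proof
      fix x assume "x \<in> B"
      then obtain y where "f y = x" using surj by blast
      then show "x \<in> f ` (f -` B)" using \<open>x \<in> B\<close> by blast
    qed
  qed auto
  have d: "dist y y' = norm (f y' /\<^sub>R (a \<bullet> f y') - f y /\<^sub>R (a \<bullet> f y))" for y y'
    using \<psi>(1)[of y' y] inv_f[of y] inv_f[of y'] by (simp add: dist_norm norm_minus_commute)
  have up: "dist y y' \<le> (1 / (1 - ?t)\<^sup>2) * dist (f y) (f y')" and low: "(1 - 2 * ?t) * dist (f y) (f y') \<le> dist y y'"
    if "y \<in> E" "y' \<in> E" for y y'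
    using chart_dist[of "f y" "f y'"] that unfolding d E_def by (simp_all add: dist_norm norm_minus_commute)
  have bE: "bounded E"
  proof (cases "E = {}")
    case False
    then obtain y0 where y0: "y0 \<in> E" by auto
    show ?thesis
      unfolding bounded_def
    proof (intro exI ballI)
      fix y assume y: "y \<in> E"
      have fb: "norm (f z) \<le> outer_radius" if "z \<in> E" for z using that regularD(6) B unfolding E_def by blast
      have "dist y0 y \<le> (1 / (1 - ?t)\<^sup>2) * dist (f y0) (f y)" by (rule up[OF y0 y])
      also have "\<dots> \<le> (1 / (1 - ?t)\<^sup>2) * (2 * outer_radius)"
      proof (intro mult_left_mono)
        show "dist (f y0) (f y) \<le> 2 * outer_radius"
          using fb[OF y0] fb[OF y] norm_triangle_ineq4[of "f y0" "f y"] by (simp add: dist_norm)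
      qed simp
      finally show "dist y0 y \<le> (1 / (1 - ?t)\<^sup>2) * (2 * outer_radius)" .
    qed
  qed simp
  let ?C = "{s *\<^sub>R \<psi> y |s y. y \<in> E \<and> 0 < s \<and> s \<le> 1}"
  have Cm: "?C \<in> lmeasurable" by (rule \<psi>(3)[OF Eb bE])
  have lE: "leb E = 3 * norm a * leb ?C" by (rule \<psi>(4)[OF Eb bE])
  have bm: "boundary_cone B \<in> lmeasurable" by (rule boundary_cone_lmeasurable[OF B(1)])
  have "boundary_cone B \<subseteq> ?C"
  proof
    fix z assume "z \<in> boundary_cone B"
    then obtain x where x: "x \<in> B" "z = gauge_fun z *\<^sub>R x" "0 < gauge_fun z" "gauge_fun z \<le> 1"
      using boundary_coneD B(2) by metis
    obtain y where y: "f y = x" "x = (a \<bullet> x) *\<^sub>R \<psi> y" using surj[OF x(1)] by blast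
    have h: "0 < a \<bullet> x" "a \<bullet> x \<le> 1" using chart_height[OF x(1)] t by auto
    have "z = (gauge_fun z * (a \<bullet> x)) *\<^sub>R \<psi> y" using x(2) y(2) by (metis scaleR_scaleR)
    moreover have "y \<in> E" using x(1) y(1) by (simp add: E_def)
    moreover have "0 < gauge_fun z * (a \<bullet> x)" "gauge_fun z * (a \<bullet> x) \<le> 1"
      using x(3,4) h by (auto intro: mult_le_one)
    ultimately show "z \<in> ?C" by blast
  qed
  then have le1: "leb (boundary_cone B) \<le> leb ?C"
    by (rule measure_mono_fmeasurable[OF _ fmeasurableD[OF bm] Cm])
  let ?q = "1 / (1 - ?t)"
  have "?C \<subseteq> (\<lambda>x. ?q *\<^sub>R x + 0) ` boundary_cone B"
  proof
    fix z assume "z \<in> ?C"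
    then obtain s y where z: "z = s *\<^sub>R \<psi> y" "y \<in> E" "0 < s" "s \<le> 1" by blast
    have fB: "f y \<in> B" using z(2) by (simp add: E_def)
    have h: "1 - ?t \<le> a \<bullet> f y" "a \<bullet> f y \<le> 1" by (rule chart_height[OF fB])+
    \<comment> \<open>Chosen so that \<open>?q * ?k\<close> reproduces the normalisation by a
      \<bullet> f y; it is at most 1 because heights are at least 1 - \<tau>.\<close>
    let ?k = "(1 - ?t) * s / (a \<bullet> f y)"
    have p: "0 < a \<bullet> f y" using h t by linarith
    have "?k *\<^sub>R f y \<in> boundary_cone B"
    proof (rule boundary_coneI[OF fB B(2)])
      show "0 < ?k" using t z p by simp
      have "(1 - ?t) * s \<le> (a \<bullet> f y) * 1" using h t z by (intro mult_mono) auto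
      then show "?k \<le> 1" using p by (simp add: field_simps)
    qed
    moreover have "z = ?q *\<^sub>R (?k *\<^sub>R f y) + 0"
    proof -
      have "1 - ?t \<noteq> 0" using t by simp
      then have "?q * ?k = s * inverse (a \<bullet> f y)" by (simp add: divide_inverse mult.assoc[symmetric])
      then have e: "?q *\<^sub>R (?k *\<^sub>R f y) = s *\<^sub>R (f y /\<^sub>R (a \<bullet> f y))" by (simp only: scaleR_scaleR)
      show ?thesis unfolding e add_0_right z(1) by (simp only: inv_f[of y, symmetric])
    qed
    ultimately show "z \<in> (\<lambda>x. ?q *\<^sub>R x + 0) ` boundary_cone B" by (rule image_eqI[rotated])
  qed
  then have "leb ?C \<le> leb ((\<lambda>x. ?q *\<^sub>R x + 0) ` boundary_cone B)"
  proof (rule measure_mono_fmeasurable[OF _ fmeasurableD[OF Cm]])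
    show "(\<lambda>x. ?q *\<^sub>R x + 0) ` boundary_cone B \<in> lmeasurable"
      using measurable_linear_image[of "\<lambda>x. ?q *\<^sub>R x" "boundary_cone B"] bm
        bounded_linear.linear[OF bounded_linear_scaleR_right] by simp
  qed
  also have "\<dots> = ?q ^ 3 * leb (boundary_cone B)"
    using measure_lebesgue_affine[of ?q 0 "boundary_cone B"] t by simp
  finally have le2: "leb ?C \<le> ?q ^ 3 * leb (boundary_cone B)" .
  show thesis
  proof (rule that[OF Eb bE img up low])
    show "3 * norm a * leb (boundary_cone B) \<le> leb E" unfolding lE by (intro mult_left_mono le1) simp
    have "leb E \<le> 3 * norm a * (?q ^ 3 * leb (boundary_cone B))" unfolding lE by (intro mult_left_mono le2) simp
    then show "leb E \<le> (1 / (1 - ?t) ^ 3) * (3 * norm a * leb (boundary_cone B))"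
      by (simp add: power_one_over mult.assoc mult.left_commute)
  qed
qed

lemma hausdorff2_piece_upper:
  "hausdorff2 B \<le> ennreal ((1 / (1 - 2 * \<tau>))\<^sup>2 * (1 / (1 - \<tau>) ^ 3) * (3 * norm a * leb (boundary_cone B)))"
proof -
  obtain E :: "(real^2) set" and f :: "real^2 \<Rightarrow> real^3" where E: "E \<in> sets borel" "bounded E" "f ` E = B"
    "\<And>y y'. y \<in> E \<Longrightarrow> y' \<in> E \<Longrightarrow> (1 - 2 * \<tau>) * dist (f y) (f y') \<le> dist y y'"
    "leb E \<le> (1 / (1 - \<tau>) ^ 3) * (3 * norm a * leb (boundary_cone B))"
    using boundary_chart by metis
  have t: "0 \<le> \<tau>" "\<tau> < 1 / 4" by (rule tau)+
  have Em: "E \<in> lmeasurable" by (rule bounded_set_imp_lmeasurable[OF E(2)]) (use E(1) in simp)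
  let ?L = "1 / (1 - 2 * \<tau>)"
  have "hausdorff2 (f ` E) \<le> ennreal (?L\<^sup>2) * hausdorff2 E"
  proof (rule hausdorff2_lipschitz_image)
    show "0 < ?L" using t by simp
    fix y y' assume "y \<in> E" "y' \<in> E"
    from E(4)[OF this] show "dist (f y) (f y') \<le> ?L * dist y y'" using t by (simp add: field_simps)
  qed
  also have "\<dots> \<le> ennreal (?L\<^sup>2) * emeasure lebesgue E"
    by (intro mult_left_mono hausdorff2_le_lebesgue_plane Em) simp
  also have "\<dots> = ennreal (?L\<^sup>2 * leb E)"
    by (subst emeasure_eq_measure2[OF Em]) (simp add: ennreal_mult)
  also have "\<dots> \<le> ennreal (?L\<^sup>2 * ((1 / (1 - \<tau>) ^ 3) * (3 * norm a * leb (boundary_cone B))))"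
    by (intro ennreal_leI mult_left_mono E(5)) simp
  finally show ?thesis unfolding E(3) by (simp only: mult.assoc)
qed

text \<open>A covering set is known by its diameter alone. The chart turns that into a diameter
  bound for the flat image, and the isodiametric inequality into an area bound; the closure supplies
  compactness.\<close>

lemma hausdorff2_piece_lower:
  assumes d: "bounded C" "B \<subseteq> C"
  shows "3 * norm a * leb (boundary_cone B) \<le> (1 / (1 - \<tau>) ^ 4) * (pi / 4 * (diameter C)\<^sup>2)"
proof -
  obtain E :: "(real^2) set" and f :: "real^2 \<Rightarrow> real^3" where E: "E \<in> sets borel" "bounded E" "f ` E = B"
    "\<And>y y'. y \<in> E \<Longrightarrow> y' \<in> E \<Longrightarrow> dist y y' \<le> (1 / (1 - \<tau>)\<^sup>2) * dist (f y) (f y')"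
    "3 * norm a * leb (boundary_cone B) \<le> leb E"
    using boundary_chart by metis
  let ?U = "1 / (1 - \<tau>)\<^sup>2"
  have d0: "0 \<le> diameter C" using d(1) by (rule diameter_ge_0)
  have "diameter E \<le> ?U * diameter C"
  proof (rule diameter_le_dist)
    fix y y' assume y: "y \<in> E" "y' \<in> E"
    then have "f y \<in> C" "f y' \<in> C" using E(3) d(2) by blast+
    then have "dist (f y) (f y') \<le> diameter C" by (rule diameter_bounded_bound[OF d(1)])
    then have "?U * dist (f y) (f y') \<le> ?U * diameter C" by (intro mult_left_mono) simp_all
    with E(4)[OF y] show "dist y y' \<le> ?U * diameter C" by linarith
  qed (use d0 in simp)
  then have dc: "diameter (closure E) \<le> ?U * diameter C" using diameter_closure[OF E(2)] by simp
  have bc: "bounded (closure E)" using E(2) by (rule bounded_closure)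
  have "leb E \<le> leb (closure E)"
    by (rule measure_mono_fmeasurable[OF closure_subset]) (use E bc in \<open>auto intro: lmeasurable_compact simp: compact_eq_bounded_closed\<close>)
  also have "\<dots> \<le> pi / 4 * (?U * diameter C)\<^sup>2"
  proof (rule isodiametric_plane)
    show "compact (closure E)" using bc by (simp add: compact_eq_bounded_closed)
    show "dist x y \<le> ?U * diameter C" if "x \<in> closure E" "y \<in> closure E" for x y
      using diameter_bounded_bound[OF bc that] dc by linarith
  qed
  also have "\<dots> = (1 / (1 - \<tau>) ^ 4) * (pi / 4 * (diameter C)\<^sup>2)"
    by (simp add: power_mult_distrib power_divide power2_eq_square power4_eq_xxxx)
  finally show ?thesis using E(5) by linarith
qed

text \<open>Both gradients have norm at least \<open>1 / outer_radius\<close>, so the absolute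
  tolerance is at most \<tau> times either norm.\<close>

lemma boundary_cone_grad0:
  assumes y: "y \<in> boundary_cone B"
  shows "norm a \<le> (1 + \<tau>) * norm (grad0 y)" "norm (grad0 y) \<le> (1 + \<tau>) * norm a"
proof -
  obtain x where x: "x \<in> B" "grad0 y = grad0 x" using boundary_coneD[OF y B(2)] by metis
  have n: "norm (grad0 y - a) \<le> (\<tau> / outer_radius)" unfolding x(2) by (rule near[OF x(1)])
  have gl: "1 / outer_radius \<le> norm (grad0 y)" unfolding x(2) using grad0_norm_lower x(1) B(2) by blast
  have e: "(\<tau> / outer_radius) = \<tau> * (1 / outer_radius)" by simp
  have "(\<tau> / outer_radius) \<le> \<tau> * norm (grad0 y)" "(\<tau> / outer_radius) \<le> \<tau> * norm a"
    unfolding e by (intro mult_left_mono gl a(2) tau(1))+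
  moreover have "norm a \<le> norm (grad0 y) + norm (grad0 y - a)" "norm (grad0 y) \<le> norm a + norm (grad0 y - a)"
    using norm_triangle_ineq2[of a "grad0 y"] norm_triangle_ineq2[of "grad0 y" a] by (simp_all add: norm_minus_commute)
  ultimately show "norm a \<le> (1 + \<tau>) * norm (grad0 y)" "norm (grad0 y) \<le> (1 + \<tau>) * norm a"
    using n by (simp_all add: algebra_simps)
qed

lemma emeasure_boundary_cone: "emeasure lborel (boundary_cone B) = ennreal (leb (boundary_cone B))"
  using emeasure_eq_measure2[OF boundary_cone_lmeasurable[OF B(1)]] boundary_cone_borel[OF B(1)] by simp

lemma area_meas_piece:
  shows "emeasure area_meas (boundary_cone B) \<le> ennreal ((1 + \<tau>) * (3 * norm a * leb (boundary_cone B)))"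
    and "ennreal (3 * norm a * leb (boundary_cone B)) \<le> ennreal (1 + \<tau>) * emeasure area_meas (boundary_cone B)"
proof -
  let ?t = \<tau> and ?C = "boundary_cone B"
  have t: "0 \<le> ?t" by (rule tau)
  have cb: "?C \<in> sets lborel" using boundary_cone_borel[OF B(1)] by simp
  have em: "emeasure area_meas ?C = (\<integral>\<^sup>+y. ennreal (3 * norm (grad0 y)) * indicator ?C y \<partial>lborel)"
    using cb by (intro emeasure_area_meas) simp
  also have "\<dots> \<le> (\<integral>\<^sup>+y. ennreal (3 * ((1 + ?t) * norm a)) * indicator ?C y \<partial>lborel)"
    using boundary_cone_grad0(2) by (intro nn_integral_mono) (auto split: split_indicator intro!: ennreal_leI)
  also have "\<dots> = ennreal (3 * ((1 + ?t) * norm a)) * ennreal (leb ?C)"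
    unfolding emeasure_boundary_cone[symmetric] by (rule nn_integral_cmult_indicator[OF cb])
  also have "\<dots> = ennreal ((1 + ?t) * (3 * norm a * leb ?C))"
    using t by (simp add: ennreal_mult[symmetric] mult.assoc mult.left_commute)
  finally show "emeasure area_meas ?C \<le> ennreal ((1 + ?t) * (3 * norm a * leb ?C))" .
  have "ennreal (3 * norm a * leb ?C) = ennreal (3 * norm a) * ennreal (leb ?C)"
    by (simp add: ennreal_mult)
  also have "\<dots> = (\<integral>\<^sup>+y. ennreal (3 * norm a) * indicator ?C y \<partial>lborel)"
    unfolding emeasure_boundary_cone[symmetric] by (rule nn_integral_cmult_indicator[OF cb, symmetric])
  also have "\<dots> \<le> (\<integral>\<^sup>+y. ennreal (1 + ?t) * (ennreal (3 * norm (grad0 y)) * indicator ?C y) \<partial>lborel)"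
  proof (intro nn_integral_mono)
    fix y
    show "ennreal (3 * norm a) * indicator ?C y \<le> ennreal (1 + ?t) * (ennreal (3 * norm (grad0 y)) * indicator ?C y)"
    proof (cases "y \<in> ?C")
      case True
      have "3 * norm a \<le> (1 + ?t) * (3 * norm (grad0 y))" using boundary_cone_grad0(1)[OF True] by simp
      then have "ennreal (3 * norm a) \<le> ennreal ((1 + ?t) * (3 * norm (grad0 y)))" by (rule ennreal_leI)
      also have "\<dots> = ennreal (1 + ?t) * ennreal (3 * norm (grad0 y))" using t by (intro ennreal_mult) auto
      finally show ?thesis using True by simp
    qed simp
  qed
  also have "\<dots> = ennreal (1 + ?t) * emeasure area_meas ?C"
    unfolding em using cb by (intro nn_integral_cmult) simp
  finally show "ennreal (3 * norm a * leb ?C) \<le> ennreal (1 + ?t) * emeasure area_meas ?C" .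
qed

lemma hausdorff2_le_area_piece:
  "hausdorff2 B \<le> ennreal ((1 + \<tau>) * ((1 / (1 - 2 * \<tau>))\<^sup>2 * (1 / (1 - \<tau>) ^ 3))) * emeasure area_meas (boundary_cone B)"
proof -
  let ?k = "(1 / (1 - 2 * \<tau>))\<^sup>2 * (1 / (1 - \<tau>) ^ 3)"
  have k: "0 \<le> ?k" using tau by simp
  have "hausdorff2 B \<le> ennreal (?k * (3 * norm a * leb (boundary_cone B)))" by (rule hausdorff2_piece_upper)
  also have "\<dots> = ennreal ?k * ennreal (3 * norm a * leb (boundary_cone B))" by (rule ennreal_mult[OF k]) simp
  also have "\<dots> \<le> ennreal ?k * (ennreal (1 + \<tau>) * emeasure area_meas (boundary_cone B))"
    by (intro mult_left_mono area_meas_piece(2)) simp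
  also have "\<dots> = ennreal (?k * (1 + \<tau>)) * emeasure area_meas (boundary_cone B)"
    using k tau(1) by (subst ennreal_mult) (simp_all add: mult.assoc)
  finally show ?thesis by (simp only: mult.commute[of ?k])
qed

lemma area_piece_le_diameter:
  assumes "bounded C" "B \<subseteq> C"
  shows "emeasure area_meas (boundary_cone B) \<le> ennreal ((1 + \<tau>) * (1 / (1 - \<tau>) ^ 4)) * ennreal (pi / 4 * (diameter C)\<^sup>2)"
proof -
  have "emeasure area_meas (boundary_cone B) \<le> ennreal ((1 + \<tau>) * (3 * norm a * leb (boundary_cone B)))"
    by (rule area_meas_piece(1))
  also have "\<dots> \<le> ennreal ((1 + \<tau>) * ((1 / (1 - \<tau>) ^ 4) * (pi / 4 * (diameter C)\<^sup>2)))"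
    using tau(1) by (intro ennreal_leI mult_left_mono hausdorff2_piece_lower assms) simp
  also have "\<dots> = ennreal ((1 + \<tau>) * (1 / (1 - \<tau>) ^ 4)) * ennreal (pi / 4 * (diameter C)\<^sup>2)"
    using tau by (subst ennreal_mult[symmetric]) (simp_all add: mult.assoc)
  finally show ?thesis .
qed

end

section \<open>Comparison on the whole regular boundary\<close>

lemma boundary_cone_UN: "boundary_cone (\<Union>i\<in>I. A i) = (\<Union>i\<in>I. boundary_cone (A i))"
  by (auto simp: boundary_cone_def)

text \<open>Gradient values are sorted into countably many disjoint Borel sets of diameter at most
  \<epsilon>, and the estimate is summed over the resulting pieces. The reference gradient is taken
  at a point of the piece, not at a ball centre, because the charts require an element of
  \<open>polar\<close> of norm at least \<open>1 / outer_radius\<close>.\<close>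

lemma hausdorff2_le_area_meas:
  assumes A: "A \<in> sets borel" "A \<subseteq> regular_boundary K"
  shows "hausdorff2 A \<le> emeasure area_meas (boundary_cone A)"
proof (rule ennreal_le_limit)
  show "((\<lambda>t::real. (1 + t) * ((1 / (1 - 2 * t))\<^sup>2 * (1 / (1 - t) ^ 3))) \<longlongrightarrow> 1) (at_right 0)"
    by (rule tendsto_eq_intros refl | simp)+
  fix t :: real assume t: "0 < t" "t < 1 / 4"
  define \<epsilon> where "\<epsilon> = t / outer_radius"
  have eps: "0 < \<epsilon>" "\<epsilon> * outer_radius = t" using t outer_radius(1) by (simp_all add: \<epsilon>_def)
  obtain D :: "(real^3) set" where D: "countable D" "UNIV \<subseteq> closure D" using separable[of UNIV] by metis
  then have Dne: "D \<noteq> {}" by auto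
  let ?\<omega> = "disjointed (\<lambda>j. ball (from_nat_into D j) (\<epsilon> / 2))"
  define P where "P j = A \<inter> grad0 -` ?\<omega> j" for j
  have wb: "?\<omega> j \<in> sets borel" for j
  proof -
    have "range ?\<omega> \<subseteq> sets borel" by (rule sets.range_disjointed_sets) auto
    then show ?thesis by blast
  qed
  have PB: "P j \<in> sets borel" for j
    using A(1) measurable_sets[OF grad0_measurable wb[of j]] by (auto simp: P_def)
  have "\<exists>j. dist (from_nat_into D j) x < \<epsilon> / 2" for x
  proof -
    have "x \<in> closure D" using D(2) by auto
    then obtain y where "y \<in> D" "dist y x < \<epsilon> / 2" using eps by (meson closure_approachable half_gt_zero)
    then show ?thesis using from_nat_into_surj[OF D(1)] by metis
  qed
  then have "(\<Union>j. ball (from_nat_into D j) (\<epsilon> / 2)) = UNIV" by auto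
  then have "(\<Union>j. ?\<omega> j) = UNIV" by (simp add: UN_disjointed_eq)
  then have AU: "A = (\<Union>j. P j)" unfolding P_def by blast
  have dP: "disjoint_family P"
    using disjoint_family_disjointed[of "\<lambda>j. ball (from_nat_into D j) (\<epsilon> / 2)"]
    unfolding disjoint_family_on_def P_def by blast
  let ?k = "(1 + t) * ((1 / (1 - 2 * t))\<^sup>2 * (1 / (1 - t) ^ 3))"
  have piece: "hausdorff2 (P j) \<le> ennreal ?k * emeasure area_meas (boundary_cone (P j))" for j
  proof (cases "P j = {}")
    case False
    then obtain x0 where x0: "x0 \<in> P j" by auto
    have r0: "x0 \<in> regular_boundary K" using x0 A(2) by (auto simp: P_def)
    have sub: "?\<omega> j \<subseteq> ball (from_nat_into D j) (\<epsilon> / 2)" by (rule disjointed_subset)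
    have near: "norm (grad0 x - grad0 x0) \<le> \<epsilon>" if x: "x \<in> P j" for x
    proof -
      have "grad0 x \<in> ball (from_nat_into D j) (\<epsilon> / 2)" "grad0 x0 \<in> ball (from_nat_into D j) (\<epsilon> / 2)"
        using x x0 sub by (auto simp: P_def)
      then show ?thesis using dist_triangle3[of "grad0 x" "grad0 x0" "from_nat_into D j"] by (simp add: dist_norm)
    qed
    have "hausdorff2 (P j) \<le> ennreal ((1 + t) * ((1 / (1 - 2 * t))\<^sup>2 * (1 / (1 - t) ^ 3))) * emeasure area_meas (boundary_cone (P j))"
      by (rule hausdorff2_le_area_piece[OF PB _ regularD(3)[OF r0] grad0_norm_lower[OF r0] near[unfolded \<epsilon>_def]])
        (use A(2) eps t in \<open>auto simp: P_def\<close>)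
    then show ?thesis .
  qed simp
  have "hausdorff2 A \<le> (\<Sum>j. hausdorff2 (P j))" unfolding AU by (rule hausdorff2_UN)
  also have "\<dots> \<le> (\<Sum>j. ennreal ?k * emeasure area_meas (boundary_cone (P j)))"
    using piece by (intro suminf_le) auto
  also have "\<dots> = ennreal ?k * (\<Sum>j. emeasure area_meas (boundary_cone (P j)))" by simp
  also have "(\<Sum>j. emeasure area_meas (boundary_cone (P j))) = emeasure area_meas (\<Union>j. boundary_cone (P j))"
  proof (rule suminf_emeasure)
    show "disjoint_family (\<lambda>j. boundary_cone (P j))"
      using dP unfolding disjoint_family_on_def boundary_cone_def by blast
  qed (use boundary_cone_borel[OF PB] in auto)
  also have "(\<Union>j. boundary_cone (P j)) = boundary_cone A" by (subst AU) (simp add: boundary_cone_UN)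
  finally show "hausdorff2 A \<le> ennreal ?k * emeasure area_meas (boundary_cone A)" .
qed

text \<open>The sets \<open>P k\<close> exhaust \<open>A\<close>; on pieces of \<open>P k\<close> of diameter below \<open>1 / (k + 1)\<close> the normals vary by at most
  \<open>\<epsilon>\<close>, so that every such covering piece satisfies the isodiametric bound up to a factor close to 1.\<close>

lemma area_meas_le_hausdorff2:
  assumes A: "A \<in> sets borel" "A \<subseteq> regular_boundary K"
  shows "emeasure area_meas (boundary_cone A) \<le> hausdorff2 A"
proof (rule ennreal_le_limit)
  show "((\<lambda>t::real. (1 + t) * (1 / (1 - t) ^ 4)) \<longlongrightarrow> 1) (at_right 0)"
    by (rule tendsto_eq_intros refl | simp)+
  fix t :: real assume t: "0 < t" "t < 1 / 4"
  define \<epsilon> where "\<epsilon> = t / outer_radius"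
  have eps: "0 < \<epsilon>" "\<epsilon> * outer_radius = t" using t outer_radius(1) by (simp_all add: \<epsilon>_def)
  let ?R = "regular_boundary K"
  let ?k = "(1 + t) * (1 / (1 - t) ^ 4)"
  define P where "P k = {x \<in> A. \<forall>x'\<in>?R. dist x' x < 1 / Suc k \<longrightarrow> norm (grad0 x - grad0 x') \<le> \<epsilon>}" for k :: nat
  have contR: "continuous_on ?R grad0"
  proof (rule continuous_on_eq)
    show "continuous_on ?R gauge_grad"
      by (rule continuous_on_subset[OF continuous_on_gauge_grad]) (auto simp: regular_boundary_eq)
  qed (auto simp: grad0_eq regular_boundary_eq)
  have PB: "P k \<in> sets borel" for k
  proof -
    \<comment> \<open>The complement of \<open>P k\<close> in \<open>A\<close> comes from an
      uncountable union over \<open>x'\<close>; it is measurable because each member is relatively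
      open.\<close>
    define N where "N x' = {x \<in> ?R. dist x' x < 1 / Suc k \<and> \<epsilon> < norm (grad0 x - grad0 x')}" for x'
    have "openin (top_of_set ?R) (N x')" for x'
    proof -
      have "N x' = (?R \<inter> ball x' (1 / Suc k)) \<inter> (?R \<inter> (\<lambda>x. norm (grad0 x - grad0 x')) -` {\<epsilon><..})"
        by (auto simp: N_def)
      moreover have "openin (top_of_set ?R) (?R \<inter> ball x' (1 / Suc k))" by (simp add: openin_open_Int)
      moreover have "openin (top_of_set ?R) (?R \<inter> (\<lambda>x. norm (grad0 x - grad0 x')) -` {\<epsilon><..})"
        by (intro continuous_openin_preimage_gen continuous_intros contR)
      ultimately show ?thesis by (simp add: openin_Int)
    qed
    then have "openin (top_of_set ?R) (\<Union>x'\<in>?R. N x')" by blast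
    then obtain T where T: "open T" "(\<Union>x'\<in>?R. N x') = ?R \<inter> T" by (auto simp: openin_open)
    have "P k = A - T"
    proof -
      have "x \<in> P k \<longleftrightarrow> x \<notin> (\<Union>x'\<in>?R. N x')" if "x \<in> A" for x
        using that A(2) by (auto simp: P_def N_def not_le)
      then show ?thesis using T(2) A(2) by (auto simp: P_def)
    qed
    then show ?thesis using A(1) T(1) by simp
  qed
  have PR: "P k \<subseteq> ?R" for k using A(2) by (auto simp: P_def)
  have bound: "emeasure area_meas (boundary_cone (P k)) \<le> ennreal ?k * hausdorff2 A" for k
  proof -
    \<comment> \<open>Half of \<open>1 / (k + 1)\<close>: diameters are bounded by \<delta>
      non-strictly, whereas \<open>P k\<close> asks for strict closeness.\<close>
    define \<delta> where "\<delta> = 1 / (2 * real (Suc k))"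
    have \<delta>: "0 < \<delta>" "\<delta> < 1 / Suc k" by (simp_all add: \<delta>_def field_simps)
    have "ennreal (1 / ?k) * emeasure area_meas (boundary_cone (P k)) \<le> hausdorff2_pre \<delta> A"
      unfolding hausdorff2_pre_def
    proof (rule INF_greatest)
      fix C :: "nat \<Rightarrow> (real^3) set"
      assume "C \<in> {C. A \<subseteq> (\<Union>i. C i) \<and> (\<forall>i. bounded (C i) \<and> diameter (C i) \<le> \<delta>)}"
      then have C: "A \<subseteq> (\<Union>i. C i)" "\<And>i. bounded (C i)" "\<And>i. diameter (C i) \<le> \<delta>" by auto
      \<comment> \<open>Covering sets are arbitrary; passing to closures keeps the diameters and
        makes the pieces Borel.\<close>
      define Q where "Q i = P k \<inter> closure (C i)" for i
      have QB: "Q i \<in> sets borel" for i using PB by (simp add: Q_def)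
      have bcl: "bounded (closure (C i))" for i using C(2) by (rule bounded_closure)
      have dcl: "diameter (closure (C i)) = diameter (C i)" for i using C(2) by (rule diameter_closure)
      have piece: "emeasure area_meas (boundary_cone (Q i)) \<le> ennreal ?k * ennreal (pi / 4 * (diameter (C i))\<^sup>2)" for i
      proof (cases "Q i = {}")
        case True
        then show ?thesis by (simp add: boundary_cone_def)
      next
        case False
        then obtain x0 where x0: "x0 \<in> Q i" by auto
        have r0: "x0 \<in> ?R" using x0 PR by (auto simp: Q_def)
        have near: "norm (grad0 x - grad0 x0) \<le> \<epsilon>" if x: "x \<in> Q i" for x
        proof -
          have "x \<in> closure (C i)" "x0 \<in> closure (C i)" using x x0 by (auto simp: Q_def)
          then have "dist x0 x \<le> \<delta>"
            using diameter_bounded_bound[OF bcl, of x0 i x] dcl[of i] C(3)[of i] by simp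
          then have "dist x0 x < 1 / Suc k" using \<delta>(2) by linarith
          then show ?thesis using x r0 by (auto simp: Q_def P_def)
        qed
        have "emeasure area_meas (boundary_cone (Q i))
            \<le> ennreal ((1 + t) * (1 / (1 - t) ^ 4)) * ennreal (pi / 4 * (diameter (closure (C i)))\<^sup>2)"
          by (rule area_piece_le_diameter[OF QB _ regularD(3)[OF r0] grad0_norm_lower[OF r0] near[unfolded \<epsilon>_def] _ _ bcl])
            (use PR eps t in \<open>auto simp: Q_def\<close>)
        then show ?thesis unfolding dcl .
      qed
      have "boundary_cone (P k) \<subseteq> (\<Union>i. boundary_cone (Q i))"
      proof -
        have "P k \<subseteq> (\<Union>i. Q i)"
        proof
          fix x assume x: "x \<in> P k"
          then obtain i where "x \<in> C i" using C(1) unfolding P_def by blast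
          then have "x \<in> Q i" using x closure_subset[of "C i"] unfolding Q_def by blast
          then show "x \<in> (\<Union>i. Q i)" by blast
        qed
        then have "boundary_cone (P k) \<subseteq> boundary_cone (\<Union>i. Q i)" by (auto simp: boundary_cone_def)
        then show ?thesis by (simp add: boundary_cone_UN)
      qed
      then have "emeasure area_meas (boundary_cone (P k)) \<le> emeasure area_meas (\<Union>i. boundary_cone (Q i))"
        using boundary_cone_borel[OF QB] by (intro emeasure_mono) auto
      also have "\<dots> \<le> (\<Sum>i. emeasure area_meas (boundary_cone (Q i)))"
        using boundary_cone_borel[OF QB] by (intro emeasure_subadditive_countably) auto
      also have "\<dots> \<le> (\<Sum>i. ennreal ?k * ennreal (pi / 4 * (diameter (C i))\<^sup>2))"
        using piece by (intro suminf_le) auto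
      also have "\<dots> = ennreal ?k * (\<Sum>i. ennreal (pi / 4 * (diameter (C i))\<^sup>2))" by simp
      finally have "ennreal (1 / ?k) * emeasure area_meas (boundary_cone (P k))
          \<le> ennreal (1 / ?k) * (ennreal ?k * (\<Sum>i. ennreal (pi / 4 * (diameter (C i))\<^sup>2)))"
        by (rule mult_left_mono) simp
      also have "\<dots> = (\<Sum>i. ennreal (pi / 4 * (diameter (C i))\<^sup>2))"
        using t by (simp add: mult.assoc[symmetric] ennreal_mult[symmetric] del: ennreal_suminf_cmult)
      finally show "ennreal (1 / ?k) * emeasure area_meas (boundary_cone (P k)) \<le> (\<Sum>i. ennreal (pi / 4 * (diameter (C i))\<^sup>2))" .
    qed
    also have "\<dots> \<le> hausdorff2 A" by (rule hausdorff2_pre_le_hausdorff2[OF \<delta>(1)])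
    finally have "ennreal ?k * (ennreal (1 / ?k) * emeasure area_meas (boundary_cone (P k))) \<le> ennreal ?k * hausdorff2 A"
      by (rule mult_left_mono) simp
    then show ?thesis using t by (simp add: mult.assoc[symmetric] ennreal_mult[symmetric])
  qed
  have inc: "incseq P"
  proof (rule incseq_SucI, rule subsetI)
    fix k x assume x: "x \<in> P k"
    have "1 / real (Suc (Suc k)) \<le> 1 / real (Suc k)" by (simp add: field_simps)
    then show "x \<in> P (Suc k)" using x unfolding P_def by force
  qed
  have "A = (\<Union>k. P k)"
  proof
    show "A \<subseteq> (\<Union>k. P k)"
    proof
      fix x assume x: "x \<in> A"
      then have xR: "x \<in> ?R" using A(2) by auto
      obtain d where d: "0 < d" "\<And>x'. x' \<in> ?R \<Longrightarrow> dist x' x < d \<Longrightarrow> dist (grad0 x') (grad0 x) < \<epsilon>"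
        using contR xR eps(1) unfolding continuous_on_iff by metis
      obtain k :: nat where k: "1 / real (Suc k) < d" using d(1) nat_approx_posE by metis
      have "x \<in> P k" unfolding P_def
      proof (intro CollectI conjI ballI impI x)
        fix x' assume "x' \<in> ?R" "dist x' x < 1 / Suc k"
        then have "dist (grad0 x') (grad0 x) < \<epsilon>" using d(2) k by force
        then show "norm (grad0 x - grad0 x') \<le> \<epsilon>" by (simp add: dist_norm norm_minus_commute)
      qed
      then show "x \<in> (\<Union>k. P k)" by blast
    qed
  qed (auto simp: P_def)
  then have "boundary_cone A = (\<Union>k. boundary_cone (P k))" using boundary_cone_UN[of P UNIV] by simp
  moreover have "(SUP k. emeasure area_meas (boundary_cone (P k))) = emeasure area_meas (\<Union>k. boundary_cone (P k))"
  proof (rule SUP_emeasure_incseq)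
    show "incseq (\<lambda>k. boundary_cone (P k))" using inc unfolding incseq_def boundary_cone_def by blast
  qed (use boundary_cone_borel[OF PB] in auto)
  ultimately show "emeasure area_meas (boundary_cone A) \<le> ennreal ?k * hausdorff2 A"
    using bound by (metis SUP_least)
qed

theorem hausdorff2_boundary:
  assumes "A \<in> sets borel" "A \<subseteq> regular_boundary K"
  shows "hausdorff2 A = emeasure area_meas (boundary_cone A)"
  using hausdorff2_le_area_meas[OF assms] area_meas_le_hausdorff2[OF assms] by (rule antisym)

end

section \<open>Cone-volume measure\<close>

context origin_body begin

lemma volume_pos: "0 < leb K"
proof -
  have "0 < leb (cball 0 inner_radius :: (real^3) set)" using inner_radius(1) by simp
  also have "\<dots> \<le> leb K"
    by (intro measure_mono_fmeasurable inner_radius(2) lmeasurable_compact compact) auto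
  finally show ?thesis .
qed

lemma K_borel [measurable]: "K \<in> sets borel"
  using compact_imp_closed[OF compact] by (rule borel_closed)

lemma emeasure_K: "emeasure lborel K = ennreal (leb K)"
  using emeasure_eq_measure2[OF lmeasurable_compact[OF compact]] K_borel by simp

text \<open>The Gauss map extended radially. On the null set \<open>singular\<close> an arbitrary
  unit vector is inserted, so that the map goes into the sphere everywhere and can be used in
  \<open>distr\<close>.\<close>

definition unit_normal :: "real^3 \<Rightarrow> real^3" where
  "unit_normal y = (if y \<in> singular then axis 1 1 else grad0 y /\<^sub>R norm (grad0 y))"

lemma grad0_nonzero: assumes "y \<notin> singular" shows "grad0 y \<noteq> 0"
proof -
  have "y \<noteq> 0" using assms zero_singular by auto
  then have "0 < grad0 y \<bullet> y" using gauge_grad(2)[OF assms] gauge_pos[of y] by (simp add: grad0_eq[OF assms])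
  then show ?thesis by auto
qed

lemma unit_normal_measurable [measurable]: "unit_normal \<in> borel_measurable borel"
proof -
  have [measurable]: "singular \<in> sets borel" by (rule borel_singular)
  show ?thesis unfolding unit_normal_def[abs_def] by measurable
qed

lemma unit_normal_sphere: "unit_normal y \<in> sphere 0 1"
  using grad0_nonzero[of y] by (simp add: unit_normal_def)

abbreviation sphere_borel :: "(real^3) measure" where
  "sphere_borel \<equiv> restrict_space borel (sphere 0 1)"

lemma unit_normal_measurable_sphere: "unit_normal \<in> measurable borel sphere_borel"
  by (rule measurable_restrict_space2[OF _ unit_normal_measurable]) (use unit_normal_sphere in auto)

lemma sets_sphere_borelD: "\<omega> \<in> sets sphere_borel \<Longrightarrow> \<omega> \<in> sets borel"
  by (subst (asm) sets_restrict_space_iff) auto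

lemma unit_normal_vimage: "\<omega> \<in> sets sphere_borel \<Longrightarrow> unit_normal -` \<omega> \<in> sets borel"
  using measurable_sets[OF unit_normal_measurable sets_sphere_borelD] by simp

text \<open>On every Borel set of the sphere the Hausdorff set function equals a genuine measure, so
  \<open>measure_of\<close> returns that measure. The cone over the boundary points with normal in
  \<omega> consists, up to singular points, of the points of \<open>K\<close> whose radial
  projection has such a normal.\<close>

lemma surface_area_measure_eq:
  "surface_area_measure K = distr (density lborel (\<lambda>y. ennreal (3 * norm (grad0 y)) * indicator K y)) sphere_borel unit_normal"
    (is "_ = distr ?D _ _")
proof -
  let ?\<mu> = "distr ?D sphere_borel unit_normal"
  have m: "unit_normal \<in> measurable ?D sphere_borel"
    using unit_normal_measurable_sphere by simp
  have eq: "hausdorff2 {x \<in> regular_boundary K. gauss_map K x \<in> \<omega>} = emeasure ?\<mu> \<omega>"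
    if w: "\<omega> \<in> sets sphere_borel" for \<omega>
  proof -
    let ?A = "{x \<in> regular_boundary K. gauss_map K x \<in> \<omega>}"
    have gm: "gauss_map K x = unit_normal x" if "x \<in> regular_boundary K" for x
      using gauss_map_eq[OF that] regularD(2)[OF that] by (simp add: unit_normal_def grad0_eq)
    have A: "?A = regular_boundary K \<inter> unit_normal -` \<omega>" using gm by auto
    have Ab: "?A \<in> sets borel" unfolding A using regular_boundary_borel unit_normal_vimage[OF w] by blast
    \<comment> \<open>At singular points the two indicators may differ, but the default value 0 of
      \<open>grad0\<close> makes both sides vanish.\<close>
    have ind: "ennreal (3 * norm (grad0 y)) * indicator (boundary_cone ?A) y
        = ennreal (3 * norm (grad0 y)) * indicator K y * indicator (unit_normal -` \<omega>) y" for y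
    proof (cases "y \<in> singular")
      case True
      then show ?thesis by (simp add: grad0_def)
    next
      case False
      then have nz: "y \<noteq> 0" using zero_singular by auto
      have g: "0 < gauge_fun y" by (rule gauge_pos[OF nz])
      have xs: "y /\<^sub>R gauge_fun y \<notin> singular" using False singular_scale[of "inverse (gauge_fun y)" y] g by simp
      then have xr: "y /\<^sub>R gauge_fun y \<in> regular_boundary K" using g by (simp add: regular_boundary_eq gauge_scale)
      have "grad0 (y /\<^sub>R gauge_fun y) = grad0 y"
        using gauge_grad_scale[OF _ False, of "inverse (gauge_fun y)"] g xs False by (simp add: grad0_eq)
      then have "unit_normal (y /\<^sub>R gauge_fun y) = unit_normal y" using xs False by (simp add: unit_normal_def)
      then have "y \<in> boundary_cone ?A \<longleftrightarrow> y \<in> K \<and> unit_normal y \<in> \<omega>"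
        unfolding A boundary_cone_def using nz xr by auto
      then show ?thesis by (auto split: split_indicator)
    qed
    have "hausdorff2 ?A = emeasure area_meas (boundary_cone ?A)"
      by (rule hausdorff2_boundary[OF Ab]) auto
    also have "\<dots> = (\<integral>\<^sup>+y. ennreal (3 * norm (grad0 y)) * indicator K y * indicator (unit_normal -` \<omega>) y \<partial>lborel)"
      unfolding emeasure_area_meas[OF boundary_cone_borel[OF Ab]] ind ..
    also have "\<dots> = emeasure ?D (unit_normal -` \<omega>)"
      using unit_normal_vimage[OF w] by (subst emeasure_density) simp_all
    also have "\<dots> = emeasure ?\<mu> \<omega>"
      using m w by (subst emeasure_distr) simp_all
    finally show ?thesis .
  qed
  have sp: "space sphere_borel = sphere 0 1" by (simp add: space_restrict_space)
  have sub: "sets sphere_borel \<subseteq> Pow (sphere 0 1)" using sets.space_closed[of sphere_borel] sp by simp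
  have "surface_area_measure K = measure_of (sphere 0 1) (sets sphere_borel) (emeasure ?\<mu>)"
    unfolding surface_area_measure_def
  proof (rule measure_of_eq[OF sub])
    fix \<omega> assume "\<omega> \<in> sigma_sets (sphere 0 1) (sets sphere_borel)"
    then have "\<omega> \<in> sets sphere_borel" using sets.sigma_sets_eq[of sphere_borel] sp by simp
    then show "hausdorff2 {x \<in> regular_boundary K. gauss_map K x \<in> \<omega>} = emeasure ?\<mu> \<omega>" by (rule eq)
  qed
  also have "\<dots> = ?\<mu>"
    using measure_of_of_measure[of ?\<mu>] sp by simp
  finally show ?thesis .
qed

text \<open>The support function is 1 at the gradient, attained at the radial projection of
  \<open>y\<close>; homogeneity gives the value at its normalisation.\<close>

lemma support_fun_unit_normal:
  assumes "y \<notin> singular" shows "support_fun K (unit_normal y) = 1 / norm (grad0 y)"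
proof -
  have nz: "y \<noteq> 0" using assms zero_singular by auto
  have g: "0 < gauge_fun y" by (rule gauge_pos[OF nz])
  have s: "support_fun K (grad0 y) = 1"
  proof (rule support_polar)
    show "grad0 y \<in> polar" using gauge_grad(1)[OF assms] by (simp add: grad0_eq[OF assms])
    show "y /\<^sub>R gauge_fun y \<in> K" using g by (simp add: mem_iff_gauge gauge_scale)
    show "grad0 y \<bullet> (y /\<^sub>R gauge_fun y) = 1" using gauge_grad(2)[OF assms] g by (simp add: grad0_eq[OF assms])
  qed
  show ?thesis
    using support_fun_scale[OF compact nonempty, of "inverse (norm (grad0 y))" "grad0 y"] assms s
    by (simp add: unit_normal_def divide_inverse)
qed

lemma support_fun_measurable: "compact A \<Longrightarrow> A \<noteq> {} \<Longrightarrow> support_fun A \<in> borel_measurable borel"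
  by (intro borel_measurable_continuous_onI continuous_on_support_fun)

lemma AE_nonsingular: "AE y in lborel. y \<notin> singular"
proof -
  have "singular \<in> null_sets lborel"
    using negligible_singular borel_singular by (simp add: negligible_iff_null_sets null_sets_completion_iff)
  then show ?thesis by (rule AE_not_in)
qed

text \<open>The area density \<open>3 * norm (grad0 y)\<close> and the factor
  \<open>support_fun K / 3\<close> at the normal cancel, leaving plain volume.\<close>

lemma cone_volume_measure_emeasure:
  assumes w: "\<omega> \<in> sets sphere_borel"
  shows "emeasure (cone_volume_measure K) \<omega> = emeasure lborel (K \<inter> unit_normal -` \<omega>)"
proof -
  let ?D = "density lborel (\<lambda>y. ennreal (3 * norm (grad0 y)) * indicator K y)"
  let ?\<mu> = "distr ?D sphere_borel unit_normal"
  have [measurable]: "support_fun K \<in> borel_measurable borel" by (rule support_fun_measurable[OF compact nonempty])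
  have [measurable]: "unit_normal -` \<omega> \<in> sets borel" by (rule unit_normal_vimage[OF w])
  have hm: "(\<lambda>u. ennreal (support_fun K u / 3)) \<in> borel_measurable sphere_borel"
    by (rule measurable_restrict_space1) measurable
  have m: "unit_normal \<in> measurable ?D sphere_borel"
    using unit_normal_measurable_sphere by simp
  have "emeasure (cone_volume_measure K) \<omega> = (\<integral>\<^sup>+u. ennreal (support_fun K u / 3) * indicator \<omega> u \<partial>?\<mu>)"
    unfolding cone_volume_measure_def surface_area_measure_eq
    by (rule emeasure_density) (use hm w in simp_all)
  also have "\<dots> = (\<integral>\<^sup>+y. ennreal (support_fun K (unit_normal y) / 3) * indicator \<omega> (unit_normal y) \<partial>?D)"
    by (rule nn_integral_distr[OF m]) (use hm w in measurable)
  also have "\<dots> = (\<integral>\<^sup>+y. ennreal (support_fun K (unit_normal y) / 3) * indicator (unit_normal -` \<omega>) y \<partial>?D)"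
    by (simp add: indicator_def)
  also have "\<dots> = (\<integral>\<^sup>+y. ennreal (3 * norm (grad0 y)) * indicator K y * (ennreal (support_fun K (unit_normal y) / 3) * indicator (unit_normal -` \<omega>) y) \<partial>lborel)"
    by (subst nn_integral_density) simp_all
  also have "\<dots> = (\<integral>\<^sup>+y. indicator (K \<inter> unit_normal -` \<omega>) y \<partial>lborel)"
  proof (rule nn_integral_cong_AE, use AE_nonsingular in eventually_elim)
    case (elim y)
    have "ennreal (3 * norm (grad0 y)) * ennreal (support_fun K (unit_normal y) / 3) = 1"
      unfolding support_fun_unit_normal[OF elim] using grad0_nonzero[OF elim]
      by (simp add: ennreal_mult[symmetric])
    then show ?case by (auto split: split_indicator)
  qed
  also have "\<dots> = emeasure lborel (K \<inter> unit_normal -` \<omega>)" by simp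
  finally show ?thesis .
qed

lemma cone_volume_prob_eq:
  "cone_volume_prob K = distr (uniform_measure lborel K) sphere_borel unit_normal"
proof (rule measure_eqI)
  have S: "sets (cone_volume_prob K) = sets sphere_borel"
    by (simp add: cone_volume_prob_def cone_volume_measure_def surface_area_measure_eq)
  then show "sets (cone_volume_prob K) = sets (distr (uniform_measure lborel K) sphere_borel unit_normal)" by simp
  fix \<omega> assume "\<omega> \<in> sets (cone_volume_prob K)"
  then have w: "\<omega> \<in> sets sphere_borel" using S by simp
  have fin: "K \<inter> unit_normal -` \<omega> \<in> lmeasurable"
    by (rule fmeasurable_Int_fmeasurable[OF lmeasurable_compact[OF compact]]) (use unit_normal_vimage[OF w] in simp)
  have e: "emeasure lborel (K \<inter> unit_normal -` \<omega>) = ennreal (leb (K \<inter> unit_normal -` \<omega>))"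
    using emeasure_eq_measure2[OF fin] unit_normal_vimage[OF w] by simp
  have "emeasure (cone_volume_prob K) \<omega> = ennreal (1 / leb K) * ennreal (leb (K \<inter> unit_normal -` \<omega>))"
    by (simp add: cone_volume_prob_def cone_volume_measure_emeasure[OF w] e)
  also have "\<dots> = ennreal (leb (K \<inter> unit_normal -` \<omega>)) / ennreal (leb K)"
    using volume_pos by (simp add: divide_ennreal ennreal_mult[symmetric])
  also have "\<dots> = emeasure (uniform_measure lborel K) (unit_normal -` \<omega>)"
    using unit_normal_vimage[OF w] by (subst emeasure_uniform_measure) (simp_all add: e emeasure_K)
  also have "\<dots> = emeasure (distr (uniform_measure lborel K) sphere_borel unit_normal) \<omega>"
    using unit_normal_measurable_sphere w by (subst emeasure_distr) simp_all
  finally show "emeasure (cone_volume_prob K) \<omega> = emeasure (distr (uniform_measure lborel K) sphere_borel unit_normal) \<omega>" .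
qed

lemma AE_uniform: "AE y in uniform_measure lborel K. y \<in> K \<and> y \<notin> singular"
  by (rule AE_uniform_measureI) (use AE_nonsingular in auto)

lemma emeasure_uniform_UNIV: "emeasure (uniform_measure lborel K) UNIV = 1"
  using volume_pos by (simp add: emeasure_K divide_ennreal)

lemma finite_measure_uniform: "finite_measure (uniform_measure lborel K)"
  by (rule finite_measureI) (simp add: emeasure_uniform_UNIV)

text \<open>By homogeneity the quotient of support functions may be evaluated at the gradient
  instead of the unit normal, and there the denominator is 1.\<close>

lemma integral_cone_volume_prob:
  assumes L: "compact L" "L \<noteq> {}"
  shows "(\<integral>u. (support_fun L u / support_fun K u) powr p \<partial>cone_volume_prob K)
       = (\<integral>y. support_fun L (grad0 y) powr p \<partial>uniform_measure lborel K)"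
proof -
  have [measurable]: "support_fun K \<in> borel_measurable borel" "support_fun L \<in> borel_measurable borel"
    by (intro support_fun_measurable compact nonempty L)+
  have "(\<integral>u. (support_fun L u / support_fun K u) powr p \<partial>cone_volume_prob K)
      = (\<integral>y. (support_fun L (unit_normal y) / support_fun K (unit_normal y)) powr p \<partial>uniform_measure lborel K)"
    unfolding cone_volume_prob_eq
    by (rule integral_distr) (use unit_normal_measurable_sphere in \<open>simp_all add: measurable_restrict_space1\<close>)
  also have "\<dots> = (\<integral>y. support_fun L (grad0 y) powr p \<partial>uniform_measure lborel K)"
  proof (rule integral_cong_AE)
    show "AE y in uniform_measure lborel K. (support_fun L (unit_normal y) / support_fun K (unit_normal y)) powr p = support_fun L (grad0 y) powr p"
      using AE_uniform
    proof eventually_elim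
      case (elim y)
      then have y: "y \<notin> singular" by simp
      have "support_fun L (unit_normal y) = support_fun L (grad0 y) / norm (grad0 y)"
        using support_fun_scale[OF L, of "inverse (norm (grad0 y))" "grad0 y"] y
        by (simp add: unit_normal_def divide_inverse mult.commute)
      then show ?case using grad0_nonzero[OF y] by (simp add: support_fun_unit_normal[OF y])
    qed
  qed simp_all
  finally show ?thesis .
qed

end

section \<open>First mixed volume\<close>

lemma support_fun_image_scale:
  assumes A: "compact A" "A \<noteq> {}" and c: "0 \<le> c"
  shows "support_fun ((*\<^sub>R) c ` A) x = c * support_fun A x"
proof (rule antisym)
  show "support_fun ((*\<^sub>R) c ` A) x \<le> c * support_fun A x"
    by (rule support_fun_least) (use A c support_fun_upper[OF A(1)] in \<open>auto intro!: mult_left_mono\<close>)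
  obtain a where a: "a \<in> A" "x \<bullet> a = support_fun A x" using support_fun_attained[OF A] .
  have "x \<bullet> (c *\<^sub>R a) \<le> support_fun ((*\<^sub>R) c ` A) x"
    by (rule support_fun_upper) (use a A in \<open>auto intro: compact_scaling\<close>)
  then show "c * support_fun A x \<le> support_fun ((*\<^sub>R) c ` A) x" using a(2) by simp
qed

lemma support_fun_mono:
  assumes "compact B" "A \<subseteq> B" "A \<noteq> {}" shows "support_fun A x \<le> support_fun B x"
  by (rule support_fun_least) (use assms support_fun_upper in auto)

context origin_body begin

context
  fixes L :: "(real^3) set"
  assumes L: "compact L" "0 \<in> L"
begin

abbreviation quot :: "real^3 \<Rightarrow> real" where
  "quot y \<equiv> support_fun L (grad0 y)"

abbreviation unif :: "(real^3) measure" where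
  "unif \<equiv> uniform_measure lborel K"

lemma Lne: "L \<noteq> {}"
  using L by auto

lemma quot_measurable [measurable]: "quot \<in> borel_measurable borel"
proof -
  have [measurable]: "support_fun L \<in> borel_measurable borel" by (rule support_fun_measurable[OF L(1) Lne])
  show ?thesis by measurable
qed

lemma quot_nonneg: "0 \<le> quot y"
  using support_fun_upper[OF L, of "grad0 y"] by simp

lemma quot_bounded: obtains M where "0 \<le> M" "\<And>y. quot y \<le> M"
proof -
  obtain B where B: "\<And>l. l \<in> L \<Longrightarrow> norm l \<le> B" using compact_imp_bounded[OF L(1)] by (auto simp: bounded_iff)
  have B0: "0 \<le> B" using B[OF L(2)] by simp
  have "quot y \<le> 1 / inner_radius * B" for y
  proof (rule support_fun_least[OF Lne])
    fix l assume l: "l \<in> L"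
    have n: "norm (grad0 y) \<le> 1 / inner_radius"
    proof (cases "y \<in> singular")
      case True then show ?thesis using inner_radius(1) by (simp add: grad0_def)
    next
      case False then show ?thesis using polar_norm_le[OF gauge_grad(1)[OF False]] by (simp add: grad0_eq)
    qed
    have "grad0 y \<bullet> l \<le> norm (grad0 y) * norm l" by (rule norm_cauchy_schwarz)
    also have "\<dots> \<le> 1 / inner_radius * B" using inner_radius(1) by (intro mult_mono n B l) auto
    finally show "grad0 y \<bullet> l \<le> 1 / inner_radius * B" .
  qed
  moreover have "0 \<le> 1 / inner_radius * B" using B0 inner_radius(1) by simp
  ultimately show thesis using that by blast
qed

lemma integrable_unif:
  assumes m: "g \<in> borel_measurable borel" and b: "\<And>y. \<bar>g y :: real\<bar> \<le> B"
  shows "integrable unif g"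
  by (rule finite_measure.integrable_const_bound[OF finite_measure_uniform, of _ B]) (use m b in auto)

lemma measure_unif: "A \<in> sets borel \<Longrightarrow> A \<subseteq> K \<Longrightarrow> measure unif A = leb A / leb K"
proof -
  assume A: "A \<in> sets borel" "A \<subseteq> K"
  have Am: "A \<in> lmeasurable"
    by (rule bounded_set_imp_lmeasurable[OF bounded_subset[OF compact_imp_bounded[OF compact] A(2)]]) (use A(1) in simp)
  have "emeasure lborel A = ennreal (leb A)" using emeasure_eq_measure2[OF Am] A(1) by simp
  then have "emeasure unif A = ennreal (leb A / leb K)"
    using A volume_pos by (subst emeasure_uniform_measure) (simp_all add: Int_absorb1 emeasure_K divide_ennreal)
  then show ?thesis unfolding measure_def using volume_pos by simp
qed

text \<open>A point \<open>z\<close> of \<open>K + t L\<close> satisfies \<open>gauge_fun z \<le> 1 + t * quot z\<close>, so the sum is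
  covered by dilated radial pieces of \<open>K\<close> on which \<open>quot\<close> is almost constant.\<close>

lemma volume_sum_le:
  assumes \<eta>: "0 < \<eta>"
  obtains C where "0 \<le> C" "\<And>t. 0 \<le> t \<Longrightarrow> t \<le> 1 \<Longrightarrow>
      leb (K + (*\<^sub>R) t ` L) \<le> leb K * (1 + 3 * t * ((\<integral>y. quot y \<partial>unif) + \<eta>) + t\<^sup>2 * C)"
proof -
  obtain M where M: "0 \<le> M" "\<And>y. quot y \<le> M" by (rule quot_bounded) blast
  \<comment> \<open>Level sets of \<open>quot\<close> with mesh \<eta>; \<open>c j\<close> is the
    upper end of level \<open>j\<close>, so \<open>quot\<close> lies in the half-open interval from
    \<open>c j - \<eta>\<close> to \<open>c j\<close>.\<close>
  define idx where "idx y = nat \<lfloor>quot y / \<eta>\<rfloor>" for y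
  define J where "J = Suc (nat \<lfloor>M / \<eta>\<rfloor>)"
  define c where "c j = (real j + 1) * \<eta>" for j :: nat
  define S where "S j = {y \<in> K. y \<notin> singular \<and> idx y = j}" for j
  \<comment> \<open>An upper bound for all levels that is at least 1, so that \<open>m ^ 3\<close>
    dominates both the square and the cube of each \<open>c j\<close>. The later constant 4 is 3 +
    1, the binomial coefficients of these two terms, using t \<le> 1.\<close>
  define m where "m = 1 + real J * \<eta>"
  have m: "1 \<le> m" using \<eta> by (simp add: m_def)
  have c0: "0 < c j" for j using \<eta> by (simp add: c_def)
  have cm: "c j \<le> m" if "j < J" for j
  proof -
    have "(real j + 1) * \<eta> \<le> real J * \<eta>" using that \<eta> by (intro mult_right_mono) auto
    then show ?thesis by (simp add: c_def m_def)
  qed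
  have idx: "idx y < J" "quot y < c (idx y)" "c (idx y) - \<eta> \<le> quot y" for y
  proof -
    have "\<lfloor>quot y / \<eta>\<rfloor> \<le> \<lfloor>M / \<eta>\<rfloor>" using M(2)[of y] \<eta> by (intro floor_mono divide_right_mono) auto
    then show "idx y < J" by (simp add: idx_def J_def nat_mono le_imp_less_Suc)
    have n: "0 \<le> quot y / \<eta>" using quot_nonneg[of y] \<eta> by simp
    then have r: "real (idx y) = of_int \<lfloor>quot y / \<eta>\<rfloor>" by (simp add: idx_def)
    have "quot y / \<eta> < real (idx y) + 1" "real (idx y) \<le> quot y / \<eta>" unfolding r by linarith+
    then show "quot y < c (idx y)" "c (idx y) - \<eta> \<le> quot y" using \<eta> by (simp_all add: c_def field_simps)
  qed
  have [measurable]: "singular \<in> sets borel" by (rule borel_singular)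
  have Sb: "S j \<in> sets borel" for j
  proof -
    have "S j = {y \<in> space borel. y \<in> K \<and> y \<notin> singular \<and> idx y = j}" by (auto simp: S_def)
    also have "\<dots> \<in> sets borel" unfolding idx_def by measurable
    finally show ?thesis .
  qed
  have SK: "S j \<subseteq> K" for j by (auto simp: S_def)
  have Sm: "S j \<in> lmeasurable" for j
    by (rule bounded_set_imp_lmeasurable[OF bounded_subset[OF compact_imp_bounded[OF compact] SK]]) (use Sb in simp)
  define P where "P j = measure unif (S j)" for j
  have P: "leb (S j) = leb K * P j" "0 \<le> P j" for j
    using measure_unif[OF Sb SK] volume_pos by (simp_all add: P_def)
  have intS: "(\<integral>y. (\<Sum>j<J. \<alpha> j * indicator (S j) y) \<partial>unif) = (\<Sum>j<J. \<alpha> j * P j)" for \<alpha> :: "nat \<Rightarrow> real"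
  proof -
    have "integrable unif (\<lambda>y. \<alpha> j * indicator (S j) y)" for j
      by (rule integrable_unif[where B = "\<bar>\<alpha> j\<bar>"]) (use Sb in \<open>auto simp: indicator_def\<close>)
    then show ?thesis using Sb by (subst Bochner_Integration.integral_sum) (simp_all add: P_def)
  qed
  have pick: "(\<Sum>j<J. \<alpha> j * indicator (S j) y) = (if y \<in> K \<and> y \<notin> singular then \<alpha> (idx y) else 0)" for \<alpha> :: "nat \<Rightarrow> real" and y
  proof -
    have "(\<Sum>j<J. \<alpha> j * indicator (S j) y) = (\<Sum>j<J. if j = idx y then (if y \<in> K \<and> y \<notin> singular then \<alpha> j else 0) else 0)"
      by (intro sum.cong) (auto simp: S_def indicator_def)
    then show ?thesis using idx(1)[of y] by simp
  qed
  have bdd: "\<bar>\<Sum>j<J. \<alpha> j * indicator (S j) y\<bar> \<le> (\<Sum>j<J. \<bar>\<alpha> j\<bar>)" for \<alpha> :: "nat \<Rightarrow> real" and y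
  proof (rule order_trans[OF sum_abs], rule sum_mono)
    show "\<bar>\<alpha> j * indicator (S j) y\<bar> \<le> \<bar>\<alpha> j\<bar>" for j by (cases "y \<in> S j") simp_all
  qed
  have intg: "integrable unif (\<lambda>y. \<Sum>j<J. \<alpha> j * indicator (S j) y)" for \<alpha> :: "nat \<Rightarrow> real"
    by (rule integrable_unif[OF _ bdd])
      (intro borel_measurable_sum borel_measurable_times borel_measurable_const borel_measurable_indicator Sb)
  have qi: "integrable unif quot"
    by (rule integrable_unif[where B = M]) (use M quot_nonneg in \<open>auto simp: abs_of_nonneg\<close>)
  let ?E = "\<integral>y. quot y \<partial>unif"
  have one: "(\<Sum>j<J. P j) \<le> 1"
  proof -
    have "(\<Sum>j<J. 1 * P j) = (\<integral>y. (\<Sum>j<J. 1 * indicator (S j) y) \<partial>unif)" by (rule intS[symmetric])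
    also have "\<dots> \<le> (\<integral>y. 1 \<partial>unif)"
    proof (rule integral_mono[OF intg])
      show "integrable unif (\<lambda>y. 1 :: real)" by (rule integrable_unif[where B = 1]) simp_all
      show "(\<Sum>j<J. 1 * indicator (S j) y) \<le> (1 :: real)" for y unfolding pick[of "\<lambda>_. 1"] by simp
    qed
    also have "\<dots> = 1" using emeasure_uniform_UNIV by (simp add: measure_def)
    finally show ?thesis by simp
  qed
  have low: "(\<Sum>j<J. (c j - \<eta>) * P j) \<le> ?E"
  proof -
    have "(\<Sum>j<J. (c j - \<eta>) * P j) = (\<integral>y. (\<Sum>j<J. (c j - \<eta>) * indicator (S j) y) \<partial>unif)" by (rule intS[symmetric])
    also have "\<dots> \<le> ?E"
      by (rule integral_mono[OF intg qi]) (simp only: pick split: if_split, use idx quot_nonneg in auto)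
    finally show ?thesis .
  qed
  have up: "(\<Sum>j<J. c j * P j) \<le> ?E + \<eta>"
  proof -
    have "(\<Sum>j<J. c j * P j) = (\<Sum>j<J. (c j - \<eta>) * P j) + \<eta> * (\<Sum>j<J. P j)"
      by (simp add: sum_distrib_left sum.distrib[symmetric] algebra_simps)
    also have "\<dots> \<le> ?E + \<eta> * 1" using low one \<eta> by (intro add_mono mult_left_mono) auto
    finally show ?thesis by simp
  qed
  show thesis
  proof (rule that[of "4 * m ^ 3"])
    show "0 \<le> 4 * m ^ 3" using m by simp
    fix t :: real assume t: "0 \<le> t" "t \<le> 1"
    let ?T = "K + (*\<^sub>R) t ` L"
    let ?I = "\<lambda>j. (\<lambda>x. (1 + t * c j) *\<^sub>R x + 0) ` S j"
    have pos: "0 < 1 + t * c j" for j using t c0[of j] by (simp add: add_pos_nonneg)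
    have cT: "compact ?T" by (intro compact_set_plus_scaled compact L)
    have Im: "?I j \<in> lmeasurable" for j
      using measurable_linear_image[of "\<lambda>x. (1 + t * c j) *\<^sub>R x" "S j"] Sm[of j]
        bounded_linear.linear[OF bounded_linear_scaleR_right] by simp
    \<comment> \<open>The gradient is constant on rays, hence so is the level. Shrinking
      \<open>z\<close> by \<open>1 + t * c (idx z)\<close> therefore gives a point of
      \<open>K\<close> in the level of \<open>z\<close>.\<close>
    have "?T - singular \<subseteq> (\<Union>j<J. ?I j)"
    proof
      fix z assume z: "z \<in> ?T - singular"
      then obtain k l where kl: "k \<in> K" "l \<in> L" "z = k + t *\<^sub>R l" by (auto simp: set_plus_def)
      let ?a = "grad0 z" and ?j = "idx z"
      have a: "?a \<in> polar" "?a \<bullet> z = gauge_fun z" using gauge_grad z by (auto simp: grad0_eq)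
      have "gauge_fun z = ?a \<bullet> k + t * (?a \<bullet> l)"
        using arg_cong[OF kl(3), of "inner ?a"] a(2) by (simp add: inner_add_right)
      also have "\<dots> \<le> 1 + t * quot z"
        using a(1) kl(1) support_fun_upper[OF L(1) kl(2)] t by (intro add_mono mult_left_mono) (auto simp: polar_def)
      also have "\<dots> \<le> 1 + t * c ?j" using idx(2)[of z] t by (simp add: mult_left_mono)
      finally have g: "gauge_fun z \<le> 1 + t * c ?j" .
      let ?y = "(1 / (1 + t * c ?j)) *\<^sub>R z"
      have p: "0 < 1 / (1 + t * c ?j)" using pos by simp
      have ns: "?y \<notin> singular" using z singular_scale[OF p] by simp
      have "?y \<in> K" using g pos[of ?j] by (simp add: mem_iff_gauge gauge_scale)
      moreover have "idx ?y = ?j" using z ns gauge_grad_scale[OF p, of z] by (simp add: idx_def grad0_eq)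
      ultimately have "?y \<in> S ?j" using ns by (simp add: S_def)
      moreover have "z = (1 + t * c ?j) *\<^sub>R ?y + 0" using pos[of ?j] by simp
      ultimately have "z \<in> ?I ?j" by (rule image_eqI[rotated])
      then show "z \<in> (\<Union>j<J. ?I j)" using idx(1)[of z] by blast
    qed
    then have "leb (?T - singular) \<le> leb (\<Union>j<J. ?I j)"
      using lmeasurable_compact[OF cT] Im borel_singular
      by (intro measure_mono_fmeasurable) (auto intro!: fmeasurable.finite_UN dest: fmeasurableD)
    also have "\<dots> \<le> (\<Sum>j<J. leb (?I j))" by (rule measure_UNION_le) (use Im in \<open>auto dest: fmeasurableD\<close>)
    also have "\<dots> = (\<Sum>j<J. (1 + t * c j) ^ 3 * leb (S j))"
      using pos by (simp only: measure_lebesgue_affine abs_of_pos) simp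
    also have "\<dots> \<le> (\<Sum>j<J. (1 + 3 * t * c j + t\<^sup>2 * (4 * m ^ 3)) * leb (S j))"
    proof (intro sum_mono mult_right_mono)
      fix j assume "j \<in> {..<J}"
      then have cj: "0 \<le> c j" "c j \<le> m" using cm c0[of j] by auto
      have "(c j)\<^sup>2 \<le> m ^ 2" using cj by (intro power_mono) auto
      also have "\<dots> \<le> m ^ 3" using m by (intro power_increasing) auto
      finally have s2: "(c j)\<^sup>2 \<le> m ^ 3" .
      have s3: "(c j) ^ 3 \<le> m ^ 3" using cj by (intro power_mono) auto
      have "(1 + t * c j) ^ 3 = 1 + 3 * t * c j + t\<^sup>2 * (3 * (c j)\<^sup>2 + t * (c j) ^ 3)"
        by (simp add: power3_eq_cube power2_eq_square algebra_simps)
      also have "\<dots> \<le> 1 + 3 * t * c j + t\<^sup>2 * (3 * m ^ 3 + 1 * m ^ 3)"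
        using t cj s2 s3 m by (intro add_left_mono mult_left_mono add_mono mult_mono) auto
      finally show "(1 + t * c j) ^ 3 \<le> 1 + 3 * t * c j + t\<^sup>2 * (4 * m ^ 3)" by simp
    qed simp
    also have "\<dots> = (\<Sum>j<J. leb K * P j + leb K * (3 * t * (c j * P j)) + leb K * (t\<^sup>2 * (4 * m ^ 3) * P j))"
      unfolding P(1) by (intro sum.cong refl) (simp only: distrib_right distrib_left mult_1_left ac_simps)
    also have "\<dots> = leb K * ((\<Sum>j<J. P j) + 3 * t * (\<Sum>j<J. c j * P j) + t\<^sup>2 * (4 * m ^ 3) * (\<Sum>j<J. P j))"
      by (simp only: sum.distrib sum_distrib_left distrib_left)
    also have "\<dots> \<le> leb K * (1 + 3 * t * (?E + \<eta>) + t\<^sup>2 * (4 * m ^ 3) * 1)"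
      using volume_pos t m by (intro mult_left_mono add_mono one up) auto
    finally have "leb (?T - singular) \<le> leb K * (1 + 3 * t * (?E + \<eta>) + t\<^sup>2 * (4 * m ^ 3))" by simp
    moreover have "leb (?T - singular) = leb ?T"
      using negligible_singular lmeasurable_compact[OF cT]
      by (intro measure_Diff_null_set) (auto simp: negligible_iff_null_sets dest: fmeasurableD)
    ultimately show "leb ?T \<le> leb K * (1 + 3 * t * (?E + \<eta>) + t\<^sup>2 * (4 * m ^ 3))" by simp
  qed
qed

lemma rel_quermass_0: assumes "convex_body L" shows "rel_quermass K L 0 = leb K"
proof -
  have "(*\<^sub>R) (0::real) ` L = {0}" using Lne by auto
  then have "K + (*\<^sub>R) (0::real) ` L = K" by (simp add: set_plus_def)
  then show ?thesis using rel_quermass_volume[OF body assms, of 0] by simp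
qed

text \<open>The cubic polynomial and its upper bound agree at \<open>t = 0\<close>; dividing the
  difference by \<open>t\<close> and letting \<open>t\<close> tend to 0, then \<eta> to 0, compares
  the linear coefficients.\<close>

lemma rel_quermass_1_le:
  assumes Lb: "convex_body L" shows "rel_quermass K L 1 \<le> leb K * (\<integral>y. quot y \<partial>unif)"
proof -
  let ?E = "\<integral>y. quot y \<partial>unif"
  have "rel_quermass K L 1 \<le> leb K * (?E + \<eta>)" if \<eta>: "0 < \<eta>" for \<eta>
  proof -
    obtain C where C: "0 \<le> C" "\<And>t. 0 \<le> t \<Longrightarrow> t \<le> 1 \<Longrightarrow>
      leb (K + (*\<^sub>R) t ` L) \<le> leb K * (1 + 3 * t * (?E + \<eta>) + t\<^sup>2 * C)"
      by (rule volume_sum_le[OF \<eta>]) blast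
    have ev: "3 * rel_quermass K L 1 + 3 * rel_quermass K L 2 * t + rel_quermass K L 3 * t^2
        \<le> leb K * (3 * (?E + \<eta>) + t * C)" if t: "0 < t" "t \<le> 1" for t
    proof -
      have "leb K + 3 * rel_quermass K L 1 * t + 3 * rel_quermass K L 2 * t^2 + rel_quermass K L 3 * t^3
          \<le> leb K * (1 + 3 * t * (?E + \<eta>) + t\<^sup>2 * C)"
        using C(2)[of t] t rel_quermass_volume[OF body Lb, of t] rel_quermass_0[OF Lb] by simp
      then have "t * (3 * rel_quermass K L 1 + 3 * rel_quermass K L 2 * t + rel_quermass K L 3 * t^2)
          \<le> t * (leb K * (3 * (?E + \<eta>) + t * C))"
        by (simp add: algebra_simps power2_eq_square power3_eq_cube)
      then show ?thesis using t by simp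
    qed
    have "3 * rel_quermass K L 1 + 3 * rel_quermass K L 2 * 0 + rel_quermass K L 3 * 0^2
        \<le> leb K * (3 * (?E + \<eta>) + 0 * C)"
    proof (rule tendsto_le)
      show "((\<lambda>t::real. leb K * (3 * (?E + \<eta>) + t * C)) \<longlongrightarrow> leb K * (3 * (?E + \<eta>) + 0 * C)) (at_right 0)"
        by (intro tendsto_intros)
      show "((\<lambda>t::real. 3 * rel_quermass K L 1 + 3 * rel_quermass K L 2 * t + rel_quermass K L 3 * t^2)
          \<longlongrightarrow> 3 * rel_quermass K L 1 + 3 * rel_quermass K L 2 * 0 + rel_quermass K L 3 * 0^2) (at_right 0)"
        by (intro tendsto_intros)
      show "\<forall>\<^sub>F t in at_right 0. 3 * rel_quermass K L 1 + 3 * rel_quermass K L 2 * t + rel_quermass K L 3 * t^2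
        \<le> leb K * (3 * (?E + \<eta>) + t * C)"
        unfolding eventually_at_right_field by (rule exI[of _ 1]) (use ev in auto)
    qed simp
    then show ?thesis by (simp add: algebra_simps)
  qed
  then have "rel_quermass K L 1 \<le> leb K * ?E + e" if "0 < e" for e
    using that volume_pos by (metis (no_types, lifting) distrib_left divide_pos_pos less_numeral_extra(3) nonzero_mult_div_cancel_left times_divide_eq_right)
  then show ?thesis by (rule field_le_epsilon)
qed

end

end

section \<open>Main inequality\<close>

lemma scaled_sum_subset:
  fixes L :: "'a::real_vector set"
  assumes L: "convex L" and c: "0 \<le> c" "0 \<le> t" "0 < c + t"
  shows "(*\<^sub>R) c ` L + (*\<^sub>R) t ` L \<subseteq> (*\<^sub>R) (c + t) ` L"
proof
  fix z assume "z \<in> (*\<^sub>R) c ` L + (*\<^sub>R) t ` L"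
  then obtain x y where xy: "x \<in> L" "y \<in> L" "z = c *\<^sub>R x + t *\<^sub>R y" by (auto simp: set_plus_def)
  have "(c / (c + t)) *\<^sub>R x + (t / (c + t)) *\<^sub>R y \<in> L"
    by (rule convexD[OF L xy(1,2)]) (use c in \<open>auto simp: add_divide_distrib[symmetric]\<close>)
  moreover have "z = (c + t) *\<^sub>R ((c / (c + t)) *\<^sub>R x + (t / (c + t)) *\<^sub>R y)"
    using c(3) by (simp add: xy(3) scaleR_add_right)
  ultimately show "z \<in> (*\<^sub>R) (c + t) ` L" by blast
qed

lemma leb_scale: "leb ((*\<^sub>R) c ` S) = \<bar>c\<bar> ^ 3 * leb S" for S :: "(real^3) set"
  using measure_lebesgue_affine[of c 0 S] by simp

lemma origin_body_subset_dilate: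
  assumes K: "origin_body K" and L: "origin_body L"
  obtains c where "0 < c" "K \<subseteq> (*\<^sub>R) c ` L"
proof -
  interpret K: origin_body K by (rule K)
  interpret L: origin_body L by (rule L)
  define c where "c = K.outer_radius / L.inner_radius"
  have c: "0 < c" using K.outer_radius L.inner_radius by (simp add: c_def)
  have "x \<in> (*\<^sub>R) c ` L" if "x \<in> K" for x
  proof -
    have n: "norm x \<le> K.outer_radius" using that by (rule K.norm_le_outer)
    have "norm ((1 / c) *\<^sub>R x) = norm x / K.outer_radius * L.inner_radius"
      using K.outer_radius(1) L.inner_radius(1) by (simp add: c_def)
    also have "\<dots> \<le> 1 * L.inner_radius"
      using n K.outer_radius(1) L.inner_radius(1) by (intro mult_right_mono) auto
    finally have "(1 / c) *\<^sub>R x \<in> L" using L.inner_radius(2) by auto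
    moreover have "x = c *\<^sub>R ((1 / c) *\<^sub>R x)" using c by simp
    ultimately show ?thesis by blast
  qed
  then show thesis using that[OF c] by blast
qed

text \<open>Comparison at infinity. Inclusion of \<open>K\<close> in a dilate of \<open>L\<close>
  bounds the leading coefficient by \<open>leb L\<close>, so the cubic terms in the Brunn-Minkowski
  bound (k + t l)^3 can be removed and the quadratic coefficients compared as \<open>t\<close>
  grows.\<close>

lemma minkowski_second:
  fixes K L :: "(real^3) set"
  assumes K: "origin_body K" and L: "origin_body L"
  shows "root 3 (leb K) * (root 3 (leb L))\<^sup>2 \<le> rel_quermass K L 2"
proof -
  interpret K: origin_body K by (rule K)
  interpret L: origin_body L by (rule L)
  define k l where "k = root 3 (leb K)" and "l = root 3 (leb L)"
  have kl: "k ^ 3 = leb K" "l ^ 3 = leb L" "0 \<le> k" "0 \<le> l" by (simp_all add: k_def l_def)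
  define W where "W = rel_quermass K L"
  have V: "leb (K + (*\<^sub>R) t ` L) = k ^ 3 + 3 * W 1 * t + 3 * W 2 * t\<^sup>2 + W 3 * t ^ 3" if "0 \<le> t" for t
    using rel_quermass_volume[OF K.body L.body that] K.rel_quermass_0[OF L.compact L.origin_in L.body]
    by (simp add: W_def kl)
  obtain c where c: "0 < c" and Kc: "K \<subseteq> (*\<^sub>R) c ` L" by (rule origin_body_subset_dilate[OF K L])
  have lower: "(k + t * l) ^ 3 \<le> leb (K + (*\<^sub>R) t ` L)" if t: "0 \<le> t" for t
  proof -
    have "root DIM(real^3) (leb K) + root DIM(real^3) (leb ((*\<^sub>R) t ` L)) \<le> root DIM(real^3) (leb (K + (*\<^sub>R) t ` L))"
      by (rule brunn_minkowski_compact) (use K.compact K.nonempty L.nonempty in \<open>auto intro: compact_scaling L.compact\<close>)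
    then have "k + t * l \<le> root 3 (leb (K + (*\<^sub>R) t ` L))"
      using t by (simp add: leb_scale real_root_mult real_root_power_cancel k_def l_def)
    then have "(k + t * l) ^ 3 \<le> (root 3 (leb (K + (*\<^sub>R) t ` L))) ^ 3"
      using t kl by (intro power_mono) auto
    then show ?thesis by simp
  qed
  have upper: "leb (K + (*\<^sub>R) t ` L) \<le> (c + t) ^ 3 * l ^ 3" if t: "0 \<le> t" for t
  proof -
    have "K + (*\<^sub>R) t ` L \<subseteq> (*\<^sub>R) (c + t) ` L"
      using set_plus_mono2[OF Kc subset_refl] scaled_sum_subset[OF L.convex, of c t] c t by force
    then have "leb (K + (*\<^sub>R) t ` L) \<le> leb ((*\<^sub>R) (c + t) ` L)"
      by (intro measure_mono_fmeasurable fmeasurableD lmeasurable_compact compact_set_plus_scaled compact_scaling K.compact L.compact)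
    then show ?thesis using c t by (simp add: leb_scale kl)
  qed
  have lim: "((\<lambda>t. a / t) \<longlongrightarrow> 0) at_top" for a :: real
    by (rule real_tendsto_divide_at_top[OF tendsto_const filterlim_ident])
  have W3: "W 3 \<le> l ^ 3"
  proof -
    \<comment> \<open>The polynomial inequality divided by \<open>t ^ 3\<close>; the quotients are
      nested so that each correction tends to 0 by the same rule.\<close>
    have "0 \<le> (l ^ 3 - W 3) + (3 * c * l ^ 3 - 3 * W 2) / t + (3 * c\<^sup>2 * l ^ 3 - 3 * W 1) / t / t + (c ^ 3 * l ^ 3 - k ^ 3) / t / t / t"
      (is "0 \<le> ?r") if t: "0 < t" for t
    proof -
      have "t ^ 3 * ?r = (c + t) ^ 3 * l ^ 3 - (k ^ 3 + 3 * W 1 * t + 3 * W 2 * t\<^sup>2 + W 3 * t ^ 3)"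
        using t by (simp add: field_simps power2_eq_square power3_eq_cube)
      also have "\<dots> \<ge> 0" using upper[of t] V[of t] t by simp
      finally show ?thesis using t by (simp add: zero_le_mult_iff)
    qed
    then have ev: "\<forall>\<^sub>F t in at_top. 0 \<le> (l ^ 3 - W 3) + (3 * c * l ^ 3 - 3 * W 2) / t + (3 * c\<^sup>2 * l ^ 3 - 3 * W 1) / t / t + (c ^ 3 * l ^ 3 - k ^ 3) / t / t / t"
      using eventually_gt_at_top[of "0::real"] by (rule eventually_mono[rotated])
    have i: "filterlim (\<lambda>t::real. t) at_top at_top" by (rule filterlim_ident)
    have "((\<lambda>t. (l ^ 3 - W 3) + (3 * c * l ^ 3 - 3 * W 2) / t + (3 * c\<^sup>2 * l ^ 3 - 3 * W 1) / t / t + (c ^ 3 * l ^ 3 - k ^ 3) / t / t / t)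
        \<longlongrightarrow> (l ^ 3 - W 3) + 0 + 0 + 0) at_top"
      by (intro tendsto_add tendsto_const lim real_tendsto_divide_at_top[OF lim i]
          real_tendsto_divide_at_top[OF real_tendsto_divide_at_top[OF lim i] i])
    from tendsto_lowerbound[OF this ev] show ?thesis by simp
  qed
  have "0 \<le> (W 2 - k * l\<^sup>2) + (W 1 - k\<^sup>2 * l) / t" (is "0 \<le> ?r") if t: "0 < t" for t
  proof -
    have "W 3 * t ^ 3 \<le> l ^ 3 * t ^ 3" using W3 t by (intro mult_right_mono) auto
    then have "0 \<le> 3 * W 1 * t + 3 * W 2 * t\<^sup>2 - 3 * k\<^sup>2 * l * t - 3 * k * l\<^sup>2 * t\<^sup>2"
    proof -
      have "(k + t * l) ^ 3 = k ^ 3 + 3 * k\<^sup>2 * l * t + 3 * k * l\<^sup>2 * t\<^sup>2 + l ^ 3 * t ^ 3"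
        by (simp add: power2_eq_square power3_eq_cube algebra_simps)
      then show ?thesis using lower[of t] V[of t] t \<open>W 3 * t ^ 3 \<le> l ^ 3 * t ^ 3\<close> by linarith
    qed
    also have "\<dots> = 3 * t\<^sup>2 * ?r" using t by (simp add: field_simps power2_eq_square)
    finally show ?thesis using t by (simp add: zero_le_mult_iff)
  qed
  then have ev: "\<forall>\<^sub>F t in at_top. 0 \<le> (W 2 - k * l\<^sup>2) + (W 1 - k\<^sup>2 * l) / t"
    using eventually_gt_at_top[of "0::real"] by (rule eventually_mono[rotated])
  have "((\<lambda>t. (W 2 - k * l\<^sup>2) + (W 1 - k\<^sup>2 * l) / t) \<longlongrightarrow> (W 2 - k * l\<^sup>2) + 0) at_top"
    by (intro tendsto_add tendsto_const lim)
  from tendsto_lowerbound[OF this ev] show ?thesis by (simp add: W_def k_def l_def)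
qed

lemma concave_on_powr:
  assumes "0 < a" "0 \<le> p" "p \<le> 1"
  shows "concave_on {a..b} (\<lambda>x::real. x powr p)"
proof (rule f''_le0_imp_concave)
  fix x assume x: "x \<in> {a..b}"
  then have x0: "0 < x" using assms by simp
  show "((\<lambda>x. x powr p) has_real_derivative p * x powr (p - 1)) (at x)"
    using x0 by (auto intro!: derivative_eq_intros)
  show "((\<lambda>x. p * x powr (p - 1)) has_real_derivative p * ((p - 1) * x powr (p - 1 - 1))) (at x)"
    using x0 by (auto intro!: derivative_eq_intros)
  show "p * ((p - 1) * x powr (p - 1 - 1)) \<le> 0"
    using assms by (intro mult_nonneg_nonpos mult_nonpos_nonneg) auto
qed simp

lemma expectation_powr_ge:
  fixes f :: "'a \<Rightarrow> real"
  assumes M: "finite_measure M" "measure M (space M) = 1"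
    and f: "integrable M f" "integrable M (\<lambda>x. f x powr p)"
    and quad: "AE x in M. 0 < f x \<and> (f x)\<^sup>2 + q \<le> 2 * a * f x"
    and a: "a \<le> (\<integral>x. f x \<partial>M)" and q: "0 < q" and p: "0 < p" "p < 1"
  shows "q powr (p / 2) \<le> (\<integral>x. f x powr p \<partial>M)"
proof -
  interpret finite_measure M by (rule M(1))
  have one: "(\<integral>x. c \<partial>M) = c" for c :: real using M(2) by simp
  \<comment> \<open>A single point satisfying the quadratic bound already forces
    \<open>a > 0\<close> and q \<le> a^2, which makes the square root \<open>d\<close>
    meaningful.\<close>
  have "\<exists>x. 0 < f x \<and> (f x)\<^sup>2 + q \<le> 2 * a * f x"
  proof (rule ccontr)
    assume no: "\<not> ?thesis"
    have "AE x in M. False" using quad by eventually_elim (use no in blast)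
    then have "emeasure M (space M) = 0" by (simp only: eventually_False ae_filter_eq_bot_iff)
    then show False using M(2) by (simp add: measure_def)
  qed
  then obtain x0 where x0: "0 < f x0" "(f x0)\<^sup>2 + q \<le> 2 * a * f x0" by blast
  have "0 < 2 * a * f x0" using x0 q by (smt (verit) zero_le_power2)
  then have a0: "0 < a" using x0(1) by (simp add: zero_less_mult_iff)
  have "0 \<le> (f x0 - a)\<^sup>2" by simp
  then have aq: "q \<le> a\<^sup>2" using x0(2) by (simp add: power2_eq_square algebra_simps)
  define d where "d = sqrt (a\<^sup>2 - q)"
  have d: "0 \<le> d" "d\<^sup>2 = a\<^sup>2 - q" using aq by (simp_all add: d_def)
  have da: "d < a" using d q a0 by (intro power2_less_imp_less[of d a]) auto
  let ?lo = "a - d" and ?hi = "a + d"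
  have prod: "?lo * ?hi = q" using d(2) by (simp add: power2_eq_square algebra_simps)
  have range: "AE x in M. f x \<in> {?lo..?hi}"
    using quad
  proof eventually_elim
    case (elim x)
    have "(f x - a)\<^sup>2 \<le> d\<^sup>2" using elim unfolding d(2) by (simp add: power2_eq_square algebra_simps)
    then have "\<bar>f x - a\<bar> \<le> d" using d(1) by (metis abs_le_square_iff abs_of_nonneg)
    then show ?case by auto
  qed
  show ?thesis
  \<comment> \<open>For \<open>d = 0\<close> the interval is a point and the slope of the chord is
    undefined; \<open>f\<close> is then almost everywhere equal to \<open>a\<close>.\<close>
  proof (cases "d = 0")
    case True
    have "(\<integral>x. f x powr p \<partial>M) = (\<integral>x. a powr p \<partial>M)"
      by (rule integral_cong_AE) (use f range True in \<open>auto simp: borel_measurable_integrable\<close>)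
    moreover have "q = a powr 2" using True d(2) a0 by simp
    then have "q powr (p / 2) = a powr p" by (simp add: powr_powr)
    ultimately show ?thesis by (simp add: M(2))
  next
    case False
    then have dp: "0 < d" using d by simp
    let ?s = "(?hi powr p - ?lo powr p) / (2 * d)"
    have s: "0 \<le> ?s" using dp da p by (intro divide_nonneg_pos) (auto intro!: powr_mono2)
    have chord: "AE x in M. ?lo powr p + ?s * (f x - ?lo) \<le> f x powr p"
      using range
    proof eventually_elim
      case (elim x)
      have "concave_on {?lo..?hi} (\<lambda>x. x powr p)" using da p by (intro concave_on_powr) auto
      from concave_onD_Icc'[OF this elim] show ?case by (simp add: algebra_simps)
    qed
    have "(?lo powr p + ?hi powr p) / 2 = ?lo powr p + ?s * (a - ?lo)" using dp by (simp add: field_simps)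
    also have "\<dots> \<le> ?lo powr p + ?s * ((\<integral>x. f x \<partial>M) - ?lo)" using s a by (intro add_left_mono mult_left_mono) auto
    also have "\<dots> = (\<integral>x. ?lo powr p + ?s * (f x - ?lo) \<partial>M)" using f(1) M(2) by simp
    also have "\<dots> \<le> (\<integral>x. f x powr p \<partial>M)" by (rule integral_mono_AE[OF _ f(2) chord]) (use f(1) in simp)
    finally have "(?lo powr p + ?hi powr p) / 2 \<le> (\<integral>x. f x powr p \<partial>M)" .
    moreover have "sqrt (?lo powr p * ?hi powr p) \<le> (?lo powr p + ?hi powr p) / 2"
      by (rule arith_geo_mean_sqrt) auto
    moreover have "sqrt (?lo powr p * ?hi powr p) = q powr (p / 2)"
      using da dp by (simp add: powr_mult[symmetric] prod powr_half_sqrt[symmetric] powr_powr)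
    ultimately show ?thesis by simp
  qed
qed

theorem theorem3p5:
  fixes K L :: "(real^3) set" and p :: real
  assumes "convex_body K" and "convex_body L"
    and "0 < p" and "p < 1"
    and "in_R1_class K L"
  shows "(\<integral>u. (support_fun L u / support_fun K u) powr p \<partial>(cone_volume_prob K)) powr (1 / p)
           \<ge> (vol L / vol K) powr (1 / 3)
       \<and> (dilates K L \<longrightarrow>
           (\<integral>u. (support_fun L u / support_fun K u) powr p \<partial>(cone_volume_prob K)) powr (1 / p)
             = (vol L / vol K) powr (1 / 3))"
proof -
  have o: "0 \<in> interior K" "0 \<in> interior L" using assms(5) by (auto simp: in_R1_class_def interior_Int)
  interpret K: origin_body K by unfold_locales (use assms o in auto)
  interpret L: origin_body L by unfold_locales (use assms o in auto)
  let ?U = "uniform_measure lborel K" and ?f = "\<lambda>y. support_fun L (K.grad0 y)"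
  let ?I = "\<integral>u. (support_fun L u / support_fun K u) powr p \<partial>(cone_volume_prob K)"
  let ?W = "rel_quermass K L"
  note LL = L.compact L.origin_in
  have I: "?I = (\<integral>y. ?f y powr p \<partial>?U)" by (rule K.integral_cone_volume_prob[OF L.compact L.nonempty])
  have vK: "0 < leb K" and vL: "0 < leb L" by (rule K.volume_pos, rule L.volume_pos)
  have U1: "measure ?U (space ?U) = 1" using K.emeasure_uniform_UNIV by (simp add: measure_def)
  obtain M where M: "0 \<le> M" "\<And>y. ?f y \<le> M" by (rule K.quot_bounded[OF LL]) blast
  have fm: "?f \<in> borel_measurable borel" by (rule K.quot_measurable[OF LL])
  have f0: "0 \<le> ?f y" for y by (rule K.quot_nonneg[OF LL])
  have fi: "integrable ?U ?f" by (rule K.integrable_unif[OF LL fm, of M]) (use f0 M in simp)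
  have fpi: "integrable ?U (\<lambda>y. ?f y powr p)"
  proof (rule K.integrable_unif[OF LL, of _ "M powr p"])
    show "(\<lambda>y. ?f y powr p) \<in> borel_measurable borel" using fm by measurable
    show "\<bar>?f y powr p\<bar> \<le> M powr p" for y using f0 M assms(3) by (simp add: powr_mono2)
  qed
  have grad: "support_fun K (K.grad0 y) = 1" "0 < ?f y" if y: "y \<notin> K.singular" for y
  proof -
    have nz: "K.grad0 y \<noteq> 0" by (rule K.grad0_nonzero[OF y])
    have "support_fun K (K.grad0 y) = norm (K.grad0 y) * support_fun K (K.unit_normal y)"
      using support_fun_scale[OF K.compact K.nonempty, of "norm (K.grad0 y)" "K.unit_normal y"] y nz
      by (simp add: K.unit_normal_def)
    then show "support_fun K (K.grad0 y) = 1" using nz by (simp add: K.support_fun_unit_normal[OF y])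
    let ?n = "norm (K.grad0 y)"
    have "(L.inner_radius / ?n) *\<^sub>R K.grad0 y \<in> L"
      by (rule subsetD[OF L.inner_radius(2)]) (use L.inner_radius(1) nz in simp)
    from support_fun_upper[OF L.compact this, of "K.grad0 y"]
    have "L.inner_radius * ?n \<le> ?f y" using nz by (simp add: dot_square_norm power2_eq_square)
    moreover have "0 < L.inner_radius * ?n" using L.inner_radius(1) nz by simp
    ultimately show "0 < ?f y" by linarith
  qed
  have W0: "?W 0 = leb K" by (rule K.rel_quermass_0[OF LL assms(2)])
  have W1: "?W 1 / leb K \<le> (\<integral>y. ?f y \<partial>?U)"
    using K.rel_quermass_1_le[OF LL assms(2)] vK by (simp add: field_simps)
  have W2: "root 3 (leb K) * (root 3 (leb L))\<^sup>2 \<le> ?W 2"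
    by (rule minkowski_second) unfold_locales
  have W2pos: "0 < ?W 2" using W2 vK vL by (smt (verit) mult_pos_pos real_root_gt_zero zero_less_numeral zero_less_power)
  \<comment> \<open>Inclusions between \<open>K\<close> and dilates of \<open>L\<close> are compared
    through support functions at the gradient, where that of \<open>K\<close> is 1. This puts
    \<open>1 / ?f y\<close> between the relative radii, and the Bonnesen function there, multiplied
    by the square of \<open>?f y\<close>, is the quadratic bound.\<close>
  have quad: "0 < ?f y \<and> (?f y)\<^sup>2 + ?W 2 / leb K \<le> 2 * (?W 1 / leb K) * ?f y" if y: "y \<notin> K.singular" for y
  proof -
    have fp: "0 < ?f y" by (rule grad(2)[OF y])
    have "rel_inradius_o K L \<le> 1 / ?f y"
      unfolding rel_inradius_o_def
    proof (rule cSup_least)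
      have "(*\<^sub>R) 0 ` L \<subseteq> K" using K.origin_in by auto
      then have "0 \<in> {t. 0 \<le> t \<and> (*\<^sub>R) t ` L \<subseteq> K}" by (intro CollectI conjI) simp_all
      then show "{t. 0 \<le> t \<and> (*\<^sub>R) t ` L \<subseteq> K} \<noteq> {}" by blast
      fix t assume t: "t \<in> {t. 0 \<le> t \<and> (*\<^sub>R) t ` L \<subseteq> K}"
      then have "support_fun ((*\<^sub>R) t ` L) (K.grad0 y) \<le> support_fun K (K.grad0 y)"
        using L.nonempty by (intro support_fun_mono K.compact) auto
      then have "t * ?f y \<le> 1" using t by (simp add: support_fun_image_scale[OF L.compact L.nonempty] grad(1)[OF y])
      then show "t \<le> 1 / ?f y" using fp by (simp add: field_simps)
    qed
    moreover have "1 / ?f y \<le> rel_circumradius_o K L"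
      unfolding rel_circumradius_o_def
    proof (rule cInf_greatest)
      obtain c where "0 < c" "K \<subseteq> (*\<^sub>R) c ` L"
        by (rule origin_body_subset_dilate) unfold_locales
      then show "{t. 0 < t \<and> K \<subseteq> (*\<^sub>R) t ` L} \<noteq> {}" by blast
      fix t assume t: "t \<in> {t. 0 < t \<and> K \<subseteq> (*\<^sub>R) t ` L}"
      then have "support_fun K (K.grad0 y) \<le> support_fun ((*\<^sub>R) t ` L) (K.grad0 y)"
        using K.nonempty by (intro support_fun_mono compact_scaling L.compact) auto
      then have "1 \<le> t * ?f y" using t by (simp add: support_fun_image_scale[OF L.compact L.nonempty] grad(1)[OF y])
      then show "1 / ?f y \<le> t" using fp by (simp add: field_simps)
    qed
    ultimately have "0 \<le> bonnesen0 K L (1 / ?f y)" using assms(5) by (simp add: in_R1_class_def)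
    then have "0 \<le> (?f y)\<^sup>2 * (2 * ?W 1 * (1 / ?f y) - leb K - ?W 2 * (1 / ?f y)\<^sup>2)"
      unfolding bonnesen0_def W0 by simp
    also have "\<dots> = 2 * ?W 1 * ?f y - leb K * (?f y)\<^sup>2 - ?W 2"
      using fp by (simp add: field_simps power2_eq_square)
    finally have "leb K * (?f y)\<^sup>2 + ?W 2 \<le> 2 * ?W 1 * ?f y" by simp
    then have "(leb K * (?f y)\<^sup>2 + ?W 2) / leb K \<le> 2 * ?W 1 * ?f y / leb K" using vK by (intro divide_right_mono) auto
    then show ?thesis using fp vK by (simp add: add_divide_distrib)
  qed
  have "(?W 2 / leb K) powr (p / 2) \<le> ?I"
    unfolding I
  proof (rule expectation_powr_ge[OF K.finite_measure_uniform U1 fi fpi _ W1 _ assms(3,4)])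
    show "AE y in ?U. 0 < ?f y \<and> (?f y)\<^sup>2 + ?W 2 / leb K \<le> 2 * (?W 1 / leb K) * ?f y"
      using K.AE_uniform by eventually_elim (use quad in blast)
    show "0 < ?W 2 / leb K" using W2pos vK by simp
  qed
  then have "((?W 2 / leb K) powr (p / 2)) powr (1 / p) \<le> ?I powr (1 / p)"
    using assms(3) by (intro powr_mono2) auto
  then have ge: "(?W 2 / leb K) powr (1 / 2) \<le> ?I powr (1 / p)" using assms(3) by (simp add: powr_powr)
  let ?k = "root 3 (leb K)" and ?l = "root 3 (leb L)"
  have kl: "0 < ?k" "0 < ?l" "?k ^ 3 = leb K" "?l ^ 3 = leb L" using vK vL by simp_all
  have r: "(leb L / leb K) powr (1 / 3) = ?l / ?k"
    using vK vL root_powr_inverse[of 3 "leb L / leb K"] by (simp add: real_root_divide)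
  have "(?l / ?k)\<^sup>2 = ?k * ?l\<^sup>2 / ?k ^ 3" using kl(1) by (simp add: power2_eq_square power3_eq_cube)
  also have "\<dots> \<le> ?W 2 / leb K" unfolding kl(3) using W2 vK by (intro divide_right_mono) auto
  finally have "?l / ?k \<le> sqrt (?W 2 / leb K)" by (rule real_le_rsqrt)
  also have "\<dots> = (?W 2 / leb K) powr (1 / 2)" using W2pos vK by (simp add: powr_half_sqrt)
  finally have main: "(leb L / leb K) powr (1 / 3) \<le> ?I powr (1 / p)" using ge r by linarith
  have "?I powr (1 / p) = (leb L / leb K) powr (1 / 3)" if dil: "dilates K L"
  proof -
    obtain c where c: "0 < c" "K = (*\<^sub>R) c ` L" using dil by (auto simp: dilates_def)
    \<comment> \<open>For a dilate the integrand is constant off \<open>singular\<close>, so the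
      mean reduces to \<open>1 / c\<close>, the cube root of the volume ratio.\<close>
    have fc: "?f y = 1 / c" if y: "y \<notin> K.singular" for y
    proof -
      have "support_fun K (K.grad0 y) = c * ?f y"
        unfolding c(2) by (rule support_fun_image_scale[OF L.compact L.nonempty]) (use c in simp)
      then show ?thesis using grad(1)[OF y] c(1) by (simp add: field_simps)
    qed
    have "AE y in ?U. ?f y powr p = (1 / c) powr p" using K.AE_uniform by eventually_elim (simp add: fc)
    then have "?I = (\<integral>y. (1 / c) powr p \<partial>?U)"
      unfolding I by (rule integral_cong_AE[rotated 2]) (use fm in simp_all)
    also have "\<dots> = (1 / c) powr p" using U1 by simp
    finally have "?I powr (1 / p) = 1 / c" using assms(3) c(1) by (simp add: powr_powr)
    moreover have "leb K = c ^ 3 * leb L" using c by (simp add: leb_scale)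
    then have "?k = c * ?l" using c(1) by (simp add: real_root_mult real_root_power_cancel)
    then have "?l / ?k = 1 / c" using kl c(1) by simp
    ultimately show ?thesis using r by simp
  qed
  with main show ?thesis by blast
qed

end
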